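(* Let $G=C_2^4\oplus C_{2n}$ with $n>70$ odd. Then $\nu(G)=\nu_2 (G)=\mathsf d (G)-1$.
   Context: $C_m$ denotes the cyclic group of order $m$. For a finite abelian group $G$ (written additively) let $G^{\bullet} = G\setminus\{0\}$. A sequence over $G$ is a finite unordered sequence of elements of $G$ with repetition allowed (an element of the free abelian monoid with basis $G$, written multiplicatively; the empty sequence is allowed); $|T|$ is the length of $T$, and $\Sigma(T)$ is the set of all sums of nonempty subsequences of $T$. $T$ is zero-sum free if $0\notin\Sigma(T)$. $\mathsf d(G)$ is the maximal length of a zero-sum free sequence over $G$. For nontrivial $G$, $\nu(G)$ is the smallest integer $\ell$ such that for every zero-sum free sequence $T$ over $G$ with $|T|\ge \ell$ there are a subgroup $H\subsetneq G$ and some $\alpha\in G\setminus H$ with $G^{\bullet}\setminus\Sigma(T)\subseteq\alpha+H$. For a prime divisor $p$ of $|G|$, $\nu_p(G)$ is the smallest integer $\ell$ such that for every zero-sum free sequence $T$ over $G$ with $|T|\ge\ell$ there are a subgroup $H\subseteq G$ with index $(G:H)=p$ and some $\alpha\in G\setminus H$ with $G^{\bullet}\setminus\Sigma(T)\subseteq\alpha+H$. *)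

theory Defs
  imports "HOL-Algebra.Algebra" "HOL-Library.Multiset"
begin

(* Finite abelian groups are those of HOL-Algebra, hence written multiplicatively:
   \<one> plays the role of 0, \<otimes> of +, and the coset \<alpha> + H is \<alpha> <# H.
   Sequences (elements of the free abelian monoid with basis G) are multisets over
   the carrier, with multiset inclusion as the subsequence relation. *)

definition seq_over :: "('a, 'b) monoid_scheme \<Rightarrow> 'a multiset \<Rightarrow> bool" where
  "seq_over G T \<longleftrightarrow> set_mset T \<subseteq> carrier G"

(* The type-level multiset folds do not apply: \<otimes> is commutative only on the carrier. *)
definition seq_sum :: "('a, 'b) monoid_scheme \<Rightarrow> 'a multiset \<Rightarrow> 'a" where
  "seq_sum G T = (\<Otimes>\<^bsub>G\<^esub> g \<in> set_mset T. g [^]\<^bsub>G\<^esub> count T g)"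

definition subseq_sums :: "('a, 'b) monoid_scheme \<Rightarrow> 'a multiset \<Rightarrow> 'a set" where
  "subseq_sums G T = {seq_sum G S | S. S \<subseteq># T \<and> S \<noteq> {#}}"

definition zero_sum_free :: "('a, 'b) monoid_scheme \<Rightarrow> 'a multiset \<Rightarrow> bool" where
  "zero_sum_free G T \<longleftrightarrow> seq_over G T \<and> \<one>\<^bsub>G\<^esub> \<notin> subseq_sums G T"

(* For finite G the lengths of zero-sum free sequences form a finite nonempty set
   (the empty sequence is zero-sum free), so the maximum exists. *)
definition small_davenport :: "('a, 'b) monoid_scheme \<Rightarrow> nat" where
  "small_davenport G = Max {size T | T. zero_sum_free G T}"

definition nonzero_elems :: "('a, 'b) monoid_scheme \<Rightarrow> 'a set" where
  "nonzero_elems G = carrier G - {\<one>\<^bsub>G\<^esub>}"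

(* For finite G the condition holds vacuously once l exceeds small_davenport G,
   so the least l exists. *)
definition nu :: "('a, 'b) monoid_scheme \<Rightarrow> nat" where
  "nu G = (LEAST l. \<forall>T. zero_sum_free G T \<and> l \<le> size T \<longrightarrow>
     (\<exists>H \<alpha>. subgroup H G \<and> H \<subset> carrier G \<and> \<alpha> \<in> carrier G - H \<and>
        nonzero_elems G - subseq_sums G T \<subseteq> \<alpha> <#\<^bsub>G\<^esub> H))"

definition nu_prime :: "nat \<Rightarrow> ('a, 'b) monoid_scheme \<Rightarrow> nat" where
  "nu_prime p G = (LEAST l. \<forall>T. zero_sum_free G T \<and> l \<le> size T \<longrightarrow>
     (\<exists>H \<alpha>. subgroup H G \<and> card (rcosets\<^bsub>G\<^esub> H) = p \<and> \<alpha> \<in> carrier G - H \<and>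
        nonzero_elems G - subseq_sums G T \<subseteq> \<alpha> <#\<^bsub>G\<^esub> H))"

end

(* Write G = C_2^5 + C_n and call the C_2^5-component of an element its label. Removing two
   elements from a longest zero-sum free sequence gives nu(G) >= d(G) - 1, and a sequence of
   length 2n + 4 is written down, so it suffices that for zero-sum free T of length 2n + 3 the
   elements g with T + g zero-sum free have labels in the complement of a hyperplane.

   Pairing elements with equal labels yields a zero-sum free sequence of length at least n - 14
   over C_n; by Scherk's theorem at least n - 27 of its terms coincide and may be scaled to 1.
   Hence T contains some e with 2e = (0, 1), and trading subsequences J with sum f e, f >= |J|,
   for |J| copies of e keeps T and all T + g zero-sum free. When no such J is left, the labels of
   the other elements, taken modulo that of e, form a configuration in F_2^4 in which every
   nonempty zero-sum set J has a value f(J) in [1, |J| - 1], with f linear modulo 2. Points on two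
   lines then have value 0 or 1, and an analysis of nine points in PG(3,2) shows that at most
   eight elements other than e remain. The few remaining cases are settled by noting that d independent
   zero-sum sets, all of whose nonempty symmetric differences have the same value, cut out
   2^d - 1 nonempty atoms. *)
theory Submission
  imports Defs "HOL-Number_Theory.Cong" "HOL-Library.Z2" "HOL-Library.Product_Plus"
begin

section \<open>Words over elementary abelian 2-groups\<close>

text \<open>No value of the Davenport constant is assumed: the coset property at length 2n + 3
  bounds every zero-sum free sequence by 2n + 4, and the explicit sequence makes this sharp. The
  elements g cannot be treated one at a time, because a single hyperplane has to serve all of them.
  The element e has nonzero label and 2e = (0, 1), hence order 2n, so a word whose label is 0 or
  that of e equals f copies of e, and the m copies of e that are present force f \<le> 2n - 1 - m.
  As m < 2n, at least 4 other elements remain, say s of them, and f \<le> s - 4 holds also for words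
  through g. The bound s \<le> 8 is the case r = 4 of the statement that labels of rank r \<le> 4
  with 1 \<le> f(J) < |J| on all words have at most 2r members. Up to rank 3 either two labels
  coincide and can be contracted, or every point lies on two lines; nine of the fifteen points of
  PG(3,2) need not have this property, which is the obstacle in rank 4. The bound n > 70 leaves room
  for what pairing loses: 32 unmatched labels, then n - 14, n - 27 and 2n - 55.\<close>

class char_two = ab_group_add +
  assumes add_self [simp]: "a + a = 0"
begin

lemma add_self_left [simp]: "a + (a + b) = b"
  by (simp flip: add.assoc)

lemma add_eq_iff: "a + b = c \<longleftrightarrow> a = b + c"
  by (metis add.commute add_self_left)

lemma add_eq_0_iff_eq: "a + b = 0 \<longleftrightarrow> a = b"
  by (metis add_eq_iff add.right_neutral)

end

instance bit :: char_two
  by standard simp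

instance prod :: (char_two, char_two) char_two
  by standard (auto simp: plus_prod_def zero_prod_def)

lemma sym_diff_sym_diff: "sym_diff I (sym_diff I J) = J"
  by blast

lemma inj_on_sym_diff: "inj_on (sym_diff I) W"
  by (rule inj_on_inverseI[where g = "sym_diff I"]) (rule sym_diff_sym_diff)

lemma sum_sym_diff:
  fixes c :: "'i \<Rightarrow> 'v::char_two"
  assumes "finite I" "finite J"
  shows "sum c (sym_diff I J) = sum c I + sum c J"
proof -
  have "sum c (sym_diff I J) = sum c (I - J) + sum c (J - I)"
    by (rule sum.union_disjoint) (use assms in auto)
  moreover have "sum c I = sum c (I - J) + sum c (I \<inter> J)"
    using sum.Int_Diff[OF assms(1), of c J] by (simp add: add.commute)
  moreover have "sum c J = sum c (J - I) + sum c (I \<inter> J)"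
    using sum.Int_Diff[OF assms(2), of c I] by (simp add: add.commute Int_commute)
  ultimately show ?thesis
    by (simp add: ac_simps)
qed

lemma sum_sym_diff_int:
  fixes y :: "'i \<Rightarrow> int"
  assumes "finite I" "finite J"
  shows "sum y (sym_diff I J) = sum y I + sum y J - 2 * sum y (I \<inter> J)"
proof -
  have "sum y (sym_diff I J) = sum y (I - J) + sum y (J - I)"
    by (rule sum.union_disjoint) (use assms in auto)
  moreover have "sum y I = sum y (I - J) + sum y (I \<inter> J)"
    using sum.Int_Diff[OF assms(1), of y J] by (simp add: add.commute)
  moreover have "sum y J = sum y (J - I) + sum y (I \<inter> J)"
    using sum.Int_Diff[OF assms(2), of y I] by (simp add: add.commute Int_commute)
  ultimately show ?thesis
    by simp
qed

definition subgrp :: "'v::char_two set \<Rightarrow> bool" where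
  "subgrp H \<longleftrightarrow> 0 \<in> H \<and> (\<forall>a\<in>H. \<forall>b\<in>H. a + b \<in> H)"

lemma subgrp_0: "subgrp H \<Longrightarrow> 0 \<in> H"
  and subgrp_add: "subgrp H \<Longrightarrow> a \<in> H \<Longrightarrow> b \<in> H \<Longrightarrow> a + b \<in> H"
  by (auto simp: subgrp_def)

lemma subgrp_sum: "subgrp H \<Longrightarrow> (\<And>i. i \<in> J \<Longrightarrow> c i \<in> H) \<Longrightarrow> sum c J \<in> H"
  by (induction J rule: infinite_finite_induct) (auto simp: subgrp_0 subgrp_add)

lemma subgrp_cancel: "subgrp H \<Longrightarrow> a \<in> H \<Longrightarrow> a + b \<in> H \<longleftrightarrow> b \<in> H"
  by (metis subgrp_add add_self_left)

lemma subgrp_extend: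
  assumes "subgrp H"
  shows "subgrp (H \<union> (+) a ` H)"
  unfolding subgrp_def
proof (intro conjI ballI)
  show "0 \<in> H \<union> (+) a ` H" using assms by (simp add: subgrp_0)
next
  fix x y assume "x \<in> H \<union> (+) a ` H" "y \<in> H \<union> (+) a ` H"
  then obtain h k where hk: "h \<in> H" "k \<in> H" "x = h \<or> x = a + h" "y = k \<or> y = a + k" by blast
  have "h + k \<in> H" using hk assms by (simp add: subgrp_add)
  moreover have "x + y = h + k \<or> x + y = a + (h + k)" using hk(3,4) by (auto simp: ac_simps)
  ultimately show "x + y \<in> H \<union> (+) a ` H" by fastforce
qed

lemma card_subgrp_extend:
  assumes "subgrp H" "finite H" "a \<notin> H"
  shows "card (H \<union> (+) a ` H) = 2 * card H"
proof -
  have "a \<in> H" if "h \<in> H" "a + h \<in> H" for h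
    using subgrp_add[OF assms(1) that(2,1)] by (simp add: add.assoc)
  then have "H \<inter> (+) a ` H = {}"
    using assms(3) by auto
  then show ?thesis
    using assms by (simp add: card_Un_disjoint card_image inj_on_def)
qed

text \<open>A subgroup of maximal size among those containing \<open>H0\<close> and avoiding
  \<open>b\<close> has index two: if neither \<open>v\<close> nor \<open>v + b\<close> belonged to
  it, adjoining \<open>v\<close> would double it and still avoid \<open>b\<close>.\<close>

lemma subgrp_index_two:
  fixes H0 :: "'v::{char_two,finite} set"
  assumes "subgrp H0" "b \<notin> H0"
  obtains H where "subgrp H" "H0 \<subseteq> H" "b \<notin> H" "\<And>v. v \<in> H \<or> v + b \<in> H"
proof -
  let ?P = "\<lambda>H. subgrp H \<and> H0 \<subseteq> H \<and> b \<notin> H"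
  obtain H where H: "?P H" and max: "\<And>H'. ?P H' \<Longrightarrow> card H' \<le> card H"
  proof -
    have "\<forall>H. ?P H \<longrightarrow> card H < Suc (card (UNIV::'v set))"
      by (simp add: card_mono le_imp_less_Suc)
    then have "\<exists>H. ?P H \<and> (\<forall>H'. ?P H' \<longrightarrow> card H' \<le> card H)"
      by (intro ex_has_greatest_nat) (use assms in auto)
    then show thesis
      using that by auto
  qed
  have "v \<in> H \<or> v + b \<in> H" for v
  proof (rule ccontr)
    assume *: "\<not> ?thesis"
    let ?H = "H \<union> (+) v ` H"
    have "subgrp ?H" using H subgrp_extend by blast
    moreover have "b \<notin> ?H"
      using * H by auto
    ultimately have "card ?H \<le> card H" using max H by auto
    moreover have "card ?H = 2 * card H" using card_subgrp_extend[of H v] * H by simp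
    moreover have "card H > 0" using H by (auto simp: card_gt_0_iff subgrp_def)
    ultimately show False by simp
  qed
  then show thesis using that H by blast
qed

text \<open>Pigeonhole: if no nonempty subset sum lies in \<open>H\<close>, the sums over distinct
  subsets of \<open>E\<close> lie in distinct cosets of \<open>H\<close>, which needs
  \<open>2 ^ card E * card H\<close> elements of \<open>K\<close>.\<close>

lemma ex_word:
  fixes q :: "'i \<Rightarrow> 'v::char_two"
  assumes "finite E" "subgrp H" "subgrp K" "finite K" "H \<subseteq> K" "q ` E \<subseteq> K"
    and "card K < 2 ^ card E * card H"
  shows "\<exists>J\<subseteq>E. J \<noteq> {} \<and> sum q J \<in> H"
proof (rule ccontr)
  assume *: "\<not> ?thesis"
  let ?f = "\<lambda>(J, h). sum q J + h"
  have "inj_on ?f (Pow E \<times> H)"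
  proof (rule inj_onI, clarify)
    fix I h J k assume I: "I \<subseteq> E" "h \<in> H" "J \<subseteq> E" "k \<in> H" and eq: "sum q I + h = sum q J + k"
    have fin: "finite I" "finite J" using I assms(1) finite_subset by auto
    have "sum q (sym_diff I J) = h + k"
      using eq unfolding sum_sym_diff[OF fin] by (metis add.assoc add.commute add_eq_iff)
    then have "sum q (sym_diff I J) \<in> H" using I assms by (simp add: subgrp_add)
    moreover have "sym_diff I J \<subseteq> E" using I by auto
    ultimately have "sym_diff I J = {}" using * by blast
    then have "I = J" by auto
    then show "I = J \<and> h = k" using eq by auto
  qed
  moreover have "?f ` (Pow E \<times> H) \<subseteq> K"
    using assms by (auto intro!: subgrp_add[of K] subgrp_sum[of K])
  ultimately have "card (Pow E \<times> H) \<le> card K"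
    using assms(4) card_inj_on_le by blast
  moreover have "card (Pow E \<times> H) = 2 ^ card E * card H"
    using assms(1) by (simp add: card_cartesian_product card_Pow)
  ultimately show False using assms by linarith
qed

text \<open>The kernel of the linear map taking J to \<open>sum c J\<close> on the power set of
  \<open>E\<close> under symmetric difference: a binary code with the labels as columns of a parity
  check matrix.\<close>

definition words :: "('i \<Rightarrow> 'v::char_two) \<Rightarrow> 'i set \<Rightarrow> 'i set set" where
  "words c E = {J. J \<subseteq> E \<and> sum c J = 0}"

lemma words_finite: "finite E \<Longrightarrow> finite (words c E)"
  by (auto simp: words_def)

lemma words_sym_diff: "finite E \<Longrightarrow> I \<in> words c E \<Longrightarrow> J \<in> words c E \<Longrightarrow> sym_diff I J \<in> words c E"
  by (auto simp: words_def sum_sym_diff finite_subset)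

lemma empty_words: "{} \<in> words c E"
  by (auto simp: words_def)

text \<open>Translation by one member of a fibre of the label sum injects that fibre into the
  kernel, and at most \<open>card K\<close> fibres cover the power set.\<close>

lemma card_words:
  fixes c :: "'i \<Rightarrow> 'v::char_two"
  assumes "finite E" "finite K" "subgrp K" "c ` E \<subseteq> K"
  shows "2 ^ card E \<le> card (words c E) * card K"
proof -
  have fib: "card {J. J \<subseteq> E \<and> sum c J = v} \<le> card (words c E)" for v
  proof (cases "\<exists>J0\<subseteq>E. sum c J0 = v")
    case True
    then obtain J0 where J0: "J0 \<subseteq> E" "sum c J0 = v" by blast
    have "sym_diff J0 ` {J. J \<subseteq> E \<and> sum c J = v} \<subseteq> words c E"
    proof (rule image_subsetI)
      fix J assume "J \<in> {J. J \<subseteq> E \<and> sum c J = v}"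
      then have J: "J \<subseteq> E" "sum c J = v" by auto
      have "sum c (sym_diff J0 J) = 0"
        using sum_sym_diff[of J0 J c] J J0 assms(1) by (simp add: finite_subset)
      then show "sym_diff J0 J \<in> words c E" using J J0 by (auto simp: words_def)
    qed
    then show ?thesis
      by (rule card_inj_on_le[OF inj_on_sym_diff _ words_finite[OF assms(1)]])
  next
    case False
    then have "{J. J \<subseteq> E \<and> sum c J = v} = {}" by blast
    then show ?thesis by (simp only: card.empty)
  qed
  have "sum c J \<in> K" if "J \<subseteq> E" for J
    using that assms(4) by (intro subgrp_sum[OF assms(3)]) blast
  then have "Pow E \<subseteq> (\<Union>v\<in>K. {J. J \<subseteq> E \<and> sum c J = v})"
    by blast
  then have "card (Pow E) \<le> card (\<Union>v\<in>K. {J. J \<subseteq> E \<and> sum c J = v})"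
    by (rule card_mono[rotated]) (use assms(1,2) in simp)
  also have "\<dots> \<le> (\<Sum>v\<in>K. card {J. J \<subseteq> E \<and> sum c J = v})"
    by (rule card_UN_le) (rule assms(2))
  also have "\<dots> \<le> (\<Sum>v\<in>K. card (words c E))"
    by (rule sum_mono) (rule fib)
  also have "\<dots> = card (words c E) * card K"
    by simp
  finally show ?thesis using assms(1) by (simp add: card_Pow)
qed

lemma card_closed_family:
  fixes W :: "'i set set"
  assumes fin: "finite W" and closed: "\<And>I J. I \<in> W \<Longrightarrow> J \<in> W \<Longrightarrow> sym_diff I J \<in> W"
    and V: "V \<subseteq> W" "\<And>I J. I \<in> V \<Longrightarrow> J \<in> V \<Longrightarrow> sym_diff I J \<in> V" and N: "N \<in> W" "N \<notin> V"
  shows "2 * card V \<le> card W"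
proof -
  have finV: "finite V" using fin V(1) finite_subset by blast
  have "card (sym_diff N ` V) = card V" by (rule card_image) (rule inj_on_sym_diff)
  moreover have "V \<inter> sym_diff N ` V = {}"
  proof (rule ccontr)
    assume "\<not> ?thesis"
    then obtain I J where IJ: "I \<in> V" "J \<in> V" "I = sym_diff N J" by blast
    then have "N = sym_diff J I" using sym_diff_sym_diff[of J N] by (simp add: Un_commute)
    then show False using V(2)[OF IJ(2,1)] N(2) by simp
  qed
  moreover have "V \<union> sym_diff N ` V \<subseteq> W"
  proof (intro Un_least V(1) image_subsetI)
    fix J assume "J \<in> V" then show "sym_diff N J \<in> W" using closed[OF N(1)] V(1) by (meson subsetD)
  qed
  ultimately show ?thesis
    using card_mono[OF fin, of "V \<union> sym_diff N ` V"] card_Un_disjoint[OF finV, of "sym_diff N ` V"] finV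
    by simp
qed

section \<open>Atoms of a family of sets with constant weight\<close>

lemma cong_half:
  fixes a b n :: int
  assumes "odd n" "[2 * a = 2 * b] (mod n)"
  shows "[a = b] (mod n)"
  using assms by (metis cong_mult_lcancel coprime_commute coprime_left_2_iff_odd)

text \<open>For d = k + 1 independent members, inclusion-exclusion and division by 2 give each of
  the 2^d - 1 atoms the weight \<beta>, so each atom leaves \<open>D\<close>. The induction builds
  no atoms: it passes to the traces of half of \<open>W\<close> on \<open>E - I\<close> and on
  \<open>I - {i0}\<close>, which have one dimension less.\<close>

lemma atoms:
  fixes n \<beta> :: int and y :: "'i \<Rightarrow> int" and W :: "'i set set"
  assumes "odd n" "\<not> n dvd \<beta>"
    and "finite E" "W \<subseteq> Pow E" "\<And>I J. I \<in> W \<Longrightarrow> J \<in> W \<Longrightarrow> sym_diff I J \<in> W"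
    and "2 ^ Suc k \<le> card W"
    and "\<And>J. J \<in> W \<Longrightarrow> J \<noteq> {} \<Longrightarrow> [sum y J = 2 ^ k * \<beta>] (mod n)"
    and "\<And>S. S \<subseteq> D \<Longrightarrow> S \<noteq> {} \<Longrightarrow> \<not> [sum y S = \<beta>] (mod n)"
  shows "2 ^ Suc k \<le> card (E - D) + 1"
  using assms(3-7)
proof (induction k arbitrary: E W)
  case 0
  have "\<not> W \<subseteq> {{}}"
    using card_mono[of "{{}}" W] 0(4) by auto
  then obtain J where J: "J \<in> W" "J \<noteq> {}" by blast
  then have "\<not> J \<subseteq> D" using assms(8)[of J] 0(5)[of J] by auto
  then obtain i where "i \<in> E - D" using J 0(2) by blast
  then have "card (E - D) > 0" using 0(1) by (auto simp: card_gt_0_iff)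
  then show ?case by simp
next
  case (Suc k)
  note closed = Suc.prems(3) and val = Suc.prems(5)
  have finW: "finite W" using Suc.prems(1,2) finite_subset by auto
  have fin: "finite J" if "J \<in> W" for J using that Suc.prems(1,2) by (meson PowD finite_subset subsetD)
  have "\<not> W \<subseteq> {{}}"
  proof
    assume "W \<subseteq> {{}}"
    then have "card W \<le> 1" using card_mono[of "{{}}" W] by simp
    moreover have "(1::nat) \<le> 2 ^ k" by simp
    ultimately show False using Suc.prems(4) unfolding power_Suc by linarith
  qed
  then obtain I where I: "I \<in> W" "I \<noteq> {}" by blast
  have IE: "I \<subseteq> E" using I Suc.prems(2) by auto
  \<comment> \<open>\<open>I\<close>, \<open>J\<close> and their symmetric difference have the same
    weight, so the intersection has half of it.\<close>
  have inter: "[sum y (I \<inter> J) = 2 ^ k * \<beta>] (mod n)" if J: "J \<in> W" "J \<noteq> {}" "J \<noteq> I" for J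
  proof -
    have ne: "sym_diff I J \<noteq> {}" using J(3) by blast
    have "2 * sum y (I \<inter> J) = sum y I + sum y J - sum y (sym_diff I J)"
      using sum_sym_diff_int[of I J y] fin I J by simp
    also have "[\<dots> = 2 ^ Suc k * \<beta> + 2 ^ Suc k * \<beta> - 2 ^ Suc k * \<beta>] (mod n)"
      by (intro cong_add cong_diff val I J closed ne)
    finally have "[2 * sum y (I \<inter> J) = 2 * (2 ^ k * \<beta>)] (mod n)"
      by (simp add: ac_simps)
    then show ?thesis using cong_half assms(1) by blast
  qed
  have diff: "[sum y (J - I) = 2 ^ k * \<beta>] (mod n)" if J: "J \<in> W" "J \<noteq> {}" "J \<noteq> I" for J
  proof -
    have "sum y (J - I) = sum y J - sum y (I \<inter> J)"
      using sum.Int_Diff[OF fin[OF J(1)], of y I] by (simp add: Int_commute)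
    also have "[\<dots> = 2 ^ Suc k * \<beta> - 2 ^ k * \<beta>] (mod n)"
      by (intro cong_diff val J inter)
    finally show ?thesis by (simp add: ac_simps)
  qed
  have nz: "\<not> [0 = 2 ^ k * \<beta>] (mod n)"
  proof
    assume "[0 = 2 ^ k * \<beta>] (mod n)"
    then have "n dvd 2 ^ k * \<beta>" using cong_0_iff cong_sym by blast
    moreover have "coprime n (2 ^ k)" using assms(1) by (simp add: coprime_commute)
    ultimately show False using assms(2) coprime_dvd_mult_right_iff by blast
  qed
  have step: "2 ^ Suc k \<le> card ((E - I) - D) + 1" "2 ^ Suc k \<le> card ((I - {i0}) - D) + 1" if i0: "i0 \<in> I" for i0
  proof -
    \<comment> \<open>Members missing \<open>i0\<close> make up half of \<open>W\<close> and exclude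
      \<open>I\<close> itself. Hence the nonempty ones have traces of nonzero weight, and both
      traces are injective on \<open>V\<close>.\<close>
    define V where "V = {J \<in> W. i0 \<notin> J}"
    have Vcl: "sym_diff J J' \<in> V" if "J \<in> V" "J' \<in> V" for J J'
    proof -
      have "sym_diff J J' \<in> W" "i0 \<notin> sym_diff J J'" using closed[of J J'] that unfolding V_def by blast+
      then show ?thesis unfolding V_def by blast
    qed
    have "W \<subseteq> V \<union> sym_diff I ` V"
    proof
      fix J assume J: "J \<in> W"
      show "J \<in> V \<union> sym_diff I ` V"
      proof (cases "i0 \<in> J")
        case True
        then have "sym_diff I J \<in> V" using closed[OF I(1) J] i0 by (auto simp: V_def)
        moreover have "J = sym_diff I (sym_diff I J)" by (rule sym_diff_sym_diff[symmetric])
        ultimately show ?thesis by blast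
      qed (use J in \<open>auto simp: V_def\<close>)
    qed
    then have "card W \<le> card V + card (sym_diff I ` V)"
      using card_mono[of "V \<union> sym_diff I ` V" W] card_Un_le[of V "sym_diff I ` V"] finW by (simp add: V_def)
    also have "\<dots> = 2 * card V"
      by (simp add: card_image[OF inj_on_sym_diff])
    finally have cardV: "2 ^ Suc k \<le> card V" using Suc.prems(4) by simp
    have inj1: "inj_on (\<lambda>J. J - I) V"
    proof (rule inj_onI, rule ccontr)
      fix J J' assume J: "J \<in> V" "J' \<in> V" "J - I = J' - I" "J \<noteq> J'"
      let ?N = "sym_diff J J'"
      have N: "?N \<in> W" "?N \<noteq> {}" "?N \<noteq> I" "?N - I = {}"
        using Vcl[OF J(1,2)] J i0 by (auto simp: V_def)
      show False using diff[OF N(1-3)] nz unfolding N(4) sum.empty by blast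
    qed
    have inj2: "inj_on (\<lambda>J. J \<inter> I) V"
    proof (rule inj_onI, rule ccontr)
      fix J J' assume J: "J \<in> V" "J' \<in> V" "J \<inter> I = J' \<inter> I" "J \<noteq> J'"
      let ?N = "sym_diff J J'"
      have N: "?N \<in> W" "?N \<noteq> {}" "?N \<noteq> I" "I \<inter> ?N = {}"
        using Vcl[OF J(1,2)] J i0 by (auto simp: V_def)
      show False using inter[OF N(1-3)] nz unfolding N(4) sum.empty by blast
    qed
    show "2 ^ Suc k \<le> card ((E - I) - D) + 1"
    proof (rule Suc.IH[of "E - I" "(\<lambda>J. J - I) ` V"])
      show "2 ^ Suc k \<le> card ((\<lambda>J. J - I) ` V)" using cardV by (simp add: card_image inj1)
      show "(\<lambda>J. J - I) ` V \<subseteq> Pow (E - I)" using Suc.prems(2) by (auto simp: V_def)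
      show "sym_diff A B \<in> (\<lambda>J. J - I) ` V"
        if AB: "A \<in> (\<lambda>J. J - I) ` V" "B \<in> (\<lambda>J. J - I) ` V" for A B
      proof -
        obtain J J' where J: "J \<in> V" "J' \<in> V" "A = J - I" "B = J' - I" using AB by blast
        have "sym_diff A B = sym_diff J J' - I" using J by blast
        then show ?thesis using Vcl[OF J(1,2)] by (rule image_eqI)
      qed
      show "[sum y A = 2 ^ k * \<beta>] (mod n)" if A: "A \<in> (\<lambda>J. J - I) ` V" "A \<noteq> {}" for A
      proof -
        obtain J where J: "J \<in> V" "A = J - I" using A by blast
        then have "J \<in> W" "J \<noteq> {}" "J \<noteq> I" using A by (auto simp: V_def)
        then show ?thesis using diff J(2) by blast
      qed
    qed (use Suc.prems(1) in simp)
    show "2 ^ Suc k \<le> card ((I - {i0}) - D) + 1"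
    proof (rule Suc.IH[of "I - {i0}" "(\<lambda>J. J \<inter> I) ` V"])
      show "2 ^ Suc k \<le> card ((\<lambda>J. J \<inter> I) ` V)" using cardV by (simp add: card_image inj2)
      show "(\<lambda>J. J \<inter> I) ` V \<subseteq> Pow (I - {i0})" by (auto simp: V_def)
      show "sym_diff A B \<in> (\<lambda>J. J \<inter> I) ` V"
        if AB: "A \<in> (\<lambda>J. J \<inter> I) ` V" "B \<in> (\<lambda>J. J \<inter> I) ` V" for A B
      proof -
        obtain J J' where J: "J \<in> V" "J' \<in> V" "A = J \<inter> I" "B = J' \<inter> I" using AB by blast
        have "sym_diff A B = sym_diff J J' \<inter> I" using J by blast
        then show ?thesis using Vcl[OF J(1,2)] by (rule image_eqI)
      qed
      show "[sum y A = 2 ^ k * \<beta>] (mod n)" if A: "A \<in> (\<lambda>J. J \<inter> I) ` V" "A \<noteq> {}" for A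
      proof -
        obtain J where J: "J \<in> V" "A = I \<inter> J" using A by blast
        then have "J \<in> W" "J \<noteq> {}" "J \<noteq> I" using A i0 by (auto simp: V_def)
        then show ?thesis using inter J(2) by blast
      qed
    qed (use fin I in simp)
  qed
  \<comment> \<open>Otherwise the count for the trace on \<open>I\<close> already fails. So
    \<open>i0\<close> can be taken outside \<open>D\<close>, and it supplies the last atom: twice
    \<open>2 ^ Suc k - 1\<close>, plus 1.\<close>
  have "\<not> I \<subseteq> D"
  proof
    assume "I \<subseteq> D"
    moreover obtain i where "i \<in> I" using I by blast
    moreover have e: "I - {i} - D = {}" using calculation by blast
    moreover have "(1::nat) \<le> 2 ^ k" by simp
    ultimately show False using step(2)[of i] unfolding power_Suc e card.empty by linarith
  qed
  then obtain i0 where i0: "i0 \<in> I" "i0 \<notin> D" by blast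
  have "card (E - D) = card ((E - I) - D) + card (I - D)"
  proof -
    have "E - D = ((E - I) - D) \<union> (I - D)" using IE by blast
    then show ?thesis
      using card_Un_disjoint[of "(E - I) - D" "I - D"] Suc.prems(1) fin[OF I(1)] by fastforce
  qed
  moreover have "card (I - D) = Suc (card ((I - {i0}) - D))"
  proof -
    have "I - D = insert i0 ((I - {i0}) - D)" using i0 by blast
    then show ?thesis using fin[OF I(1)] by (metis DiffD1 DiffE card_insert_disjoint finite_Diff singletonI)
  qed
  ultimately show ?case using step[OF i0(1)] by simp
qed

section \<open>Word systems of small rank\<close>

lemma cong_imp_eq_small:
  fixes a b n :: int
  assumes "[a = b] (mod n)" "\<bar>a - b\<bar> < n"
  shows "a = b"
  using assms by (metis abs_0_eq cong_iff_dvd_diff dvd_imp_le_int abs_of_pos eq_iff_diff_eq_0 less_le_not_le abs_ge_zero le_less_trans)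

text \<open>In a contraction, a and b are the values of the two completions of an odd word and k is
  the value it receives. Since b - a is the same for all odd words, so is k - a.\<close>

lemma parity_shift:
  fixes k1 k2 j :: int
  assumes "a1 + b1 = 2 * k1 + 1" "a2 + b2 = 2 * k2 + 1" "b1 - a1 = b2 - a2" "even (a1 + j + a2)"
  shows "even (k1 + j + k2)"
  using assms by presburger

text \<open>Labels are read modulo \<open>H\<close>, and the rank is that of \<open>K\<close> modulo
  \<open>H\<close>; a contraction can then enlarge \<open>H\<close> instead of changing the vector
  space. \<open>parity\<close> is linearity modulo 2, and \<open>n_large\<close> turns congruences
  between values of words into equalities.\<close>

locale word_system =
  fixes n :: int and x :: "'i \<Rightarrow> int" and q :: "'i \<Rightarrow> 'v::char_two"
    and H K :: "'v set" and E :: "'i set"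
  assumes odd_n: "odd n" and n_large: "4 * int (card E) < n"
    and finE: "finite E" and finK: "finite K"
    and subH: "subgrp H" and subK: "subgrp K" and HK: "H \<subseteq> K" and qE: "q ` E \<subseteq> K"
    and range: "\<And>J. J \<subseteq> E \<Longrightarrow> J \<noteq> {} \<Longrightarrow> sum q J \<in> H \<Longrightarrow>
      1 \<le> sum x J mod n \<and> sum x J mod n < int (card J)"
    and parity: "\<And>I J. I \<subseteq> E \<Longrightarrow> J \<subseteq> E \<Longrightarrow> sum q I \<in> H \<Longrightarrow> sum q J \<in> H \<Longrightarrow>
      even (sum x I mod n + sum x J mod n + sum x (sym_diff I J) mod n)"
begin

abbreviation F :: "'i set \<Rightarrow> int" where "F J \<equiv> sum x J mod n"

lemma finite_sub: "J \<subseteq> E \<Longrightarrow> finite J"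
  using finE finite_subset by blast

lemma F_unique:
  assumes "[sum x J = k] (mod n)" "0 \<le> k" "k < n"
  shows "F J = k"
  using assms by (simp add: cong_def)

lemma card_le_E: "J \<subseteq> E \<Longrightarrow> card J \<le> card E"
  using finE card_mono by blast

lemma q_notin: "i \<in> E \<Longrightarrow> q i \<notin> H"
  using range[of "{i}"] by fastforce

text \<open>Linearity modulo 2 makes half of \<open>F I + F J - F (sym_diff I J)\<close> an integer
  of controlled size, not merely a residue.\<close>

lemma sum_inter:
  assumes "I \<subseteq> E" "J \<subseteq> E" "sum q I \<in> H" "sum q J \<in> H"
  obtains k where "F I + F J - F (sym_diff I J) = 2 * k" "[sum x (I \<inter> J) = k] (mod n)"
proof -
  have "even (F I + F J - F (sym_diff I J))"
    using parity[OF assms] by simp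
  then obtain k where k: "F I + F J - F (sym_diff I J) = 2 * k" by (rule evenE)
  have "2 * sum x (I \<inter> J) = sum x I + sum x J - sum x (sym_diff I J)"
    using sum_sym_diff_int[OF finite_sub finite_sub, OF assms(1,2), of x] by simp
  also have "[\<dots> = F I + F J - F (sym_diff I J)] (mod n)"
    by (intro cong_add cong_diff) (simp_all add: cong_def)
  finally have "[2 * sum x (I \<inter> J) = 2 * k] (mod n)" by (simp only: k)
  then have "[sum x (I \<inter> J) = k] (mod n)" using cong_half odd_n by blast
  with k show thesis using that by blast
qed

text \<open>The lines meet in \<open>p\<close> only. Words of sizes 3, 3 and 4 put 2k between 1 + 1
  - 3 and 2 + 2 - 1, which leaves k = 0 and k = 1.\<close>

lemma two_lines:
  assumes "{p, a, b, c, d} \<subseteq> E" "distinct [p, a, b, c, d]"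
    and "q p + q a + q b \<in> H" "q p + q c + q d \<in> H"
  shows "[x p = 0] (mod n) \<or> [x p = 1] (mod n)"
proof -
  let ?I = "{p, a, b}" and ?J = "{p, c, d}"
  have I: "?I \<subseteq> E" "?J \<subseteq> E" using assms(1) by auto
  have q: "sum q ?I \<in> H" "sum q ?J \<in> H" using assms(2-4) by (auto simp: add.assoc)
  have sd: "sym_diff ?I ?J = {a, b, c, d}" and int: "?I \<inter> ?J = {p}" using assms(2) by auto
  have qs: "sum q {a, b, c, d} \<in> H"
    using sum_sym_diff[OF finite_sub finite_sub, OF I, of q] subgrp_add[OF subH q] by (simp only: sd)
  obtain k where k: "F ?I + F ?J - F {a, b, c, d} = 2 * k" "[sum x {p} = k] (mod n)"
    using sum_inter[OF I q] unfolding sd int by blast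
  have "1 \<le> F ?I" "F ?I < 3" "1 \<le> F ?J" "F ?J < 3"
    using range[OF I(1) _ q(1)] range[OF I(2) _ q(2)] assms(2) by auto
  moreover have "1 \<le> F {a, b, c, d}" "F {a, b, c, d} < 4"
    using range[OF _ _ qs] assms(1,2) by auto
  ultimately have "k = 0 \<or> k = 1" using k(1) by linarith
  then show ?thesis using k(2) by auto
qed

text \<open>A word inside \<open>Z\<close> would have value 0 or its own size, both outside the
  allowed range; so the labels of \<open>Z\<close> are independent modulo \<open>H\<close>.\<close>

lemma same_value_bound:
  assumes "Z \<subseteq> E" "v = 0 \<or> v = 1" "\<And>i. i \<in> Z \<Longrightarrow> [x i = v] (mod n)"
  shows "2 ^ card Z * card H \<le> card K"
proof (rule ccontr)
  assume "\<not> ?thesis"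
  moreover have "q ` Z \<subseteq> K" using qE assms(1) by blast
  ultimately obtain J where J: "J \<subseteq> Z" "J \<noteq> {}" "sum q J \<in> H"
    using ex_word[of Z H K q] finite_sub[OF assms(1)] subH subK finK HK by (auto simp: not_le)
  have JE: "J \<subseteq> E" using J assms by blast
  have "[sum x J = (\<Sum>i\<in>J. v)] (mod n)"
    by (rule cong_sum) (use J assms(3) in blast)
  then have "F J = v * int (card J)"
    using assms(2) n_large card_le_E[OF JE] by (intro F_unique) (auto simp: mult.commute)
  then show False using range[OF JE J(2,3)] assms(2) by (elim disjE) simp_all
qed

lemma zero_one_bound:
  assumes "Z \<subseteq> E" "\<And>i. i \<in> Z \<Longrightarrow> [x i = 0] (mod n) \<or> [x i = 1] (mod n)" "2 * m < card Z + 2"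
  shows "2 ^ m * card H \<le> card K"
proof -
  let ?Z0 = "{i\<in>Z. [x i = 0] (mod n)}" and ?Z1 = "{i\<in>Z. [x i = 1] (mod n)}"
  have fin: "finite Z" using finite_sub assms(1) by blast
  have "Z \<subseteq> ?Z0 \<union> ?Z1" using assms(2) by blast
  then have "card Z \<le> card (?Z0 \<union> ?Z1)" by (rule card_mono[rotated]) (use fin in simp)
  also have "\<dots> \<le> card ?Z0 + card ?Z1" by (rule card_Un_le)
  finally have "m \<le> card ?Z0 \<or> m \<le> card ?Z1" using assms(3) by linarith
  moreover have "2 ^ card ?Z0 * card H \<le> card K"
    by (rule same_value_bound[of _ 0]) (use assms(1) in blast)+
  moreover have "2 ^ card ?Z1 * card H \<le> card K"
    by (rule same_value_bound[of _ 1]) (use assms(1) in blast)+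
  moreover have "2 ^ m * card H \<le> 2 ^ l * card H" if "m \<le> l" for l
    using that by (simp add: power_increasing)
  ultimately show ?thesis using le_trans by blast
qed

text \<open>Labels avoid \<open>H\<close>, so pairwise incongruent ones occupy different nonzero
  cosets of \<open>H\<close> in \<open>K\<close>, of which there are too few.\<close>

lemma ex_double:
  assumes "card K < card E * card H + card H"
  obtains a b where "a \<in> E" "b \<in> E" "a \<noteq> b" "q a + q b \<in> H"
proof (rule ccontr)
  assume "\<not> thesis"
  then have nd: "\<And>a b. a \<in> E \<Longrightarrow> b \<in> E \<Longrightarrow> a \<noteq> b \<Longrightarrow> q a + q b \<notin> H" using that by blast
  let ?f = "\<lambda>(i, h). q i + h"
  have inj: "inj_on ?f (E \<times> H)"
  proof (rule inj_onI, clarify)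
    fix a h b k assume *: "a \<in> E" "h \<in> H" "b \<in> E" "k \<in> H" "q a + h = q b + k"
    then have "q a + q b = h + k" by (metis add.assoc add.commute add_eq_iff)
    then have "a = b" using nd[of a b] subgrp_add[OF subH] * by metis
    then show "a = b \<and> h = k" using * by simp
  qed
  have "?f ` (E \<times> H) \<subseteq> K - H"
  proof clarsimp
    fix a h assume *: "a \<in> E" "h \<in> H"
    have "q a \<notin> H" using q_notin * by blast
    then have "q a + h \<notin> H" using * subgrp_cancel[OF subH] by (metis add.commute)
    moreover have "q a + h \<in> K" using * qE HK by (intro subgrp_add[OF subK]) auto
    ultimately show "q a + h \<in> K \<and> q a + h \<notin> H" by blast
  qed
  then have "card (E \<times> H) \<le> card (K - H)"
    using card_inj_on_le[OF inj] finK by blast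
  also have "\<dots> = card K - card H" using HK finK by (simp add: card_Diff_subset finite_subset)
  finally have "card E * card H \<le> card K - card H" by (simp add: card_cartesian_product)
  moreover have "card H \<le> card K" using HK finK card_mono by blast
  ultimately show False using assms by linarith
qed

text \<open>The pair has value 1, so the completions of an odd word \<open>J\<close> by
  \<open>a\<close> and by \<open>b\<close> have values of odd sum 2k + 1. Both lie in [1, |J|], and
  oddness of the sum excludes the extremes, so k, the value of \<open>J\<close>, lies in
  [1, |J| - 1]. The rank drops by one and the size by two.\<close>

lemma contract:
  assumes ab: "a \<in> E" "b \<in> E" "a \<noteq> b" "q a + q b \<in> H"
  shows "word_system n x q (H \<union> (+) (q a) ` H) K (E - {a, b})"
proof -
  let ?E = "E - {a, b}" and ?H = "H \<union> (+) (q a) ` H"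
  have memH: "v \<in> ?H \<longleftrightarrow> v \<in> H \<or> q a + v \<in> H" for v
    by (auto simp: image_iff add_eq_iff) (metis add_self_left)
  have sqab: "q b + v \<in> H \<longleftrightarrow> q a + v \<in> H" for v
    using subgrp_cancel[OF subH ab(4), of "q a + v"] by (simp add: ac_simps)
  have one: "F {a, b} = 1"
    using range[of "{a, b}"] ab by auto
  define odd_w where "odd_w J \<longleftrightarrow> J \<subseteq> ?E \<and> q a + sum q J \<in> H" for J
  have ins: "insert i J \<subseteq> E" "sum q (insert i J) \<in> H" "card (insert i J) = Suc (card J)"
      "sum x (insert i J) = x i + sum x J"
    if J: "odd_w J" "i = a \<or> i = b" for i J
  proof -
    have "J \<subseteq> ?E" "q a + sum q J \<in> H" "q b + sum q J \<in> H" using J sqab by (auto simp: odd_w_def)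
    moreover have "finite J" "i \<notin> J" using finite_sub[of J] calculation(1) J(2) by auto
    ultimately show "insert i J \<subseteq> E" "sum q (insert i J) \<in> H" "card (insert i J) = Suc (card J)"
      "sum x (insert i J) = x i + sum x J"
      using ab J(2) by auto
  qed
  have fr: "1 \<le> F (insert i J)" "F (insert i J) \<le> int (card J)" if "odd_w J" "i = a \<or> i = b" for i J
    using range[of "insert i J"] ins[OF that] by auto
  have pa: "odd (F (insert a J) + F (insert b J))" if "odd_w J" for J
  proof -
    have sd: "sym_diff (insert a J) (insert b J) = {a, b}" using that ab by (auto simp: odd_w_def)
    have "even (F (insert a J) + F (insert b J) + F (sym_diff (insert a J) (insert b J)))"
      by (rule parity) (use ins(1,2)[OF that] in blast)+
    then have "even (F (insert a J) + F (insert b J) + F {a, b})" unfolding sd .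
    then show ?thesis using one by simp
  qed
  have val: "\<exists>k. F (insert a J) + F (insert b J) = 2 * k + 1 \<and> 1 \<le> k \<and> k < int (card J) \<and> F J = k"
    if J: "odd_w J" for J
  proof -
    obtain k where k: "F (insert a J) + F (insert b J) = 2 * k + 1"
      using pa[OF J] by (rule oddE)
    have k2: "1 \<le> k" "k < int (card J)" using k fr[OF J, of a] fr[OF J, of b] by auto
    have "[2 * k + 1 = sum x (insert a J) + sum x (insert b J)] (mod n)"
      unfolding k[symmetric] by (intro cong_add) (simp_all add: cong_def)
    also have "sum x (insert a J) + sum x (insert b J) = 2 * sum x J + sum x {a, b}"
      using ins[OF J] ab by simp
    also have "[\<dots> = 2 * sum x J + F {a, b}] (mod n)"
      by (intro cong_add) (simp_all add: cong_def)
    finally have "[2 * sum x J = 2 * k] (mod n)"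
      unfolding one by (metis cong_add_rcancel cong_sym)
    then have "[sum x J = k] (mod n)" using cong_half odd_n by blast
    moreover have "card J \<le> card E" using card_le_E J by (auto simp: odd_w_def)
    ultimately have "F J = k" using k2 n_large by (intro F_unique) auto
    then show ?thesis using k k2 by blast
  qed
  \<comment> \<open>Both sides are \<open>x b - x a\<close> modulo \<open>n\<close> and small, hence
    equal integers; this is the constant that \<open>parity_shift\<close> needs.\<close>
  have diff: "F (insert b I) - F (insert a I) = F (insert b J) - F (insert a J)"
    if I: "odd_w I" and J: "odd_w J" for I J
  proof (rule cong_imp_eq_small)
    have "[F (insert b J) - F (insert a J) = sum x (insert b J) - sum x (insert a J)] (mod n)" for J
      by (intro cong_diff) (simp_all add: cong_def)
    moreover have "sum x (insert b J) - sum x (insert a J) = x b - x a" if "odd_w J" for J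
      using ins(4)[OF that] by simp
    ultimately have "[F (insert b J) - F (insert a J) = x b - x a] (mod n)" if "odd_w J" for J
      using that by metis
    then show "[F (insert b I) - F (insert a I) = F (insert b J) - F (insert a J)] (mod n)"
      using I J by (meson cong_sym cong_trans)
    have "card I \<le> card E" "card J \<le> card E" using card_le_E I J by (auto simp: odd_w_def)
    then show "\<bar>F (insert b I) - F (insert a I) - (F (insert b J) - F (insert a J))\<bar> < n"
      using fr[OF I disjI1[OF refl]] fr[OF I disjI2[OF refl]] fr[OF J disjI1[OF refl]]
        fr[OF J disjI2[OF refl]] n_large by linarith
  qed
  have par10: "even (F I + F J + F (sym_diff I J))" if I: "odd_w I" and J: "J \<subseteq> ?E" "sum q J \<in> H" for I J
  proof -
    have fin: "finite I" "finite J" using I J finite_sub[of I] finite_sub[of J] by (auto simp: odd_w_def)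
    have S: "odd_w (sym_diff I J)"
      using I J sum_sym_diff[OF fin, of q] subgrp_add[OF subH]
      by (auto simp: odd_w_def simp flip: add.assoc)
    have sd: "sym_diff (insert a I) J = insert a (sym_diff I J)" using J by auto
    have "even (F (insert a I) + F J + F (sym_diff (insert a I) J))"
      by (rule parity) (use ins(1,2)[OF I] J in blast)+
    then have "even (F (insert a I) + F J + F (insert a (sym_diff I J)))" unfolding sd .
    moreover obtain k1 k2 where "F (insert a I) + F (insert b I) = 2 * k1 + 1" "F I = k1"
      "F (insert a (sym_diff I J)) + F (insert b (sym_diff I J)) = 2 * k2 + 1" "F (sym_diff I J) = k2"
      using val[OF I] val[OF S] by blast
    ultimately show ?thesis using parity_shift[of _ _ k1 _ _ k2] diff[OF I S] by metis
  qed
  have par11: "even (F I + F J + F (sym_diff I J))" if I: "odd_w I" and J: "odd_w J" for I J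
  proof -
    have sd: "sym_diff (insert a I) (insert a J) = sym_diff I J" using I J by (auto simp: odd_w_def)
    have "even (F (insert a I) + F (insert a J) + F (sym_diff (insert a I) (insert a J)))"
      by (rule parity) (use ins(1,2)[OF I] ins(1,2)[OF J] in blast)+
    then have "even (F (insert a I) + F (insert a J) + F (sym_diff I J))" unfolding sd .
    then have "even (F (insert a I) + F (sym_diff I J) + F (insert a J))" by (simp only: ac_simps)
    moreover obtain k1 k2 where "F (insert a I) + F (insert b I) = 2 * k1 + 1" "F I = k1"
      "F (insert a J) + F (insert b J) = 2 * k2 + 1" "F J = k2"
      using val[OF I] val[OF J] by blast
    ultimately have "even (F I + F (sym_diff I J) + F J)"
      using parity_shift[of _ _ k1 _ _ k2] diff[OF I J] by metis
    then show ?thesis by (simp only: ac_simps)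
  qed
  show ?thesis
  proof unfold_locales
    show "4 * int (card ?E) < n" using n_large card_le_E[OF Diff_subset, of "{a, b}"] by linarith
    show "subgrp ?H" by (rule subgrp_extend[OF subH])
    show "?H \<subseteq> K" using HK qE ab subgrp_add[OF subK] by blast
    show "q ` ?E \<subseteq> K" using qE by blast
    show "1 \<le> F J \<and> F J < int (card J)" if "J \<subseteq> ?E" "J \<noteq> {}" "sum q J \<in> ?H" for J
    proof (cases "sum q J \<in> H")
      case True
      then show ?thesis using range[of J] that by blast
    next
      case False
      then have "odd_w J" using that memH by (auto simp: odd_w_def)
      then show ?thesis using val by blast
    qed
    show "even (F I + F J + F (sym_diff I J))"
      if IJ: "I \<subseteq> ?E" "J \<subseteq> ?E" "sum q I \<in> ?H" "sum q J \<in> ?H" for I J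
    proof -
      have cI: "sum q I \<in> H \<or> odd_w I" and cJ: "sum q J \<in> H \<or> odd_w J"
        using IJ memH by (auto simp: odd_w_def)
      have comm: "sym_diff J I = sym_diff I J" by blast
      show ?thesis
        using cI cJ par11[of I J] par10[of I J] par10[of J I] parity[of I J] IJ(1,2) unfolding comm
        by (auto simp: add.commute)
    qed
  qed (use odd_n finE finK subK in auto)
qed

end

text \<open>For r = 1 and r = 2 the 2r + 1 labels outnumber the 2^r - 1 nonzero cosets, so two
  coincide, and contraction keeps the shape 2r + 1. For r = 3 both numbers are 7, which makes that
  case separate.\<close>

lemma word_system_le_two:
  assumes "word_system n x q H K E" "card K = 2 ^ r * card H" "r \<le> 2" "card E = 2 * r + 1"
  shows False
  using assms
proof (induction r arbitrary: H E)
  case 0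
  interpret word_system n x q H K E by (rule 0)
  have "card K = card H" using 0 by simp
  then have "H = K" using HK finK card_subset_eq by metis
  moreover obtain i where "i \<in> E" using 0 by fastforce
  ultimately show False using q_notin qE by blast
next
  case (Suc r)
  interpret word_system n x q H K E by (rule Suc)
  have finH: "finite H" using HK finK finite_subset by blast
  have "0 < card H" using subgrp_0[OF subH] finH card_gt_0_iff by blast
  moreover have "r = 0 \<or> r = 1" using Suc.prems by auto
  ultimately have "card K < card E * card H + card H"
    using Suc.prems(2,4) by auto
  then obtain a b where ab: "a \<in> E" "b \<in> E" "a \<noteq> b" "q a + q b \<in> H" by (rule ex_double)
  show False
  proof (rule Suc.IH[OF contract[OF ab]])
    have "card (H \<union> (+) (q a) ` H) = 2 * card H"
      using card_subgrp_extend[OF subH finH q_notin[OF ab(1)]] .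
    then show "card K = 2 ^ r * card (H \<union> (+) (q a) ` H)" using Suc.prems(2) by simp
    show "card (E - {a, b}) = 2 * r + 1"
      using Suc.prems(4) ab finE by (simp add: card_Diff_subset)
  qed (use Suc.prems in simp)
qed

text \<open>With seven pairwise inequivalent labels every pair of labels lies on a line, as in the Fano plane.\<close>

lemma word_system_three:
  assumes "word_system n x q H K E" "card K = 8 * card H" "card E = 7"
  shows False
proof -
  interpret word_system n x q H K E by (rule assms)
  have finH: "finite H" using HK finK finite_subset by blast
  have Hpos: "0 < card H" using subgrp_0[OF subH] finH card_gt_0_iff by blast
  show False
  proof (cases "\<exists>a\<in>E. \<exists>b\<in>E. a \<noteq> b \<and> q a + q b \<in> H")
    case True
    then obtain a b where ab: "a \<in> E" "b \<in> E" "a \<noteq> b" "q a + q b \<in> H" by blast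
    show False
    proof (rule word_system_le_two[OF contract[OF ab], of 2])
      have "card (H \<union> (+) (q a) ` H) = 2 * card H"
        using card_subgrp_extend[OF subH finH q_notin[OF ab(1)]] .
      then show "card K = 2 ^ 2 * card (H \<union> (+) (q a) ` H)" using assms(2) by simp
      show "card (E - {a, b}) = 2 * 2 + 1"
        using assms(3) ab finE by (simp add: card_Diff_subset)
    qed simp
  next
    case False
    then have nd: "q i + q j \<notin> H" if "i \<in> E" "j \<in> E" "i \<noteq> j" for i j using that by blast
    \<comment> \<open>If \<open>q a + q b\<close> were congruent to no label, it would represent an
      eighth nonzero coset; the index \<open>None\<close> stands for it.\<close>
    have line: "\<exists>c\<in>E. q a + q b + q c \<in> H" if "a \<in> E" "b \<in> E" "a \<noteq> b" for a b
    proof (rule ccontr)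
      assume no: "\<not> ?thesis"
      let ?q = "\<lambda>i. case i of None \<Rightarrow> q a + q b | Some i \<Rightarrow> q i"
      let ?E = "insert None (Some ` E)"
      let ?f = "\<lambda>(i, h). ?q i + h"
      have dist: "?q i + ?q j \<notin> H" if "i \<in> ?E" "j \<in> ?E" "i \<noteq> j" for i j
        using that no False by (auto simp: ac_simps split: option.splits)
      have nH: "?q i \<notin> H" if "i \<in> ?E" for i
        using that False \<open>a \<in> E\<close> \<open>b \<in> E\<close> \<open>a \<noteq> b\<close> q_notin by (auto split: option.splits)
      have inj: "inj_on ?f (?E \<times> H)"
      proof (rule inj_onI, clarify)
        fix i h j k assume *: "i \<in> ?E" "h \<in> H" "j \<in> ?E" "k \<in> H" "?q i + h = ?q j + k"
        then have "?q i + ?q j = h + k" by (metis add.assoc add.commute add_eq_iff)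
        then have "i = j" using dist[OF *(1,3)] subgrp_add[OF subH *(2,4)] by metis
        then show "i = j \<and> h = k" using * by simp
      qed
      have img: "?f ` (?E \<times> H) \<subseteq> K - H"
      proof (rule image_subsetI)
        fix z assume "z \<in> ?E \<times> H"
        then obtain i h where z: "z = (i, h)" "i \<in> ?E" "h \<in> H" by blast
        have "?q i + h \<notin> H" using nH[OF z(2)] z subgrp_cancel[OF subH z(3), of "?q i"] by (simp add: add.commute)
        moreover have "?q i \<in> K"
          using z(2) qE \<open>a \<in> E\<close> \<open>b \<in> E\<close> subgrp_add[OF subK, of "q a" "q b"]
          by (auto simp: image_subset_iff)
        then have "?q i + h \<in> K" using z HK subgrp_add[OF subK] by blast
        ultimately show "?f z \<in> K - H" using z by simp
      qed
      have "card (?E \<times> H) \<le> card (K - H)"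
        by (rule card_inj_on_le[OF inj img]) (use finK in simp)
      also have "\<dots> = 7 * card H" using HK finK finH assms(2) by (simp add: card_Diff_subset)
      finally have "card ?E * card H \<le> 7 * card H" by (simp only: card_cartesian_product)
      moreover have "card ?E = 8" using finE assms(3) by (simp add: card_image)
      ultimately show False using Hpos by simp
    qed
    have line3: "\<exists>c\<in>E. c \<noteq> a \<and> c \<noteq> b \<and> q a + q b + q c \<in> H" if ab: "a \<in> E" "b \<in> E" "a \<noteq> b" for a b
    proof -
      obtain c where c: "c \<in> E" "q a + q b + q c \<in> H" using line[OF ab] by blast
      have "c \<noteq> a" using c(2) q_notin[OF ab(2)] by (auto simp: ac_simps)
      moreover have "c \<noteq> b" using c(2) q_notin[OF ab(1)] by (auto simp: ac_simps)
      ultimately show ?thesis using c by blast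
    qed
    have "[x p = 0] (mod n) \<or> [x p = 1] (mod n)" if p: "p \<in> E" for p
    proof -
      have "\<not> E \<subseteq> {p}" using card_mono[of "{p}" E] assms(3) by auto
      then obtain a where a: "a \<in> E" "a \<noteq> p" by blast
      obtain b where b: "b \<in> E" "b \<noteq> p" "b \<noteq> a" "q p + q a + q b \<in> H"
        using line3[OF p a(1)] a by metis
      have "card {p, a, b} = 3" using a b by auto
      then have "\<not> E \<subseteq> {p, a, b}" using card_mono[of "{p, a, b}" E] assms(3) by fastforce
      then obtain c where c: "c \<in> E" "c \<notin> {p, a, b}" by blast
      obtain d where d: "d \<in> E" "d \<noteq> p" "d \<noteq> c" "q p + q c + q d \<in> H"
        using line3[OF p c(1)] c by auto
      \<comment> \<open>Two lines through \<open>p\<close> that share another point coincide, and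
        \<open>c\<close> was chosen off the first line.\<close>
      have "d \<noteq> a \<and> d \<noteq> b"
      proof (rule ccontr)
        assume *: "\<not> ?thesis"
        have "(q p + q a + q b) + (q p + q c + q d) \<in> H" using subgrp_add[OF subH b(4) d(4)] .
        then have "(d = a \<and> q b + q c \<in> H) \<or> (d = b \<and> q a + q c \<in> H)" using * by (auto simp: ac_simps)
        moreover have "q b + q c \<notin> H" "q a + q c \<notin> H" using nd[OF b(1) c(1)] nd[OF a(1) c(1)] c(2) by auto
        ultimately show False by blast
      qed
      then have "{p, a, b, c, d} \<subseteq> E" "distinct [p, a, b, c, d]"
        using p a b(1-3) c d(1-3) by auto
      then show ?thesis by (rule two_lines[OF _ _ b(4) d(4)])
    qed
    \<comment> \<open>Among seven values 0 or 1 four agree, and four labels cannot be independent in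
      rank 3.\<close>
    then have "2 ^ 4 * card H \<le> card K"
      by (rule zero_one_bound[OF order_refl]) (simp_all add: assms(3))
    then show False using assms(2) Hpos by simp
  qed
qed

section \<open>Nine points of PG(3,2)\<close>

lemma ex_notin:
  assumes "card B < card A" "finite B"
  obtains a where "a \<in> A" "a \<notin> B"
  using assms card_mono[of B A] by (metis leD subsetI)

text \<open>For injective labels the label can serve as index. Then \<open>M\<close> is a set of
  points of a projective space, and words are the subsets with sum 0.\<close>

locale vector_words = word_system n x "\<lambda>v. v" "{0}" K M
  for n :: int and x :: "'v::char_two \<Rightarrow> int" and K M
begin

lemma MK: "M \<subseteq> K" and zero_notin: "0 \<notin> M"
  using qE q_notin by auto

lemma finM: "finite M" by (rule finE)

lemma F_range:
  assumes "J \<subseteq> M" "J \<noteq> {}" "\<Sum>J = 0"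
  shows "1 \<le> F J" "F J < int (card J)"
  using range[of J] assms by auto

lemma line_pair:
  assumes "p \<in> M" "w \<in> M" "w + p \<in> M" "z \<in> M" "z + p \<in> M" "z \<noteq> w" "z \<noteq> w + p"
  shows "[x p = 0] (mod n) \<or> [x p = 1] (mod n)"
proof (rule two_lines)
  have "p \<noteq> w" "p \<noteq> z" "w \<noteq> w + p" "z \<noteq> z + p" "p \<noteq> w + p" "p \<noteq> z + p"
    using zero_notin assms by auto
  moreover have "w \<noteq> z + p" using assms(7) by (auto simp: add.assoc)
  ultimately show "distinct [p, w, w + p, z, z + p]" using assms(6,7) by auto
qed (use assms in \<open>auto simp: ac_simps\<close>)

definition zeros :: "'v set \<Rightarrow> 'v set" where "zeros Y = {i\<in>Y. [x i = 0] (mod n)}"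
definition ones :: "'v set \<Rightarrow> 'v set" where "ones Y = {i\<in>Y. [x i = 1] (mod n)}"

text \<open>No word lies inside \<open>Z\<close>, as in \<open>same_value_bound\<close>; in a space
  of size \<open>2 ^ r\<close>, a set of \<open>r\<close> such points is a basis, whence the second
  claim.\<close>

lemma same_value_bound':
  assumes "Z \<subseteq> M" "Z \<subseteq> L" "subgrp L" "finite L" "card L = 2 ^ r"
    and "v = 0 \<or> v = 1" "\<And>i. i \<in> Z \<Longrightarrow> [x i = v] (mod n)"
  shows "card Z \<le> r"
    and "card Z = r \<Longrightarrow> w \<in> L \<Longrightarrow> \<exists>J\<subseteq>Z. \<Sum>J = w"
proof -
  have finZ: "finite Z" using assms(1) finM finite_subset by blast
  have indep: "J = {}" if "J \<subseteq> Z" "\<Sum>J = 0" for J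
  proof (rule ccontr)
    assume "J \<noteq> {}"
    have JE: "J \<subseteq> M" using that assms by blast
    have "[sum x J = (\<Sum>i\<in>J. v)] (mod n)"
      by (rule cong_sum) (use that assms(7) in blast)
    then have "F J = v * int (card J)"
      using assms(6) n_large card_le_E[OF JE] by (intro F_unique) (auto simp: mult.commute)
    then show False using F_range[OF JE \<open>J \<noteq> {}\<close> that(2)] assms(6) by (elim disjE) simp_all
  qed
  have inj: "inj_on Sum (Pow Z)"
  proof (rule inj_onI)
    fix I J assume IJ: "I \<in> Pow Z" "J \<in> Pow Z" "\<Sum>I = \<Sum>J"
    have fin: "finite I" "finite J" using IJ finZ finite_subset by blast+
    have "sym_diff I J = {}"
      by (rule indep) (use IJ in \<open>auto simp: sum_sym_diff[OF fin]\<close>)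
    then show "I = J" by blast
  qed
  have img: "Sum ` Pow Z \<subseteq> L" using assms(2) by (auto intro!: subgrp_sum[OF assms(3)])
  have c: "card (Sum ` Pow Z) = 2 ^ card Z" using card_image[OF inj] finZ by (simp add: card_Pow)
  have "(2::nat) ^ card Z \<le> 2 ^ r" using card_mono[OF assms(4) img] c assms(5) by simp
  then show "card Z \<le> r" by simp
  assume "card Z = r" "w \<in> L"
  then have "Sum ` Pow Z = L" using card_subset_eq[OF assms(4) img] c assms(5) by simp
  then show "\<exists>J\<subseteq>Z. \<Sum>J = w" using \<open>w \<in> L\<close> by (auto simp: image_iff)
qed

text \<open>If the zeros and the ones of \<open>Y\<close> both form a basis of \<open>L\<close>, completing \<open>J0\<close> by either
  of them squeezes its value from both sides.\<close>

lemma squeeze: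
  assumes "Y \<subseteq> M" "Y \<subseteq> L" "subgrp L" "finite L" "card L = 2 ^ r" "card Y = 2 * r"
    and "\<And>i. i \<in> Y \<Longrightarrow> [x i = 0] (mod n) \<or> [x i = 1] (mod n)"
    and "J0 \<subseteq> M" "J0 \<inter> Y = {}" "J0 \<noteq> {}" "\<Sum>J0 \<in> L"
  obtains J k where "J \<subseteq> zeros Y" "\<Sum>(J0 \<union> J) = 0" "F (J0 \<union> J) = k" "[sum x J0 = k] (mod n)"
    "1 \<le> k" "k < int (card J0)"
proof -
  have finY: "finite Y" using assms(1) finM finite_subset by blast
  have Z: "zeros Y \<subseteq> M" "zeros Y \<subseteq> L" "ones Y \<subseteq> M" "ones Y \<subseteq> L" "zeros Y \<subseteq> Y" "ones Y \<subseteq> Y"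
    using assms(1,2) by (auto simp: zeros_def ones_def)
  have Zv: "\<And>i. i \<in> zeros Y \<Longrightarrow> [x i = 0] (mod n)" and Ov: "\<And>i. i \<in> ones Y \<Longrightarrow> [x i = 1] (mod n)"
    by (simp_all add: zeros_def ones_def)
  have zb: "card (zeros Y) \<le> r" "card (zeros Y) = r \<Longrightarrow> w \<in> L \<Longrightarrow> \<exists>J\<subseteq>zeros Y. \<Sum>J = w" for w
    using same_value_bound'[OF Z(1,2) assms(3-5), of 0] Zv by simp_all
  have ob: "card (ones Y) \<le> r" "card (ones Y) = r \<Longrightarrow> w \<in> L \<Longrightarrow> \<exists>J\<subseteq>ones Y. \<Sum>J = w" for w
    using same_value_bound'[OF Z(3,4) assms(3-5), of 1] Ov by simp_all
  have "Y \<subseteq> zeros Y \<union> ones Y" using assms(7) by (auto simp: zeros_def ones_def)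
  then have "card Y \<le> card (zeros Y \<union> ones Y)"
    by (rule card_mono[rotated]) (use Z(5,6) finY finite_subset in blast)
  also have "\<dots> \<le> card (zeros Y) + card (ones Y)" by (rule card_Un_le)
  finally have cr: "card (zeros Y) = r" "card (ones Y) = r" using zb(1) ob(1) assms(6) by linarith+
  obtain J where J: "J \<subseteq> zeros Y" "\<Sum>J = \<Sum>J0" using zb(2)[OF cr(1) assms(11)] by blast
  obtain J' where J': "J' \<subseteq> ones Y" "\<Sum>J' = \<Sum>J0" using ob(2)[OF cr(2) assms(11)] by blast
  have fin: "finite J0" "finite J" "finite J'"
    using finite_sub[OF assms(8)] J J' Z finY by (meson finite_subset)+
  have dj: "J0 \<inter> J = {}" "J0 \<inter> J' = {}" using J J' Z assms(9) by blast+
  have sub: "J0 \<union> J \<subseteq> M" "J0 \<union> J' \<subseteq> M" "J0 \<union> J \<noteq> {}" "J0 \<union> J' \<noteq> {}"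
    using J J' Z assms(8,10) by blast+
  have w: "\<Sum>(J0 \<union> J) = 0" "\<Sum>(J0 \<union> J') = 0"
    using sum.union_disjoint[OF fin(1,2) dj(1), of "\<lambda>v. v"] sum.union_disjoint[OF fin(1,3) dj(2), of "\<lambda>v. v"] J J'
    by simp_all
  let ?k = "F (J0 \<union> J)"
  have "[sum x J = (\<Sum>i\<in>J. 0)] (mod n)" by (rule cong_sum) (use J Zv in blast)
  then have "[sum x J0 + sum x J = sum x J0 + 0] (mod n)" by (intro cong_add) simp_all
  moreover have "[sum x J0 + sum x J = ?k] (mod n)"
    using sum.union_disjoint[OF fin(1,2) dj(1), of x] by (simp add: cong_def)
  ultimately have k: "[sum x J0 = ?k] (mod n)" by (simp add: cong_def)
  have "[sum x J' = (\<Sum>i\<in>J'. 1)] (mod n)" by (rule cong_sum) (use J' Ov in blast)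
  then have "[sum x J0 + sum x J' = ?k + int (card J')] (mod n)" using k by (intro cong_add) simp_all
  moreover have "[sum x J0 + sum x J' = F (J0 \<union> J')] (mod n)"
    using sum.union_disjoint[OF fin(1,3) dj(2), of x] by (simp add: cong_def)
  ultimately have c: "[?k + int (card J') = F (J0 \<union> J')] (mod n)" by (simp add: cong_def)
  have cards: "card (J0 \<union> J') = card J0 + card J'" "card (J0 \<union> J) \<le> card M" "card (J0 \<union> J') \<le> card M"
    using card_Un_disjoint[OF fin(1,3) dj(2)] card_le_E[OF sub(1)] card_le_E[OF sub(2)] by auto
  note b = F_range[OF sub(1,3) w(1)] F_range[OF sub(2,4) w(2)]
  \<comment> \<open>Completing by ones instead of zeros raises the value by exactly
    \<open>card J'\<close>, while the new value stays below \<open>card J0 + card J'\<close>. Hence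
    the old one is below \<open>card J0\<close>.\<close>
  have eq: "?k + int (card J') = F (J0 \<union> J')"
    by (rule cong_imp_eq_small[OF c]) (use b cards n_large in linarith)
  then have "?k < int (card J0)" using b(4) unfolding cards(1) by linarith
  then show thesis using that J(1) w(1) k b(1) by blast
qed

text \<open>Each pair of the three points is squeezed to value 1. The two words through
  \<open>p1\<close> and their symmetric difference, made of \<open>p2\<close>, \<open>p3\<close> and
  points of value 0, all have value 1, and 1 + 1 + 1 is odd.\<close>

lemma no_three_outside:
  assumes Y: "Y \<subseteq> M" "Y \<subseteq> L" "subgrp L" "finite L" "card L = 2 ^ r" "card Y = 2 * r"
      "\<And>i. i \<in> Y \<Longrightarrow> [x i = 0] (mod n) \<or> [x i = 1] (mod n)"
    and p: "{p1, p2, p3} \<subseteq> M - L" "distinct [p1, p2, p3]" "p1 + p2 \<in> L" "p1 + p3 \<in> L"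
  shows False
proof -
  have p23: "p2 + p3 \<in> L" using subgrp_add[OF Y(3) p(3,4)] by (simp add: ac_simps)
  have pair: "\<exists>J\<subseteq>zeros Y. \<Sum>({a, b} \<union> J) = 0 \<and> F ({a, b} \<union> J) = 1 \<and> [x a + x b = 1] (mod n)"
    if ab: "{a, b} \<subseteq> M - L" "a \<noteq> b" "a + b \<in> L" for a b
  proof -
    obtain J k where "J \<subseteq> zeros Y" "\<Sum>({a, b} \<union> J) = 0" "F ({a, b} \<union> J) = k"
      "[sum x {a, b} = k] (mod n)" "1 \<le> k" "k < int (card {a, b})"
      by (rule squeeze[OF Y, of "{a, b}"]) (use ab Y(2) in auto)
    moreover have "sum x {a, b} = x a + x b" "int (card {a, b}) = 2" using ab by auto
    moreover have "k = 1" using calculation by linarith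
    ultimately show ?thesis by metis
  qed
  obtain I where I: "I \<subseteq> zeros Y" "\<Sum>({p1, p2} \<union> I) = 0" "F ({p1, p2} \<union> I) = 1"
    using pair[of p1 p2] p by auto
  obtain J where J: "J \<subseteq> zeros Y" "\<Sum>({p1, p3} \<union> J) = 0" "F ({p1, p3} \<union> J) = 1"
    using pair[of p1 p3] p by auto
  have v23: "[x p2 + x p3 = 1] (mod n)" using pair[of p2 p3] p p23 by auto
  let ?A = "{p1, p2} \<union> I" and ?B = "{p1, p3} \<union> J"
  have ZY: "zeros Y \<subseteq> Y" by (auto simp: zeros_def)
  have sub: "?A \<subseteq> M" "?B \<subseteq> M" using p(1) I(1) J(1) ZY Y(1) by blast+
  have finIJ: "finite (sym_diff I J)" using finite_sub[of I] finite_sub[of J] I(1) J(1) ZY Y(1) by blast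
  have notin: "p1 \<notin> I \<union> J" "p2 \<notin> I \<union> J" "p3 \<notin> I \<union> J" using p(1) I(1) J(1) ZY Y(2) by blast+
  have sd: "sym_diff ?A ?B = {p2, p3} \<union> sym_diff I J" using notin p(2) by auto
  have "[sum x (sym_diff I J) = (\<Sum>i\<in>sym_diff I J. 0)] (mod n)"
    by (rule cong_sum) (use I(1) J(1) in \<open>auto simp: zeros_def\<close>)
  moreover have "sum x (sym_diff ?A ?B) = x p2 + x p3 + sum x (sym_diff I J)"
    unfolding sd using sum.union_disjoint[of "{p2, p3}" "sym_diff I J" x] finIJ notin p(2) by auto
  ultimately have "[sum x (sym_diff ?A ?B) = 1] (mod n)"
    using cong_add[OF v23, of "sum x (sym_diff I J)" 0] by simp
  then have "F (sym_diff ?A ?B) = 1"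
    by (rule F_unique) (use n_large card_le_E[OF sub(1)] card_gt_0_iff[of ?A] finite_sub[OF sub(1)] in force)+
  moreover have "even (F ?A + F ?B + F (sym_diff ?A ?B))"
    by (rule parity) (use sub I(2) J(2) in auto)
  ultimately show False using I(3) J(3) by simp
qed

text \<open>If two points \<open>s\<close>, \<open>s'\<close> outside \<open>M\<close> had sum
  \<open>t\<close>, both \<open>M\<close> and its translate by \<open>t\<close> would miss them,
  hence meet in at least 9 + 9 - 14 = 4 points. These form two lines through \<open>t\<close>, which
  force the value 0 or 1.\<close>

lemma bad_difference:
  assumes cards: "card K = 16" "card M = 9"
    and t: "t \<in> M" "\<not> ([x t = 0] (mod n) \<or> [x t = 1] (mod n))"
    and s: "s \<in> K - M" "s' \<in> K - M"
  shows "s + s' \<noteq> t"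
proof
  assume st: "s + s' = t"
  let ?T = "(+) t ` M"
  have "t \<noteq> 0" using t(1) zero_notin by blast
  then have ss: "s \<noteq> s'" using st by auto
  have finT: "finite ?T" using finM by simp
  have cT: "card ?T = 9" using cards by (simp add: card_image inj_on_def)
  have "s \<notin> ?T" "s' \<notin> ?T" using s st by (auto simp: add_eq_iff ac_simps add_eq_0_iff_eq)
  then have "M \<union> ?T \<subseteq> K - {s, s'}" using MK s t(1) subgrp_add[OF subK] by (auto simp: subset_eq)
  then have "card (M \<union> ?T) \<le> card (K - {s, s'})" by (rule card_mono[rotated]) (use finK in simp)
  also have "\<dots> = 14" using s ss finK cards by (simp add: card_Diff_subset)
  finally have "card (M \<inter> ?T) \<ge> 4" using card_Un_Int[OF finM finT] cT cards by linarith
  then have "M \<inter> ?T \<noteq> {}" by (metis card.empty not_numeral_le_zero)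
  then obtain w where w: "w \<in> M \<inter> ?T" by blast
  have "card {w, w + t} < card (M \<inter> ?T)" using \<open>card (M \<inter> ?T) \<ge> 4\<close> card_insert_le_m1[of 2 "{w + t}" w] by auto
  then obtain z where z: "z \<in> M \<inter> ?T" "z \<notin> {w, w + t}" by (rule ex_notin) simp
  have "w + t \<in> M" "z + t \<in> M" using w z by (auto simp: ac_simps)
  then have "[x t = 0] (mod n) \<or> [x t = 1] (mod n)"
    using line_pair[of t w z] t(1) w z by auto
  then show False using t(2) by blast
qed

end

context vector_words
begin

text \<open>The six points are a Fano plane without \<open>u\<close>, and each lies on two lines
  formed by them. If \<open>u\<close> is in \<open>M\<close>, seven values are 0 or 1, too many for
  rank 3; otherwise three points of \<open>M\<close> lie off the plane, against
  \<open>no_three_outside\<close>.\<close>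

lemma six_in_plane:
  assumes cards: "card K = 16" "card M = 9"
    and "u \<in> K" "u \<noteq> 0" and M: "{a, a + u, b, b + u, a + b, a + b + u} \<subseteq> M"
    and ab: "a \<noteq> b" "b \<noteq> a + u"
  shows False
proof -
  let ?Y = "{a, a + u, b, b + u, a + b, a + b + u}"
  have nz: "a \<noteq> 0" "b \<noteq> 0" "a \<noteq> u" "b \<noteq> u" "a + b \<noteq> 0" "a + b \<noteq> u"
    using M zero_notin ab(1) by (auto simp: add_eq_0_iff_eq)
  have d: "distinct [a, a + u, b, b + u, a + b, a + b + u]"
    using nz ab assms(4) by (auto simp: add_eq_iff ac_simps)
  have cY: "card ?Y = 6" using distinct_card[OF d] by simp
  have lines: "[x i = 0] (mod n) \<or> [x i = 1] (mod n)" if "i \<in> ?Y" for i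
    using that M
      line_pair[of a b "b + u"] line_pair[of "a + u" b "b + u"] line_pair[of b a "a + u"]
      line_pair[of "b + u" a "a + u"] line_pair[of "a + b" a "a + u"] line_pair[of "a + b + u" a "a + u"]
      ab nz assms(4)
    by (auto simp: ac_simps add_eq_iff)
  let ?U = "{0, u}"
  let ?A = "?U \<union> (+) a ` ?U"
  define P where "P = ?A \<union> (+) b ` ?A"
  have sU: "subgrp ?U" by (auto simp: subgrp_def)
  have sA: "subgrp ?A" by (rule subgrp_extend[OF sU])
  have sP: "subgrp P" unfolding P_def by (rule subgrp_extend[OF sA])
  have cA: "card ?A = 4"
    using card_subgrp_extend[OF sU, of a] nz assms(4) by simp
  have cP: "card P = 2 ^ 3"
    using card_subgrp_extend[OF sA, of b] cA nz ab by (simp add: P_def ac_simps)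
  have PY: "P = ?Y \<union> ?U" unfolding P_def by (auto simp: ac_simps)
  have finP: "finite P" by (simp add: PY)
  have PK: "P \<subseteq> K" unfolding PY using M MK subgrp_0[OF subK] assms(3) by auto
  show False
  proof (cases "u \<in> M")
    case True
    have "[x u = 0] (mod n) \<or> [x u = 1] (mod n)"
      using line_pair[of u a b] M True ab by auto
    then have all: "\<And>i. i \<in> insert u ?Y \<Longrightarrow> [x i = 0] (mod n) \<or> [x i = 1] (mod n)" using lines by blast
    let ?Z = "{i \<in> insert u ?Y. [x i = 0] (mod n)}" and ?O = "{i \<in> insert u ?Y. [x i = 1] (mod n)}"
    have "card ?Z \<le> 3"
      by (rule same_value_bound'(1)[OF _ _ sP finP cP, of _ 0]) (use M True PY in auto)
    moreover have "card ?O \<le> 3"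
      by (rule same_value_bound'(1)[OF _ _ sP finP cP, of _ 1]) (use M True PY in auto)
    moreover have "card (insert u ?Y) \<le> card (?Z \<union> ?O)"
      by (rule card_mono) (use all in auto)
    moreover have "card (?Z \<union> ?O) \<le> card ?Z + card ?O" by (rule card_Un_le)
    moreover have "u \<notin> ?Y" using nz assms(4) by (auto simp: add_eq_iff)
    then have "card (insert u ?Y) = Suc (card ?Y)" by (intro card_insert_disjoint) auto
    ultimately show False using cY by linarith
  next
    case False
    then have "M \<inter> P = ?Y" unfolding PY using M zero_notin by auto
    then have "card (M - P) = 3" using cY cards finM by (simp only: card_Diff_subset_Int[OF finite_Int, OF disjI1[OF finM]])
    then obtain p1 p2 p3 where p: "M - P = {p1, p2, p3}" "distinct [p1, p2, p3]"
      by (auto simp: card_3_iff)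
    have inP: "v + w \<in> P" if v: "v \<in> K - P" "w \<in> K - P" for v w
    proof -
      have "card (P \<union> (+) v ` P) = 16" using card_subgrp_extend[OF sP finP, of v] v cP by simp
      moreover have "P \<union> (+) v ` P \<subseteq> K" using PK v subgrp_add[OF subK] by blast
      ultimately have "P \<union> (+) v ` P = K" using cards finK card_subset_eq by metis
      then obtain z where "z \<in> P" "w = v + z" using v by blast
      then show ?thesis by simp
    qed
    show False
    proof (rule no_three_outside[of ?Y P 3 p1 p2 p3])
      have "{p1, p2, p3} \<subseteq> K - P" using p(1) MK by blast
      then show "p1 + p2 \<in> P" "p1 + p3 \<in> P" using inP by blast+
      show "card ?Y = 2 * 3" using cY by simp
    qed (use M sP finP cP lines p PY in auto)
  qed
qed

text \<open>Here \<open>M\<close> is the coset of \<open>V\<close> through \<open>a\<close> together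
  with \<open>v\<close>. Planes of the coset that share a pair bound each
  \<open>x a + x (a + s)\<close> by 0 and 2; the line through \<open>v\<close> and \<open>a\<close>
  gives a value of \<open>a\<close> in [-1, 2]; a plane of the coset avoiding \<open>a\<close>
  excludes the two ends.\<close>

lemma affine_value:
  assumes V: "subgrp V" "card V = 8" "v \<in> V" "v \<noteq> 0" "v \<in> M"
    and D: "\<And>w. w \<in> V \<Longrightarrow> a + w \<in> M" "a \<notin> V" and "card M = 9"
  shows "[x a = 0] (mod n) \<or> [x a = 1] (mod n)"
proof -
  have finV: "finite V" using V(2) by (metis card.infinite zero_neq_numeral)
  have plane: "1 \<le> F {c, c + s, c + s', c + s + s'}" "F {c, c + s, c + s', c + s + s'} \<le> 3"
      "{c, c + s, c + s', c + s + s'} \<subseteq> M" "\<Sum>{c, c + s, c + s', c + s + s'} = 0"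
    if "c + a \<in> V" "s \<in> V" "s' \<in> V" "s \<noteq> 0" "s' \<noteq> 0" "s \<noteq> s'" for c s s'
  proof -
    have "c + w \<in> M" if "w \<in> V" for w
    proof -
      have "a + ((c + a) + w) \<in> M" using D(1) subgrp_add[OF V(1) \<open>c + a \<in> V\<close> that] .
      then show ?thesis by (simp add: ac_simps)
    qed
    from this[of 0] this[of s] this[of s'] this[of "s + s'"]
    show sub: "{c, c + s, c + s', c + s + s'} \<subseteq> M"
      using that subgrp_0[OF V(1)] subgrp_add[OF V(1)] by (auto simp: add.assoc)
    have d: "distinct [c, c + s, c + s', c + s + s']"
      using that by (auto simp: add.assoc add_eq_0_iff_eq)
    show sum: "\<Sum>{c, c + s, c + s', c + s + s'} = 0" using d by (simp add: ac_simps)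
    have "card {c, c + s, c + s', c + s + s'} = 4" using d by simp
    then show "1 \<le> F {c, c + s, c + s', c + s + s'}" "F {c, c + s, c + s', c + s + s'} \<le> 3"
      using F_range[OF sub _ sum] by auto
  qed
  have ex1: "\<exists>s\<in>V. s \<notin> B" if "card B < 8" "finite B" for B
    using that ex_notin[of B V] V(2) by metis
  have aa: "a + a \<in> V" using subgrp_0[OF V(1)] by simp
  have pairsum: "\<exists>k. 0 \<le> k \<and> k \<le> 2 \<and> [x a + x (a + s) = k] (mod n)" if s: "s \<in> V" "s \<noteq> 0" for s
  proof -
    have "card {0, s} < 8" by (simp add: card_insert_if)
    then obtain s1 where s1: "s1 \<in> V" "s1 \<notin> {0, s}" using ex1 by blast
    have "card {0, s, s1, s + s1} < 8" by (simp add: card_insert_if)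
    then obtain s2 where s2: "s2 \<in> V" "s2 \<notin> {0, s, s1, s + s1}" using ex1 by blast
    let ?I = "{a, a + s, a + s1, a + s + s1}" and ?J = "{a, a + s, a + s2, a + s + s2}"
    have sd: "sym_diff ?I ?J = {a + s1, a + s1 + s, a + s2, a + s2 + s}" and int: "?I \<inter> ?J = {a, a + s}"
      using s s1 s2 by (auto simp: ac_simps add_eq_iff)
    have e: "{a + s1, a + s1 + s, a + s2, a + s2 + s}
        = {a + s1, a + s1 + s, a + s1 + (s1 + s2), a + s1 + s + (s1 + s2)}"
      by (simp add: ac_simps)
    have P1: "1 \<le> F ?I" "F ?I \<le> 3" "?I \<subseteq> M" "\<Sum>?I = 0" and P2: "1 \<le> F ?J" "F ?J \<le> 3" "?J \<subseteq> M" "\<Sum>?J = 0"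
      using plane[OF aa s(1) s1(1) s(2)] plane[OF aa s(1) s2(1) s(2)] s1(2) s2(2) by blast+
    have "s1 + s2 \<in> V" "s1 + s2 \<noteq> 0" "s \<noteq> s1 + s2"
      using s1 s2 subgrp_add[OF V(1)] by (auto simp: add_eq_0_iff_eq ac_simps)
    then have P3: "1 \<le> F (sym_diff ?I ?J)" "F (sym_diff ?I ?J) \<le> 3"
      using plane[of "a + s1" s "s1 + s2"] s s1 unfolding sd e by (auto simp: ac_simps)
    obtain k where k: "F ?I + F ?J - F (sym_diff ?I ?J) = 2 * k" "[sum x {a, a + s} = k] (mod n)"
      using sum_inter[OF P1(3) P2(3)] P1(4) P2(4) unfolding int by (metis singletonI)
    have "0 \<le> k" "k \<le> 2" using k(1) P1(1,2) P2(1,2) P3 by linarith+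
    moreover have "sum x {a, a + s} = x a + x (a + s)" using s by simp
    ultimately show ?thesis using k(2) by metis
  qed
  have "card {0, v} < 8" by (simp add: card_insert_if)
  then obtain s where s: "s \<in> V" "s \<notin> {0, v}" using ex1 by blast
  have "card {0, v, s, s + v} < 8" by (simp add: card_insert_if)
  then obtain s' where s': "s' \<in> V" "s' \<notin> {0, v, s, s + v}" using ex1 by blast
  have "card {0, s, s', s + s'} < 8" by (simp add: card_insert_if)
  then obtain w where w: "w \<in> V" "w \<notin> {0, s, s', s + s'}" using ex1 by blast
  \<comment> \<open>The line and the plane meet in \<open>a\<close> alone; words of sizes 3, 4 and
    at most 5 put 2k between 1 + 1 - 4 and 2 + 3 - 1.\<close>
  have "\<exists>k. - 1 \<le> k \<and> k \<le> 2 \<and> [x a = k] (mod n)"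
  proof -
    let ?L = "{v, a, a + v}" and ?P = "{a, a + s, a + s', a + s + s'}"
    have va: "v \<noteq> a" "v \<noteq> a + w" if "w \<in> V" for w
      using V(3) D(2) subgrp_cancel[OF V(1) that, of a] by (auto simp: add.commute)
    have P: "1 \<le> F ?P" "F ?P \<le> 3" "?P \<subseteq> M" "\<Sum>?P = 0"
      using plane[of a s s'] s s' subgrp_0[OF V(1)] by auto
    have L: "?L \<subseteq> M" using V D(1)[of 0] D(1)[of v] subgrp_0[OF V(1)] by simp
    have Ls: "\<Sum>?L = 0" "card ?L = 3" using va[OF V(3)] V(4) by (auto simp: ac_simps)
    have int: "?L \<inter> ?P = {a}"
      using va[OF s(1)] va[OF s'(1)] va[OF subgrp_add[OF V(1) s(1) s'(1)]] V(4) s s'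
      by (auto simp: ac_simps add_eq_iff)
    have sd: "sym_diff ?L ?P = {v, a + v, a + s, a + s', a + s + s'}"
      using va[OF s(1)] va[OF s'(1)] va[OF subgrp_add[OF V(1) s(1) s'(1)]] V(4) s s'
      by (auto simp: ac_simps add_eq_iff)
    have ssum: "\<Sum>(sym_diff ?L ?P) = 0"
      using sum_sym_diff[of ?L ?P "\<lambda>v. v"] Ls P(4) by simp
    have ssub: "sym_diff ?L ?P \<subseteq> M" using L P(3) by blast
    have "card (sym_diff ?L ?P) \<le> 5" unfolding sd by (simp add: card_insert_if)
    then have F3: "1 \<le> F (sym_diff ?L ?P)" "F (sym_diff ?L ?P) \<le> 4"
      using F_range[OF ssub _ ssum] unfolding sd by auto
    obtain k where k: "F ?L + F ?P - F (sym_diff ?L ?P) = 2 * k" "[sum x {a} = k] (mod n)"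
      using sum_inter[OF L P(3)] Ls(1) P(4) unfolding int by (metis singletonI)
    have "1 \<le> F ?L" "F ?L \<le> 2" using F_range[OF L _ Ls(1)] Ls(2) by auto
    then have "- 1 \<le> k" "k \<le> 2" using k(1) P(1,2) F3 by linarith+
    then show ?thesis using k(2) by auto
  qed
  then obtain k where k: "- 1 \<le> k" "k \<le> 2" "[x a = k] (mod n)" by blast
  let ?Q = "{a + w, a + w + s, a + w + s', a + w + s + s'}"
  have wV: "w + s \<in> V" "w + s' \<in> V" "w + s + s' \<in> V" using w s s' subgrp_add[OF V(1)] by auto
  have wn: "w + s \<noteq> 0" "w + s' \<noteq> 0" "w + s + s' \<noteq> 0" using w by (auto simp: add_eq_0_iff_eq add_eq_iff add.assoc)
  obtain k1 k2 k3 k4 where ks: "[x a + x (a + w) = k1] (mod n)" "[x a + x (a + (w + s)) = k2] (mod n)"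
    "[x a + x (a + (w + s')) = k3] (mod n)" "[x a + x (a + (w + s + s')) = k4] (mod n)"
    and kb: "0 \<le> k1" "k1 \<le> 2" "0 \<le> k2" "k2 \<le> 2" "0 \<le> k3" "k3 \<le> 2" "0 \<le> k4" "k4 \<le> 2"
    using pairsum[of w] pairsum[OF wV(1) wn(1)] pairsum[OF wV(2) wn(2)] pairsum[OF wV(3) wn(3)] w by auto
  have Qv: "1 \<le> F ?Q" "F ?Q \<le> 3"
    using plane[of "a + w" s s'] w s s' by (auto simp: ac_simps)
  have "distinct [a + w, a + w + s, a + w + s', a + w + s + s']"
    using s s' by (auto simp: add.assoc add_eq_0_iff_eq)
  then have "sum x ?Q = x (a + w) + x (a + (w + s)) + x (a + (w + s')) + x (a + (w + s + s'))"
    by (simp add: add.assoc)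
  also have "\<dots> = (x a + x (a + w)) + (x a + x (a + (w + s))) + (x a + x (a + (w + s'))) + (x a + x (a + (w + s + s'))) - 4 * x a"
    by simp
  also have "[\<dots> = k1 + k2 + k3 + k4 - 4 * k] (mod n)"
    by (intro cong_add cong_diff ks cong_scalar_left k(3))
  finally have "[F ?Q = k1 + k2 + k3 + k4 - 4 * k] (mod n)" by (simp add: cong_def)
  then have "F ?Q = k1 + k2 + k3 + k4 - 4 * k"
    by (rule cong_imp_eq_small) (use Qv kb k(1,2) n_large assms(8) in linarith)
  \<comment> \<open>The four pair sums total between 0 and 8 and \<open>F ?Q\<close> lies in [1, 3]:
    k = -1 would give at least 4, and k = 2 at most 0.\<close>
  then have "k = 0 \<or> k = 1" using Qv kb k(1,2) by linarith
  then show ?thesis using k(3) by auto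
qed

text \<open>The eight points fill the affine hyperplane through \<open>a\<close> in direction
  \<open>?V\<close>, so the ninth point lies in \<open>?V\<close> and \<open>affine_value\<close>
  applies to the eight. The ninth is on two lines through pairs of them. Nine values 0 or 1 contain
  five equal ones, too many for rank 4.\<close>

lemma parallelepiped:
  assumes cards: "card K = 16" "card M = 9"
    and u: "u \<in> K" "u \<noteq> 0" and a: "\<And>w. w \<in> {0, u} \<Longrightarrow> {a + w, b + w, c + w, a + b + c + w} \<subseteq> M"
    and d: "b + a \<notin> {0, u}" "c + a \<notin> {0, u, b + a, b + a + u}"
  shows False
proof -
  let ?U = "{0, u}"
  let ?A = "?U \<union> (+) (b + a) ` ?U"
  let ?V = "?A \<union> (+) (c + a) ` ?A"
  have sU: "subgrp ?U" by (auto simp: subgrp_def)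
  have sA: "subgrp ?A" by (rule subgrp_extend[OF sU])
  have sV: "subgrp ?V" by (rule subgrp_extend[OF sA])
  have finV: "finite ?V" by simp
  have "card ?A = 4" using card_subgrp_extend[OF sU _ d(1)] u(2) by simp
  moreover have "c + a \<notin> ?A" using d(2) by (auto simp: ac_simps)
  ultimately have cV: "card ?V = 8" using card_subgrp_extend[OF sA, of "c + a"] by simp
  have D: "a + w \<in> M" if "w \<in> ?V" for w
    using that a[of 0] a[of u] by (auto simp: ac_simps)
  have aV: "a \<notin> ?V"
  proof
    assume "a \<in> ?V"
    then have "a + a \<in> M" by (rule D)
    then show False using zero_notin by simp
  qed
  have aK: "a \<in> K" "b \<in> K" "c \<in> K" using MK a[of 0] by auto
  have UK: "?U \<subseteq> K" using u subgrp_0[OF subK] by auto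
  have AK: "?A \<subseteq> K" using UK subgrp_add[OF subK subgrp_add[OF subK aK(2,1)]] by blast
  have VK: "?V \<subseteq> K" using AK subgrp_add[OF subK subgrp_add[OF subK aK(3,1)]] by blast
  have c16: "card (?V \<union> (+) a ` ?V) = 16" using card_subgrp_extend[OF sV finV aV] cV by simp
  moreover have "?V \<union> (+) a ` ?V \<subseteq> K" using VK aK subgrp_add[OF subK] by blast
  ultimately have KV: "?V \<union> (+) a ` ?V = K" using cards finK card_subset_eq by metis
  have "inj_on ((+) a) ?V" by (rule inj_onI) (rule add_left_imp_eq)
  then have "card ((+) a ` ?V) = 8" using cV by (simp only: card_image)
  then have "card ((+) a ` ?V) < card M" using cards by simp
  then obtain v where v: "v \<in> M" "v \<notin> (+) a ` ?V" by (rule ex_notin) (use finV in blast)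
  then have vV: "v \<in> ?V" using KV MK by blast
  have "v \<noteq> 0" using v zero_notin by blast
  have aff: "[x p = 0] (mod n) \<or> [x p = 1] (mod n)" if p: "p \<in> (+) a ` ?V" for p
  proof (rule affine_value[OF sV cV vV \<open>v \<noteq> 0\<close> v(1) _ _ cards(2)])
    obtain z where z: "z \<in> ?V" "p = a + z" using p by blast
    show "p + w \<in> M" if "w \<in> ?V" for w
      using D[OF subgrp_add[OF sV z(1) that]] z(2) by (simp only: add.assoc)
    show "p \<notin> ?V" using aV subgrp_cancel[OF sV z(1), of a] z(2) by (metis add.commute)
  qed
  have "M - {v} \<subseteq> (+) a ` ?V"
  proof -
    have "(+) a ` ?V \<subseteq> M - {v}" using D v by blast
    moreover have "card (M - {v}) = 8" using v cards finM by simp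
    ultimately have "(+) a ` ?V = M - {v}"
      using \<open>card ((+) a ` ?V) = 8\<close> card_subset_eq finM by (metis finite_Diff)
    then show ?thesis by simp
  qed
  moreover have "[x v = 0] (mod n) \<or> [x v = 1] (mod n)"
  proof -
    have "card {a, a + v} < card ((+) a ` ?V)"
      using \<open>card ((+) a ` ?V) = 8\<close> card_insert_le_m1[of 2 "{a + v}" a] by simp
    then obtain z where z: "z \<in> (+) a ` ?V" "z \<notin> {a, a + v}" by (rule ex_notin) simp
    obtain w where w: "w \<in> ?V" "z = a + w" using z by blast
    show ?thesis
    proof (rule line_pair[OF v(1)])
      show "a \<in> M" using a[of 0] by auto
      show "a + v \<in> M" by (rule D[OF vV])
      show "z \<in> M" using D[OF w(1)] w(2) by simp
      show "z + v \<in> M" using D[OF subgrp_add[OF sV w(1) vV]] w(2) by (simp only: add.assoc)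
    qed (use z(2) in auto)
  qed
  ultimately have "[x p = 0] (mod n) \<or> [x p = 1] (mod n)" if "p \<in> M" for p
    using aff that by blast
  then have "2 ^ 5 * card {0::'v} \<le> card K"
    by (rule zero_one_bound[OF order_refl]) (simp_all add: cards)
  then show False using cards by simp
qed

text \<open>Without a bad point, five values agree; a single bad point is squeezed by the other
  eight into 1 \<le> k < 1. Two bad points make a large part of \<open>M\<close> invariant under
  their sum \<open>u\<close>. Modulo \<open>u\<close> the rank is 3, so four points of that part are
  dependent, which leads to one of the two excluded configurations.\<close>

lemma nine_vectors:
  assumes cards: "card K = 16" "card M = 9"
  shows False
proof -
  define good where "good t \<longleftrightarrow> [x t = 0] (mod n) \<or> [x t = 1] (mod n)" for t
  show False
  proof (cases "\<exists>t\<in>M. \<exists>t'\<in>M. t \<noteq> t' \<and> \<not> good t \<and> \<not> good t'")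
    case False
    show False
    proof (cases "\<exists>t\<in>M. \<not> good t")
      case all: False
      have "2 ^ 5 * card {0::'v} \<le> card K"
        by (rule zero_one_bound[OF order_refl]) (use all cards in \<open>auto simp: good_def\<close>)
      then show False using cards by simp
    next
      case True
      then obtain t where t: "t \<in> M" "\<not> good t" by blast
      have rest: "[x i = 0] (mod n) \<or> [x i = 1] (mod n)" if "i \<in> M - {t}" for i
        using that t False unfolding good_def by blast
      show False
      proof (rule squeeze[where Y = "M - {t}" and L = K and r = 4 and ?J0.0 = "{t}"])
        show "card K = 2 ^ 4" "card (M - {t}) = 2 * 4" using t cards finM by auto
      qed (use MK t rest subK finK in auto)
    qed
  next
    case True
    then obtain t t' where t: "t \<in> M" "t' \<in> M" "t \<noteq> t'" "\<not> good t" "\<not> good t'" by blast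
    define u where "u = t + t'"
    \<comment> \<open>The translates of \<open>?S\<close> by \<open>t\<close> and \<open>t'\<close>
      will lie in \<open>M\<close> and share 7 + 7 - 9 = 5 points. So \<open>?S\<close> and its
      translate by \<open>u\<close> share 5, \<open>M\<close> and its translate cover at most 16 - 5
      = 11, and their intersection \<open>D\<close> has at least 9 + 9 - 11 = 7 points.\<close>
    let ?S = "K - M"
    have tK: "t \<in> K" "t' \<in> K" using t MK by auto
    have u: "u \<in> K" "u \<noteq> 0"
      using tK t(3) subgrp_add[OF subK] by (auto simp: u_def add_eq_0_iff_eq)
    have finS: "finite ?S" using finK by simp
    have cS: "card ?S = 7" using MK cards finM by (simp add: card_Diff_subset)
    have tS: "(+) p ` ?S \<subseteq> M" if p: "p = t \<or> p = t'" for p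
    proof (rule image_subsetI, rule ccontr)
      fix s assume s: "s \<in> ?S" "p + s \<notin> M"
      then have "p + s \<in> ?S" using p tK subgrp_add[OF subK] by blast
      then have "s + (p + s) \<noteq> p"
        using bad_difference[OF cards _ _ s(1)] p t unfolding good_def by blast
      then show False by (simp add: ac_simps)
    qed
    have "card ((+) t ` ?S \<union> (+) t' ` ?S) \<le> 9"
      using card_mono[OF finM, of "(+) t ` ?S \<union> (+) t' ` ?S"] tS cards by simp
    moreover have ct: "card ((+) p ` A) = card A" for p and A :: "'v set"
      by (simp add: card_image inj_on_def)
    ultimately have i5: "card ((+) t ` ?S \<inter> (+) t' ` ?S) \<ge> 5"
      using card_Un_Int[of "(+) t ` ?S" "(+) t' ` ?S"] finS cS by simp
    have "(+) t ` ((+) t ` ?S \<inter> (+) t' ` ?S) \<subseteq> ?S \<inter> (+) u ` ?S"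
    proof (rule image_subsetI)
      fix v assume "v \<in> (+) t ` ?S \<inter> (+) t' ` ?S"
      then obtain s s' where s: "s \<in> ?S" "s' \<in> ?S" "v = t + s" "v = t' + s'" by blast
      have "t + v = s" "t + v = u + s'" by (simp add: s(3)) (simp add: s(4) u_def add.assoc)
      then show "t + v \<in> ?S \<inter> (+) u ` ?S" using s(1,2) by auto
    qed
    then have "card ((+) t ` ((+) t ` ?S \<inter> (+) t' ` ?S)) \<le> card (?S \<inter> (+) u ` ?S)"
      by (rule card_mono[rotated]) (use finS in simp)
    then have S5: "card (?S \<inter> (+) u ` ?S) \<ge> 5" using i5 unfolding ct by linarith
    have uK: "u + v \<in> K" if "v \<in> K" for v using subgrp_add[OF subK u(1) that] .
    have disj: "(M \<union> (+) u ` M) \<inter> (?S \<inter> (+) u ` ?S) = {}"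
      by (auto simp: image_iff)
    have "M \<union> (+) u ` M \<subseteq> K" "?S \<inter> (+) u ` ?S \<subseteq> K" using MK uK by blast+
    then have "card ((M \<union> (+) u ` M) \<union> (?S \<inter> (+) u ` ?S)) \<le> 16"
      using card_mono[OF finK, of "(M \<union> (+) u ` M) \<union> (?S \<inter> (+) u ` ?S)"] cards by simp
    moreover have "card ((M \<union> (+) u ` M) \<union> (?S \<inter> (+) u ` ?S))
        = card (M \<union> (+) u ` M) + card (?S \<inter> (+) u ` ?S)"
      by (rule card_Un_disjoint) (use finM finS disj in auto)
    ultimately have "card (M \<union> (+) u ` M) \<le> 11" using S5 by linarith
    define D where "D = M \<inter> (+) u ` M"
    have "card M + card ((+) u ` M) = card (M \<union> (+) u ` M) + card D"
      unfolding D_def by (rule card_Un_Int) (use finM in auto)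
    then have D7: "card D \<ge> 7" using \<open>card (M \<union> (+) u ` M) \<le> 11\<close> cards unfolding ct by linarith
    have DM: "v \<in> M" "v + u \<in> M" if "v \<in> D" for v using that by (auto simp: D_def ac_simps)
    \<comment> \<open>Seven points suffice to choose four that are distinct modulo \<open>u\<close>:
      three chosen ones exclude only six.\<close>
    have Dex: "\<exists>v\<in>D. v \<notin> B" if "card B < 7" "finite B" for B
      using ex_notin[of B D] that D7 by (metis le_trans not_le)
    obtain a where a: "a \<in> D" using Dex[of "{}"] by auto
    have "card {a, a + u} < 7" by (simp add: card_insert_if)
    then obtain b where b: "b \<in> D" "b \<notin> {a, a + u}" using Dex by blast
    have "card {a, a + u, b, b + u} < 7" by (simp add: card_insert_if)
    then obtain c where c: "c \<in> D" "c \<notin> {a, a + u, b, b + u}" using Dex by blast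
    have "card {a, a + u, b, b + u, c, c + u} < 7" by (simp add: card_insert_if)
    then obtain d where d: "d \<in> D" "d \<notin> {a, a + u, b, b + u, c, c + u}" using Dex by blast
    have uu: "v + u + u = v" for v by (simp add: add.assoc)
    have tri: False if v: "v \<in> D" "w \<in> D" "z \<in> D" "w \<noteq> v" "w \<noteq> v + u" "v + w + z = 0 \<or> v + w + z = u" for v w z
    proof (rule six_in_plane[OF cards u])
      have "v + w = z \<or> v + w = z + u" using v(6) by (auto simp: add_eq_iff ac_simps)
      then have "v + w \<in> M" "v + w + u \<in> M" using DM[OF v(3)] by (auto simp: uu)
      then show "{v, v + u, w, w + u, v + w, v + w + u} \<subseteq> M" using DM v(1,2) by simp
    qed (use v(4,5) in auto)
    have nz: "v \<noteq> 0" "v \<noteq> u" if "v \<in> D" for v using DM[OF that] zero_notin by auto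
    have qs: "subgrp {0, u}" by (auto simp: subgrp_def)
    have cabcd: "card {a, b, c, d} = 4" using b c d by auto
    have "\<exists>J\<subseteq>{a, b, c, d}. J \<noteq> {} \<and> (\<Sum>v\<in>J. v) \<in> {0, u}"
    proof (rule ex_word[OF _ qs subK finK])
      show "card K < 2 ^ card {a, b, c, d} * card {0, u}" using cards cabcd u(2) by simp
      show "(\<lambda>v. v) ` {a, b, c, d} \<subseteq> K" using a b c d DM MK by auto
    qed (use u subgrp_0[OF subK] in auto)
    then obtain J where J: "J \<subseteq> {a, b, c, d}" "J \<noteq> {}" "\<Sum>J \<in> {0, u}" by blast
    have "\<Sum>J = (\<Sum>v\<in>{a, b, c, d}. if v \<in> J then v else 0)"
      using J(1) by (simp add: sum.inter_restrict[symmetric] Int_absorb1)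
    also have "\<dots> = (if a \<in> J then a else 0) + (if b \<in> J then b else 0) + (if c \<in> J then c else 0) + (if d \<in> J then d else 0)"
      using b c d by (auto simp: add.assoc)
    finally have S: "(if a \<in> J then a else 0) + (if b \<in> J then b else 0) + (if c \<in> J then c else 0) + (if d \<in> J then d else 0) \<in> {0, u}"
      using J(3) by simp
    have pairs: "v + w \<noteq> 0 \<and> v + w \<noteq> u" if "w \<noteq> v" "w \<noteq> v + u" for v w
      using that by (auto simp: add_eq_0_iff_eq add_eq_iff)
    have ne: "b \<noteq> a" "b \<noteq> a + u" "c \<noteq> a" "c \<noteq> a + u" "c \<noteq> b" "c \<noteq> b + u" "d \<noteq> a" "d \<noteq> a + u" "d \<noteq> b" "d \<noteq> b + u"
      "d \<noteq> c" "d \<noteq> c + u" using b c d by auto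
    \<comment> \<open>A dependence modulo \<open>u\<close> has no length 1 or 2 by the choice of the
      points, and no length 3 by \<open>six_in_plane\<close>.\<close>
    have "a + b + c + d \<in> {0, u}"
    proof (rule ccontr)
      assume "\<not> ?thesis"
      then show False
        using S J(1,2) nz[OF a] nz[OF b(1)] nz[OF c(1)] nz[OF d(1)]
          pairs[OF ne(1,2)] pairs[OF ne(3,4)] pairs[OF ne(5,6)] pairs[OF ne(7,8)] pairs[OF ne(9,10)] pairs[OF ne(11,12)]
          tri[OF a b(1) c(1) ne(1,2)] tri[OF a b(1) d(1) ne(1,2)] tri[OF a c(1) d(1) ne(3,4)] tri[OF b(1) c(1) d(1) ne(5,6)]
        by (auto split: if_splits)
    qed
    then have abc: "a + b + c = d \<or> a + b + c = d + u" by (auto simp: add_eq_iff ac_simps)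
    show False
    proof (rule parallelepiped[OF cards u])
      show "{a + w, b + w, c + w, a + b + c + w} \<subseteq> M" if "w \<in> {0, u}" for w
      proof -
        have "a + b + c \<in> M" "a + b + c + u \<in> M"
          using abc DM[OF d(1)] by (auto simp: uu)
        then show ?thesis using that DM[OF a] DM[OF b(1)] DM[OF c(1)] by auto
      qed
      show "b + a \<notin> {0, u}" using pairs[OF ne(1,2)] by (simp add: add.commute)
      show "c + a \<notin> {0, u, b + a, b + a + u}"
        using pairs[OF ne(3,4)] ne(5,6) by (auto simp: add.commute add_eq_iff ac_simps)
    qed
  qed
qed

end

text \<open>A coincidence of labels contracts to the rank 3 case with seven elements; injective
  labels are transported along the inverse of \<open>q\<close>.\<close>

theorem word_system_four:
  assumes "word_system n x q {0} K E" "card K = 16" "card E = 9"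
  shows False
proof -
  interpret word_system n x q "{0}" K E by (rule assms)
  show False
  proof (cases "inj_on q E")
    case False
    then obtain a b where ab: "a \<in> E" "b \<in> E" "a \<noteq> b" "q a + q b \<in> {0}" by (auto simp: inj_on_def)
    show False
    proof (rule word_system_three[OF contract[OF ab]])
      have "card ({0} \<union> (+) (q a) ` {0}) = 2"
        using card_subgrp_extend[OF subH _ q_notin[OF ab(1)]] by simp
      then show "card K = 8 * card ({0} \<union> (+) (q a) ` {0})" using assms(2) by simp
      show "card (E - {a, b}) = 7" using assms(3) ab finE by (simp add: card_Diff_subset)
    qed
  next
    case True
    let ?p = "the_inv_into E q"
    let ?M = "q ` E"
    have pq: "?p (q i) = i" if "i \<in> E" for i using the_inv_into_f_f[OF True that] .
    have lift: "?p ` J \<subseteq> E" "q ` ?p ` J = J" "inj_on ?p J" "inj_on q (?p ` J)" if J: "J \<subseteq> ?M" for J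
    proof -
      show 1: "?p ` J \<subseteq> E" using J pq by auto
      show "q ` ?p ` J = J" using J pq by (force simp: image_iff)
      show "inj_on ?p J" using inj_on_the_inv_into[OF True] J by (rule inj_on_subset)
      show "inj_on q (?p ` J)" using True 1 inj_on_subset by blast
    qed
    have sums: "sum (x \<circ> ?p) J = sum x (?p ` J)" "sum q (?p ` J) = \<Sum>J" "card (?p ` J) = card J" if J: "J \<subseteq> ?M" for J
    proof -
      show "sum (x \<circ> ?p) J = sum x (?p ` J)" using sum.reindex[OF lift(3)[OF J], of x] by simp
      have "sum (\<lambda>v. v) (q ` ?p ` J) = sum q (?p ` J)" using sum.reindex[OF lift(4)[OF J], of "\<lambda>v. v"] by simp
      then show "sum q (?p ` J) = \<Sum>J" using lift(2)[OF J] by simp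
      show "card (?p ` J) = card J" using card_image[OF lift(3)[OF J]] .
    qed
    have sd: "?p ` sym_diff I J = sym_diff (?p ` I) (?p ` J)" if "I \<subseteq> ?M" "J \<subseteq> ?M" for I J
    proof -
      have "inj_on ?p ?M" by (rule lift(3)) simp
      then have "?p ` (I - J) = ?p ` I - ?p ` J" "?p ` (J - I) = ?p ` J - ?p ` I"
        using inj_on_image_set_diff[of ?p ?M I J] inj_on_image_set_diff[of ?p ?M J I] that by blast+
      then show ?thesis by (simp only: image_Un)
    qed
    have cM: "card ?M = 9" using card_image[OF True] assms(3) by simp
    interpret V: vector_words n "x \<circ> ?p" K ?M
    proof unfold_locales
      show "4 * int (card ?M) < n" using n_large cM assms(3) by simp
      show "1 \<le> sum (x \<circ> ?p) J mod n \<and> sum (x \<circ> ?p) J mod n < int (card J)"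
        if "J \<subseteq> ?M" "J \<noteq> {}" "\<Sum>J \<in> {0}" for J
        using range[OF lift(1)[OF that(1)]] that sums[OF that(1)] by auto
      show "even (sum (x \<circ> ?p) I mod n + sum (x \<circ> ?p) J mod n + sum (x \<circ> ?p) (sym_diff I J) mod n)"
        if "I \<subseteq> ?M" "J \<subseteq> ?M" "\<Sum>I \<in> {0}" "\<Sum>J \<in> {0}" for I J
      proof -
        have sub: "sym_diff I J \<subseteq> ?M" using that by blast
        have "even (F (?p ` I) + F (?p ` J) + F (sym_diff (?p ` I) (?p ` J)))"
          by (rule parity[OF lift(1)[OF that(1)] lift(1)[OF that(2)]])
            (simp_all only: sums(2)[OF that(1)] sums(2)[OF that(2)] that(3,4))
        then show ?thesis
          unfolding sums(1)[OF that(1)] sums(1)[OF that(2)] sums(1)[OF sub] sd[OF that(1,2)] .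
      qed
      show "(\<lambda>v. v) ` ?M \<subseteq> K" using qE by simp
      show "finite ?M" using finE by simp
    qed (rule odd_n finK subH subK HK)+
    show False by (rule V.nine_vectors[OF assms(2) cM])
  qed
qed

section \<open>Scherk's theorem and frequent residues\<close>

definition sumset :: "int \<Rightarrow> int set \<Rightarrow> int set \<Rightarrow> int set" where
  "sumset n A B = (\<lambda>(a, b). (a + b) mod n) ` (A \<times> B)"

text \<open>Dyson's transform: \<open>A\<close> gains the translate of \<open>B\<close> by
  \<open>a\<close>, and \<open>B\<close> keeps the \<open>b\<close> with a + b in \<open>A\<close>.
  The total size is preserved, the sumset does not grow, and 0 remains a sum in one way only. Some
  \<open>a\<close> shrinks \<open>B\<close>, since otherwise translation by \<open>b0\<close> would
  permute \<open>A\<close> and reach 0.\<close>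

lemma scherk:
  fixes n :: int
  assumes "A \<subseteq> {0..<n}" "B \<subseteq> {0..<n}" "0 \<in> A" "0 \<in> B"
    and "\<And>a b. a \<in> A \<Longrightarrow> b \<in> B \<Longrightarrow> (a + b) mod n = 0 \<Longrightarrow> a = 0 \<and> b = 0"
  shows "card A + card B \<le> card (sumset n A B) + 1"
  using assms
proof (induction "card B" arbitrary: A B rule: less_induct)
  case less
  have fin: "finite A" "finite B" using less.prems(1,2) finite_subset by blast+
  have inj: "inj_on (\<lambda>b. (a + b) mod n) C" if "C \<subseteq> {0..<n}" for a C
  proof (rule inj_onI)
    fix b b' assume *: "b \<in> C" "b' \<in> C" "(a + b) mod n = (a + b') mod n"
    then have "[b = b'] (mod n)" using cong_add_lcancel[of a b b' n] by (simp add: cong_def)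
    moreover have "b \<in> {0..<n}" "b' \<in> {0..<n}" using * that by blast+
    ultimately show "b = b'" by (simp add: cong_def)
  qed
  show ?case
  proof (cases "B = {0}")
    case True
    have "sumset n A B = A"
      using less.prems(1) unfolding sumset_def True by (force simp: image_iff subset_eq)
    then show ?thesis using True by simp
  next
    case False
    then obtain b0 where b0: "b0 \<in> B" "b0 \<noteq> 0" using less.prems(4) by blast
    have "\<exists>a\<in>A. \<exists>b\<in>B. (a + b) mod n \<notin> A"
    proof (rule ccontr)
      assume *: "\<not> ?thesis"
      have "(\<lambda>a. (b0 + a) mod n) ` A \<subseteq> A" using * b0 by (auto simp: add.commute)
      then have "(\<lambda>a. (b0 + a) mod n) ` A = A"
        by (rule endo_inj_surj[OF fin(1) _ inj[OF less.prems(1)]])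
      then have "0 \<in> (\<lambda>a. (b0 + a) mod n) ` A" using less.prems(3) by simp
      then obtain a where "0 = (b0 + a) mod n" "a \<in> A" by (rule imageE)
      then show False using less.prems(5)[of a b0] b0 by (simp add: add.commute)
    qed
    then obtain a b1 where a: "a \<in> A" "b1 \<in> B" "(a + b1) mod n \<notin> A" by blast
    define A' where "A' = A \<union> (\<lambda>b. (a + b) mod n) ` B"
    define B' where "B' = {b\<in>B. (a + b) mod n \<in> A}"
    have npos: "0 < n" using less.prems(1,3) by auto
    have amod: "a mod n = a" using a(1) less.prems(1) by auto
    have "B' \<subset> B" using a by (auto simp: B'_def)
    then have cB: "card B' < card B" using fin psubset_card_mono by blast
    have IH: "card A' + card B' \<le> card (sumset n A' B') + 1"
    proof (rule less.hyps[OF cB])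
      show "A' \<subseteq> {0..<n}" using less.prems(1) npos by (auto simp: A'_def)
      show "B' \<subseteq> {0..<n}" using less.prems(2) by (auto simp: B'_def)
      show "0 \<in> A'" using less.prems(3) by (simp add: A'_def)
      show "0 \<in> B'" using less.prems(4) a(1) amod by (simp add: B'_def)
      show "x = 0 \<and> b' = 0" if x: "x \<in> A'" "b' \<in> B'" "(x + b') mod n = 0" for x b'
      proof (cases "x \<in> A")
        case True
        then show ?thesis using less.prems(5)[of x b'] x by (simp add: B'_def)
      next
        case False
        then obtain b where b: "b \<in> B" "x = (a + b) mod n" using x(1) by (auto simp: A'_def)
        have "((a + b') mod n + b) mod n = 0"
          using x(3) unfolding b(2) by (simp add: mod_simps ac_simps)
        then have "(a + b') mod n = 0 \<and> b = 0"
          using less.prems(5)[of "(a + b') mod n" b] x(2) b(1) by (simp add: B'_def)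
        then have "a = 0 \<and> b' = 0 \<and> b = 0" using less.prems(5)[of a b'] a(1) x(2) by (simp add: B'_def)
        then show ?thesis using b(2) by simp
      qed
    qed
    have "sumset n A' B' \<subseteq> sumset n A B"
    proof
      fix z assume "z \<in> sumset n A' B'"
      then obtain x b' where x: "x \<in> A'" "b' \<in> B'" "z = (x + b') mod n" by (auto simp: sumset_def)
      show "z \<in> sumset n A B"
      proof (cases "x \<in> A")
        case True
        then have "(x, b') \<in> A \<times> B" using x by (simp add: B'_def)
        then show ?thesis unfolding sumset_def x(3) by (rule rev_image_eqI) simp
      next
        case False
        then obtain b where b: "b \<in> B" "x = (a + b) mod n" using x(1) by (auto simp: A'_def)
        have "((a + b') mod n, b) \<in> A \<times> B" using x(2) b(1) by (simp add: B'_def)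
        moreover have "z = ((a + b') mod n + b) mod n" unfolding x(3) b(2) by (simp add: mod_simps ac_simps)
        ultimately show ?thesis unfolding sumset_def by (intro rev_image_eqI) auto
      qed
    qed
    then have "card (sumset n A' B') \<le> card (sumset n A B)"
      using fin by (intro card_mono) (auto simp: sumset_def)
    moreover have "card A' = card A + card (B - B')"
    proof -
      have "A' = A \<union> (\<lambda>b. (a + b) mod n) ` (B - B')" by (auto simp: A'_def B'_def)
      moreover have "A \<inter> (\<lambda>b. (a + b) mod n) ` (B - B') = {}" by (auto simp: B'_def)
      moreover have "card ((\<lambda>b. (a + b) mod n) ` (B - B')) = card (B - B')"
        by (rule card_image) (rule inj, use less.prems(2) in blast)
      ultimately show ?thesis using fin by (simp add: card_Un_disjoint)
    qed
    moreover have "card (B - B') = card B - card B'"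
      using \<open>B' \<subset> B\<close> fin by (intro card_Diff_subset) (auto intro: finite_subset)
    ultimately show ?thesis using IH cB by linarith
  qed
qed

text \<open>Zero-sum freeness in F_2^5 + C_n in coordinates; an indexed family instead of a multiset
  lets single occurrences be exchanged.\<close>

definition zsf :: "int \<Rightarrow> ('i \<Rightarrow> 'v::char_two) \<Rightarrow> ('i \<Rightarrow> int) \<Rightarrow> 'i set \<Rightarrow> bool" where
  "zsf n c y I \<longleftrightarrow> (\<forall>J\<subseteq>I. J \<noteq> {} \<longrightarrow> \<not> (sum c J = 0 \<and> n dvd sum y J))"

lemma zsfD: "zsf n c y I \<Longrightarrow> J \<subseteq> I \<Longrightarrow> J \<noteq> {} \<Longrightarrow> sum c J = 0 \<Longrightarrow> \<not> n dvd sum y J"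
  by (auto simp: zsf_def)

definition zsf_mod :: "int \<Rightarrow> ('i \<Rightarrow> int) \<Rightarrow> 'i set \<Rightarrow> bool" where
  "zsf_mod n s P \<longleftrightarrow> (\<forall>J\<subseteq>P. J \<noteq> {} \<longrightarrow> sum s J mod n \<noteq> 0)"

definition subsums :: "int \<Rightarrow> ('i \<Rightarrow> int) \<Rightarrow> 'i set \<Rightarrow> int set" where
  "subsums n s J = (\<lambda>K. sum s K mod n) ` Pow J"

lemma finite_subsums: "finite J \<Longrightarrow> finite (subsums n s J)"
  by (simp add: subsums_def)

lemma subsums_bound: "0 < n \<Longrightarrow> int (card (subsums n s J)) \<le> n"
proof -
  assume n: "0 < n"
  have "subsums n s J \<subseteq> {0..<n}" using n by (auto simp: subsums_def)
  then have "card (subsums n s J) \<le> card {0..<n}" by (rule card_mono[rotated]) simp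
  then show ?thesis using n by simp
qed

text \<open>Scherk's theorem applies because a vanishing sum would come from a zero-sum subset. So
  the number of subset sums minus 1 is superadditive.\<close>

lemma card_subsums_Un:
  assumes "zsf_mod n s (J1 \<union> J2)" "J1 \<inter> J2 = {}" "finite J1" "finite J2" "0 < n"
  shows "card (subsums n s J1) + card (subsums n s J2) \<le> card (subsums n s (J1 \<union> J2)) + 1"
proof -
  have un: "(sum s K1 mod n + sum s K2 mod n) mod n = sum s (K1 \<union> K2) mod n"
    if "K1 \<subseteq> J1" "K2 \<subseteq> J2" for K1 K2
    using that assms(2-4) sum.union_disjoint[of K1 K2 s] finite_subset by (metis disjoint_iff mod_add_eq subsetD)
  have "card (subsums n s J1) + card (subsums n s J2) \<le> card (sumset n (subsums n s J1) (subsums n s J2)) + 1"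
  proof (rule scherk)
    show "subsums n s J1 \<subseteq> {0..<n}" "subsums n s J2 \<subseteq> {0..<n}" using assms(5) by (auto simp: subsums_def)
    show "0 \<in> subsums n s J1" "0 \<in> subsums n s J2"
      by (auto simp: subsums_def image_iff intro!: bexI[of _ "{}"])
    show "a = 0 \<and> b = 0" if ab: "a \<in> subsums n s J1" "b \<in> subsums n s J2" "(a + b) mod n = 0" for a b
    proof -
      obtain K1 K2 where K: "K1 \<subseteq> J1" "K2 \<subseteq> J2" "a = sum s K1 mod n" "b = sum s K2 mod n"
        using ab(1,2) by (auto simp: subsums_def)
      have "sum s (K1 \<union> K2) mod n = 0" using ab(3) un[OF K(1,2)] K(3,4) by simp
      moreover have "K1 \<union> K2 \<subseteq> J1 \<union> J2" using K by blast
      ultimately have "K1 \<union> K2 = {}" using assms(1)[unfolded zsf_mod_def, rule_format, of "K1 \<union> K2"] by fast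
      then show ?thesis using K by simp
    qed
  qed
  moreover have "sumset n (subsums n s J1) (subsums n s J2) \<subseteq> subsums n s (J1 \<union> J2)"
  proof
    fix z assume "z \<in> sumset n (subsums n s J1) (subsums n s J2)"
    then obtain K1 K2 where K: "K1 \<subseteq> J1" "K2 \<subseteq> J2" "z = (sum s K1 mod n + sum s K2 mod n) mod n"
      by (auto simp: subsums_def sumset_def)
    then show "z \<in> subsums n s (J1 \<union> J2)"
      unfolding subsums_def using un[OF K(1,2)] by (intro image_eqI[of _ _ "K1 \<union> K2"]) auto
  qed
  then have "card (sumset n (subsums n s J1) (subsums n s J2)) \<le> card (subsums n s (J1 \<union> J2))"
    by (rule card_mono[rotated]) (use assms(3,4) in \<open>simp add: finite_subsums\<close>)
  ultimately show ?thesis by linarith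
qed

lemma zsf_mod_subset: "zsf_mod n s P \<Longrightarrow> Q \<subseteq> P \<Longrightarrow> zsf_mod n s Q"
  by (auto simp: zsf_mod_def)

lemma card_subsums_singles:
  assumes "finite L" "finite U" "U \<inter> L = {}" "zsf_mod n s (U \<union> L)" "0 < n"
  shows "card (subsums n s U) + card L \<le> card (subsums n s (U \<union> L))"
  using assms
proof (induction L rule: finite_induct)
  case (insert p L)
  have "s p mod n \<noteq> 0" using insert.prems(3) unfolding zsf_mod_def by (metis Un_insert_right empty_not_insert empty_subsetI insert_subset insertI1 sum.insert_if sum.empty finite.emptyI add_0_right emptyE)
  moreover have "subsums n s {p} = {0, s p mod n}" by (auto simp: subsums_def Pow_insert)
  ultimately have c2: "card (subsums n s {p}) = 2" by simp
  have "card (subsums n s (U \<union> L)) + card (subsums n s {p}) \<le> card (subsums n s ((U \<union> L) \<union> {p})) + 1"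
    by (rule card_subsums_Un) (use insert in auto)
  moreover have "card (subsums n s U) + card L \<le> card (subsums n s (U \<union> L))"
    by (rule insert.IH) (use insert.prems zsf_mod_subset[OF insert.prems(3), of "U \<union> L"] in auto)
  ultimately show ?case using c2 insert.hyps by simp
qed simp

section \<open>Matchings and a residue of high multiplicity\<close>

text \<open>The relation \<open>R\<close> is used in two ways: different residues in
  \<open>frequent_residue\<close>, equal labels from there on.\<close>

definition matching :: "('i \<Rightarrow> 'i \<Rightarrow> bool) \<Rightarrow> 'i set \<Rightarrow> 'i set set \<Rightarrow> bool" where
  "matching R P D \<longleftrightarrow> (\<forall>e\<in>D. \<exists>p\<in>P. \<exists>r\<in>P. p \<noteq> r \<and> R p r \<and> e = {p, r}) \<and>
     (\<forall>e\<in>D. \<forall>e'\<in>D. e \<noteq> e' \<longrightarrow> e \<inter> e' = {})"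

lemma matching_Union: "matching R P D \<Longrightarrow> \<Union>D \<subseteq> P"
  by (auto simp: matching_def)

lemma matching_subset: "matching R P D \<Longrightarrow> D' \<subseteq> D \<Longrightarrow> matching R P D'"
  unfolding matching_def by (meson subsetD)

lemma matching_finite: "matching R P D \<Longrightarrow> finite P \<Longrightarrow> finite D"
  using matching_Union[of R P D] by (metis finite_UnionD finite_subset)

lemma matching_edge:
  assumes "matching R P D" "e \<in> D"
  obtains p r where "p \<in> P" "r \<in> P" "p \<noteq> r" "R p r" "e = {p, r}"
proof -
  have "\<exists>p\<in>P. \<exists>r\<in>P. p \<noteq> r \<and> R p r \<and> e = {p, r}" using assms unfolding matching_def by simp
  then show thesis using that by fast
qed

lemma matching_disjoint: "matching R P D \<Longrightarrow> e \<in> D \<Longrightarrow> e' \<in> D \<Longrightarrow> e \<noteq> e' \<Longrightarrow> e \<inter> e' = {}"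
  unfolding matching_def by metis

lemma matching_insert:
  assumes "matching R P D" "p \<in> P" "r \<in> P" "p \<noteq> r" "R p r" "p \<notin> \<Union>D" "r \<notin> \<Union>D"
  shows "matching R P (insert {p, r} D)"
  unfolding matching_def
proof (intro conjI ballI impI)
  fix e assume "e \<in> insert {p, r} D"
  then show "\<exists>a\<in>P. \<exists>b\<in>P. a \<noteq> b \<and> R a b \<and> e = {a, b}"
    using matching_edge[OF assms(1), of e] assms(2-5) by (metis insert_iff)
next
  have dj: "e \<inter> {p, r} = {}" if "e \<in> D" for e using assms(6,7) that by blast
  fix e e' assume "e \<in> insert {p, r} D" "e' \<in> insert {p, r} D" "e \<noteq> e'"
  then show "e \<inter> e' = {}"
    using dj[of e] dj[of e'] matching_disjoint[OF assms(1), of e e'] by (metis insert_iff Int_commute)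
qed

lemma card_matching_Union:
  assumes "matching R P D" "finite P"
  shows "card (\<Union>D) = 2 * card D"
proof -
  have "card (\<Union>D) = (\<Sum>e\<in>D. card e)"
  proof (rule card_Union_disjoint)
    show "pairwise disjnt D" using assms(1) by (auto simp: pairwise_def disjnt_def matching_def)
    show "finite e" if "e \<in> D" for e using that matching_edge[OF assms(1)] by (metis finite.emptyI finite_insert)
  qed
  also have "\<dots> = (\<Sum>e\<in>D. 2)"
    by (rule sum.cong) (use matching_edge[OF assms(1)] in \<open>metis card_2_iff\<close>)+
  finally show ?thesis by simp
qed

lemma sum_matching_Union:
  assumes "matching R P D"
  shows "sum f (\<Union>D) = (\<Sum>e\<in>D. sum f e)"
proof (rule sum.Union_disjoint[unfolded comp_def])
  show "\<forall>e\<in>D. finite e" using matching_edge[OF assms] by (metis finite.emptyI finite_insert)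
  show "\<forall>A\<in>D. \<forall>B\<in>D. A \<noteq> B \<longrightarrow> A \<inter> B = {}" using assms by (simp add: matching_def)
qed

lemma ex_max_matching:
  assumes "finite P"
  obtains D where "matching R P D" "\<And>D'. matching R P D' \<Longrightarrow> card D' \<le> card D"
proof -
  have b: "card D < Suc (card (Pow P))" if "matching R P D" for D
  proof -
    have "D \<subseteq> Pow P" using matching_Union[OF that] by blast
    then have "card D \<le> card (Pow P)" by (rule card_mono[rotated]) (use assms in simp)
    then show ?thesis by simp
  qed
  have "\<exists>D. matching R P D \<and> (\<forall>D'. matching R P D' \<longrightarrow> card D' \<le> card D)"
    by (rule ex_has_greatest_nat[of _ "{}"]) (use b in \<open>auto simp: matching_def\<close>)
  then show thesis using that by blast
qed

lemma max_matching_leftover: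
  assumes "finite P" "matching R P D" "\<And>D'. matching R P D' \<Longrightarrow> card D' \<le> card D"
    and "p \<in> P - \<Union>D" "r \<in> P - \<Union>D" "p \<noteq> r"
  shows "\<not> R p r"
proof
  assume "R p r"
  then have "matching R P (insert {p, r} D)"
    by (intro matching_insert) (use assms(2,4-6) in auto)
  moreover have "{p, r} \<notin> D" using assms(4) by blast
  ultimately show False using assms(3)[of "insert {p, r} D"] matching_finite[OF assms(2,1)] by simp
qed

text \<open>Two terms with different residues p and r have the four subset sums 0, p, r, p + r, so
  each edge adds 3.\<close>

lemma card_subsums_matching:
  assumes "finite P" "zsf_mod n s P" "matching (\<lambda>p r. s p mod n \<noteq> s r mod n) P D" "0 < n"
  shows "1 + 3 * card D \<le> card (subsums n s (\<Union>D))"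
proof -
  have "1 + 3 * card D' \<le> card (subsums n s (\<Union>D'))" if "finite D'" "D' \<subseteq> D" for D'
    using that
  proof (induction D' rule: finite_induct)
    case empty
    then show ?case by (simp add: subsums_def)
  next
    case (insert e D')
    obtain p r where e: "p \<in> P" "r \<in> P" "p \<noteq> r" "s p mod n \<noteq> s r mod n" "e = {p, r}"
      using matching_edge[OF assms(3)] insert.prems by blast
    have z: "J \<subseteq> P \<Longrightarrow> J \<noteq> {} \<Longrightarrow> sum s J mod n \<noteq> 0" for J using assms(2) by (simp add: zsf_mod_def)
    have nz: "s p mod n \<noteq> 0" "s r mod n \<noteq> 0" "(s p + s r) mod n \<noteq> 0"
      using z[of "{p}"] z[of "{r}"] z[of "{p, r}"] e(1-3) by simp_all
    have ne: "(s p + s r) mod n \<noteq> s p mod n" "(s p + s r) mod n \<noteq> s r mod n"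
      using nz cong_add_lcancel_0[of "s p" "s r" n] cong_add_rcancel_0[of "s p" "s r" n]
      by (auto simp: cong_def)
    have "subsums n s e = {0, s p mod n, s r mod n, (s p + s r) mod n}"
      using e(3) by (auto simp: e(5) subsums_def Pow_insert)
    then have c4: "card (subsums n s e) = 4" using nz ne e(4) by (auto simp: card_insert_if)
    have sub: "\<Union>D' \<union> e \<subseteq> P" using matching_Union[OF assms(3)] insert.prems by blast
    have "card (subsums n s (\<Union>D')) + card (subsums n s e) \<le> card (subsums n s (\<Union>D' \<union> e)) + 1"
    proof (rule card_subsums_Un)
      show "zsf_mod n s (\<Union>D' \<union> e)" by (rule zsf_mod_subset[OF assms(2) sub])
      show "\<Union>D' \<inter> e = {}" using matching_disjoint[OF assms(3)] insert by blast
      show "finite (\<Union>D')" "finite e" using sub assms(1) finite_subset by blast+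
    qed (rule assms(4))
    then show ?case using insert c4 by (simp add: Un_commute)
  qed
  then show ?thesis using matching_finite[OF assms(3,1)] by blast
qed

text \<open>Match terms of different residues maximally. An edge adds 3 subset sums and a leftover
  adds 1, so there are few edges. The leftovers share one residue, and by maximality each edge
  contains it as well, which gives at least \<open>card P - card D\<close> occurrences.\<close>

lemma frequent_residue:
  assumes "finite P" "zsf_mod n s P" "0 < n" "2 * n \<le> 3 * int (card P)"
  obtains r where "2 * int (card P) + 1 - n \<le> int (card {p\<in>P. s p mod n = r})"
proof -
  let ?R = "\<lambda>p r. s p mod n \<noteq> s r mod n"
  obtain D where D: "matching ?R P D" and max: "\<And>D'. matching ?R P D' \<Longrightarrow> card D' \<le> card D"
    using ex_max_matching[OF assms(1), of ?R] by blast
  let ?L = "P - \<Union>D"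
  note UP = matching_Union[OF D]
  have finU: "finite (\<Union>D)" using UP assms(1) finite_subset by blast
  have cL: "card ?L + 2 * card D = card P"
    using card_matching_Union[OF D assms(1)] card_Diff_subset[OF finU UP] card_mono[OF assms(1) UP] by simp
  have same: "s p mod n = s q mod n" if "p \<in> ?L" "q \<in> ?L" for p q
    using max_matching_leftover[OF assms(1) D max, of p q] that by (cases "p = q") auto
  have PU: "\<Union>D \<union> ?L = P" using UP by blast
  have "card (subsums n s (\<Union>D)) + card ?L \<le> card (subsums n s (\<Union>D \<union> ?L))"
    by (rule card_subsums_singles) (use assms finU PU in auto)
  then have "int (1 + 3 * card D + card ?L) \<le> n"
    using card_subsums_matching[OF assms(1,2) D assms(3)] subsums_bound[OF assms(3), of s P] unfolding PU by linarith
  then have Db: "int (card D) + int (card P) + 1 \<le> n" using cL by linarith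
  \<comment> \<open>This is where 2n \<le> 3 |P| enters; with two leftovers, an edge avoiding their
    residue could be replaced by two edges.\<close>
  then have "2 \<le> card ?L" using assms(4) cL by linarith
  then obtain Z where "Z \<subseteq> ?L" "card Z = 2" by (meson obtain_subset_with_card_n)
  then obtain l1 l2 where l: "l1 \<in> ?L" "l2 \<in> ?L" "l1 \<noteq> l2" by (auto simp: card_2_iff)
  have ex: "\<exists>p\<in>e. s p mod n = s l1 mod n" if e: "e \<in> D" for e
  proof (rule ccontr)
    assume no: "\<not> ?thesis"
    obtain p r where pr: "p \<in> P" "r \<in> P" "p \<noteq> r" "e = {p, r}" using matching_edge[OF D e] by blast
    let ?D = "insert {p, l1} (insert {r, l2} (D - {e}))"
    have notin: "p \<notin> \<Union>(D - {e})" "r \<notin> \<Union>(D - {e})" using matching_disjoint[OF D e] pr(4) by blast+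
    have ln: "l1 \<notin> \<Union>D" "l2 \<notin> \<Union>D" "l1 \<in> P" "l2 \<in> P" using l by blast+
    have pU: "p \<in> \<Union>D" "r \<in> \<Union>D" using e pr(4) by auto
    have neq: "p \<noteq> l1" "p \<noteq> l2" "r \<noteq> l1" "r \<noteq> l2" using pU ln by auto
    have R: "?R p l1" "?R r l2" using no pr(4) same[OF l(1,2)] by auto
    have m: "matching ?R P (D - {e})" by (rule matching_subset[OF D]) blast
    have m2: "matching ?R P (insert {r, l2} (D - {e}))"
      by (rule matching_insert[OF m pr(2) ln(4) neq(4) R(2) notin(2)]) (use ln(2) in blast)
    have m3: "matching ?R P ?D"
      by (rule matching_insert[OF m2 pr(1) ln(3) neq(1) R(1)]) (use notin(1) ln(1) neq pr(3) l(3) in auto)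
    have "{r, l2} \<notin> D - {e}" "{p, l1} \<notin> insert {r, l2} (D - {e})" using ln neq l(3) by auto
    then have "card ?D = Suc (Suc (card (D - {e})))" using matching_finite[OF D assms(1)] by simp
    also have "\<dots> = Suc (card D)" using e matching_finite[OF D assms(1)] by (simp add: card_gt_0_iff) (metis Suc_pred card_gt_0_iff empty_iff)
    finally show False using max[OF m3] by simp
  qed
  define f where "f e = (SOME p. p \<in> e \<and> s p mod n = s l1 mod n)" for e
  have f: "f e \<in> e" "s (f e) mod n = s l1 mod n" if "e \<in> D" for e
    using someI_ex[of "\<lambda>p. p \<in> e \<and> s p mod n = s l1 mod n"] ex[OF that] unfolding f_def by blast+
  have "inj_on f D" using f(1) matching_disjoint[OF D] by (metis disjoint_iff inj_onI)
  let ?C = "{p\<in>P. s p mod n = s l1 mod n}"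
  have "?L \<union> f ` D \<subseteq> ?C" using same[OF _ l(1)] f UP by blast
  then have "card (?L \<union> f ` D) \<le> card ?C" by (rule card_mono[rotated]) (use assms(1) in simp)
  moreover have "card (?L \<union> f ` D) = card ?L + card D"
    using card_Un_disjoint[of ?L "f ` D"] assms(1) matching_finite[OF D assms(1)] card_image[OF \<open>inj_on f D\<close>] f(1) by fastforce
  ultimately have "2 * int (card P) + 1 - n \<le> int (card ?C)" using Db cL by linarith
  then show thesis by (rule that)
qed

section \<open>Exchanging words for copies of one element\<close>

definition scal :: "nat \<Rightarrow> 'v::char_two \<Rightarrow> 'v" where "scal k v = (if even k then 0 else v)"

lemma scal_simps [simp]: "scal 0 v = 0" "scal (Suc k) v = v + scal k v"
  by (auto simp: scal_def)

lemma scal_add: "scal (k + l) v = scal k v + scal l v"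
  by (auto simp: scal_def)

lemma sum_const_char_two:
  assumes "\<And>i. i \<in> S \<Longrightarrow> c i = v"
  shows "sum c S = scal (card S) v"
proof (cases "finite S")
  case True
  then show ?thesis using assms by (induction S rule: finite_induct) auto
qed simp

lemma sum_const_cong:
  fixes y :: "'i \<Rightarrow> int"
  assumes "\<And>i. i \<in> S \<Longrightarrow> [y i = a] (mod n)"
  shows "[sum y S = int (card S) * a] (mod n)"
  using cong_sum[of S y "\<lambda>_. a" n] assms by simp

text \<open>Let K count the copies of e that a new zero-sum subset takes from \<open>J\<close> and
  \<open>U\<close>. If K \<le> |U|, take them all from \<open>U\<close>; otherwise f \<le> K, and
  the old \<open>J\<close> with K - f copies from \<open>U\<close> has the same sum. The bound f
  \<le> |U| + 1 closes the gap between the cases, and |J| \<le> f keeps K - f within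
  \<open>U\<close>.\<close>

lemma zsf_replace:
  assumes zsf: "zsf n c y E" and fin: "finite E" and J: "J \<subseteq> E" "J \<noteq> {}" and U: "U \<subseteq> E - J"
    and e: "\<And>i. i \<in> U \<Longrightarrow> c i = ce \<and> [y i = ye] (mod n)"
    and f: "sum c J = scal f ce" "[sum y J = int f * ye] (mod n)" "card J \<le> f" "f \<le> card U + 1"
  shows "zsf n (\<lambda>i. if i \<in> J then ce else c i) (\<lambda>i. if i \<in> J then ye else y i) E"
  unfolding zsf_def
proof (intro allI impI notI)
  let ?c = "\<lambda>i. if i \<in> J then ce else c i" and ?y = "\<lambda>i. if i \<in> J then ye else y i"
  fix N assume N: "N \<subseteq> E" "N \<noteq> {}" and z: "sum ?c N = 0 \<and> n dvd sum ?y N"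
  have finJ: "finite J" and finU: "finite U" and finN: "finite N"
    using J U N fin by (meson Diff_subset finite_subset)+
  define R where "R = N - J - U"
  define K where "K = card (N \<inter> J) + card (N \<inter> U)"
  have K_le: "K \<le> f + card U"
    unfolding K_def using card_mono[OF finJ, of "N \<inter> J"] card_mono[OF finU, of "N \<inter> U"] f(3) by simp
  have split: "sum g N = sum g (N \<inter> J) + sum g (N \<inter> U) + sum g R" for g :: "_ \<Rightarrow> 'x::comm_monoid_add"
  proof -
    have "sum g N = sum g (N \<inter> J) + sum g (N - J)" using finN by (simp add: sum.Int_Diff)
    also have "sum g (N - J) = sum g ((N - J) \<inter> U) + sum g R"
      unfolding R_def using finN by (simp add: sum.Int_Diff)
    also have "(N - J) \<inter> U = N \<inter> U" using U by blast
    finally show ?thesis by (simp add: add.assoc)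
  qed
  have cN: "scal K ce + sum c R = 0"
  proof -
    have "sum ?c (N \<inter> J) = scal (card (N \<inter> J)) ce" by (rule sum_const_char_two) simp
    moreover have "sum ?c (N \<inter> U) = scal (card (N \<inter> U)) ce" by (rule sum_const_char_two) (use e U in auto)
    moreover have "sum ?c R = sum c R" by (rule sum.cong) (auto simp: R_def)
    ultimately show ?thesis using z split[of ?c] by (simp add: K_def scal_add)
  qed
  have yN: "[int K * ye + sum y R = 0] (mod n)"
  proof -
    have 1: "[sum ?y (N \<inter> J) = int (card (N \<inter> J)) * ye] (mod n)" by (rule sum_const_cong) simp
    have 2: "[sum ?y (N \<inter> U) = int (card (N \<inter> U)) * ye] (mod n)" by (rule sum_const_cong) (use e U in auto)
    have 3: "sum ?y R = sum y R" by (rule sum.cong) (auto simp: R_def)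
    have "[sum ?y N = int (card (N \<inter> J)) * ye + int (card (N \<inter> U)) * ye + sum y R] (mod n)"
      unfolding split[of ?y] 3 by (rule cong_add[OF cong_add[OF 1 2] cong_refl])
    then have "[sum ?y N = int K * ye + sum y R] (mod n)" by (simp add: K_def distrib_right)
    then show ?thesis using z by (metis cong_0_iff cong_sym cong_trans)
  qed
  have "\<exists>N2\<subseteq>J \<union> U. sum c N2 = scal K ce \<and> [sum y N2 = int K * ye] (mod n) \<and> (K > 0 \<longrightarrow> N2 \<noteq> {})"
  proof (cases "K \<le> card U")
    case True
    then obtain S where S: "S \<subseteq> U" "card S = K" by (meson obtain_subset_with_card_n)
    have "sum c S = scal K ce" using sum_const_char_two[of S c ce] S e by blast
    moreover have "[sum y S = int K * ye] (mod n)" using sum_const_cong[of S y ye n] S e by blast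
    moreover have "K > 0 \<longrightarrow> S \<noteq> {}" using S by auto
    ultimately show ?thesis using S by blast
  next
    case False
    then have "f \<le> K" "K - f \<le> card U" using f(4) K_le by auto
    then obtain S where S: "S \<subseteq> U" "card S = K - f" by (meson obtain_subset_with_card_n)
    have dj: "J \<inter> S = {}" and finS: "finite S" using S U finU finite_subset by auto
    have "sum c (J \<union> S) = scal f ce + scal (K - f) ce"
      using sum_const_char_two[of S c ce] S e f(1) sum.union_disjoint[OF finJ finS dj, of c] by (metis subsetD)
    then have "sum c (J \<union> S) = scal K ce" using \<open>f \<le> K\<close> by (simp flip: scal_add)
    moreover have "[sum y (J \<union> S) = int f * ye + int (K - f) * ye] (mod n)"
      unfolding sum.union_disjoint[OF finJ finS dj]
      by (intro cong_add f(2)) (use sum_const_cong[of S y ye n] S e in \<open>metis subsetD\<close>)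
    then have "[sum y (J \<union> S) = int K * ye] (mod n)" using \<open>f \<le> K\<close> by (simp flip: distrib_right of_nat_add)
    ultimately show ?thesis using J S by blast
  qed
  then obtain N2 where N2: "N2 \<subseteq> J \<union> U" "sum c N2 = scal K ce" "[sum y N2 = int K * ye] (mod n)" "K > 0 \<longrightarrow> N2 \<noteq> {}"
    by blast
  have dj: "N2 \<inter> R = {}" using N2(1) by (auto simp: R_def)
  have finR: "finite N2" "finite R" using N2(1) finJ finU finN finite_subset by (auto simp: R_def)
  have "sum c (N2 \<union> R) = 0" using sum.union_disjoint[OF finR dj, of c] N2(2) cN by simp
  moreover have "[sum y (N2 \<union> R) = 0] (mod n)"
    using sum.union_disjoint[OF finR dj, of y] N2(3) yN by (metis cong_add_rcancel cong_trans)
  moreover have "N2 \<union> R \<subseteq> E" using N2(1) J U N by (auto simp: R_def)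
  moreover have "N2 \<union> R \<noteq> {}"
  proof (cases "K > 0")
    case False
    then have "N \<inter> J = {}" "N \<inter> U = {}" using finN by (auto simp: K_def)
    then show ?thesis using N by (auto simp: R_def)
  qed (use N2 in blast)
  ultimately show False using zsfD[OF zsf] cong_0_iff by blast
qed

text \<open>\<open>A\<close> lists the coordinates of all elements that may be appended, at an index
  \<open>j\<close> which no exchange touches; so one chain of exchanges serves all of them.\<close>

definition compat :: "int \<Rightarrow> 'i set \<Rightarrow> 'i \<Rightarrow> ('v::char_two \<times> int) set \<Rightarrow> ('i \<Rightarrow> 'v) \<Rightarrow> ('i \<Rightarrow> int) \<Rightarrow> bool" where
  "compat n I j A c y \<longleftrightarrow> zsf n c y I \<and> (\<forall>(d, b)\<in>A. zsf n (c(j := d)) (y(j := b)) (insert j I))"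

lemma compat_replace:
  assumes "compat n I j A c y" "finite I" "j \<notin> I" "J \<subseteq> I" "J \<noteq> {}" "U \<subseteq> I - J"
    and "\<And>i. i \<in> U \<Longrightarrow> c i = ce \<and> [y i = ye] (mod n)"
    and "sum c J = scal f ce" "[sum y J = int f * ye] (mod n)" "card J \<le> f" "f \<le> card U + 1"
  shows "compat n I j A (\<lambda>i. if i \<in> J then ce else c i) (\<lambda>i. if i \<in> J then ye else y i)"
  unfolding compat_def
proof (intro conjI ballI)
  show "zsf n (\<lambda>i. if i \<in> J then ce else c i) (\<lambda>i. if i \<in> J then ye else y i) I"
    by (rule zsf_replace[of _ _ _ _ _ U ce ye f]) (use assms in \<open>auto simp: compat_def\<close>)
  have upd: "(\<lambda>i. if i \<in> J then v else w i)(j := d) = (\<lambda>i. if i \<in> J then v else (w(j := d)) i)"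
    for v d :: 'x and w
    using assms(3,4) by (auto simp: fun_eq_iff)
  show "case p of (d, b) \<Rightarrow> zsf n ((\<lambda>i. if i \<in> J then ce else c i)(j := d))
      ((\<lambda>i. if i \<in> J then ye else y i)(j := b)) (insert j I)" if "p \<in> A" for p
  proof (cases p)
    case (Pair d b)
    have z: "zsf n (c(j := d)) (y(j := b)) (insert j I)" using assms(1) that Pair by (auto simp: compat_def)
    have jJ: "i \<noteq> j" if "i \<in> J \<union> U" for i using that assms(3,4,6) by auto
    have "sum (c(j := d)) J = sum c J" "sum (y(j := b)) J = sum y J"
      by (rule sum.cong; use jJ in auto)+
    then have "zsf n (\<lambda>i. if i \<in> J then ce else (c(j := d)) i) (\<lambda>i. if i \<in> J then ye else (y(j := b)) i) (insert j I)"
      using assms jJ by (intro zsf_replace[OF z, of J U ce ye f]) auto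
    then show ?thesis unfolding Pair prod.case upd .
  qed
qed

text \<open>A pair of equal labels and value 1 sums to 2e, so it is a word with f = |J| = 2, and the
  one copy \<open>z\<close> already meets f \<le> |U| + 1.\<close>

lemma compat_pairs:
  assumes "finite D" "matching (\<lambda>p r. c p = c r) I D" "\<And>e. e \<in> D \<Longrightarrow> [sum y e = 1] (mod n)"
    and "compat n I j A c y" "finite I" "j \<notin> I" "z \<in> I - \<Union>D" "c z = ce" "[y z = ye] (mod n)" "[2 * ye = 1] (mod n)"
  shows "\<exists>c' y'. compat n I j A c' y' \<and> (\<forall>i\<in>insert z (\<Union>D). c' i = ce \<and> [y' i = ye] (mod n))
     \<and> (\<forall>i. i \<notin> \<Union>D \<longrightarrow> c' i = c i \<and> y' i = y i)"
  using assms(1-3,7)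
proof (induction D rule: finite_induct)
  case empty
  then show ?case using assms by auto
next
  case (insert e D)
  have mD: "matching (\<lambda>p r. c p = c r) I D" by (rule matching_subset[OF insert.prems(1)]) blast
  obtain c' y' where c': "compat n I j A c' y'" "\<forall>i\<in>insert z (\<Union>D). c' i = ce \<and> [y' i = ye] (mod n)"
    "\<forall>i. i \<notin> \<Union>D \<longrightarrow> c' i = c i \<and> y' i = y i"
    using insert.IH[OF mD] insert.prems(2,3) by auto
  obtain p r where e: "p \<in> I" "r \<in> I" "p \<noteq> r" "c p = c r" "e = {p, r}"
    using matching_edge[OF insert.prems(1), of e] by blast
  have dj: "e \<inter> \<Union>D = {}" using matching_disjoint[OF insert.prems(1), of e] insert.hyps(2) by blast
  then have same: "c' p = c p" "y' p = y p" "c' r = c r" "y' r = y r" using c'(3) e(5) by auto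
  have "compat n I j A (\<lambda>i. if i \<in> e then ce else c' i) (\<lambda>i. if i \<in> e then ye else y' i)"
  proof (rule compat_replace[OF c'(1) assms(5,6), of e "{z}" ce ye 2])
    show "sum c' e = scal 2 ce" using e same by (simp add: scal_def)
    have "sum y' e = sum y e" using e same by simp
    moreover have "[int 2 * ye = 1] (mod n)" using assms(10) by simp
    ultimately show "[sum y' e = int 2 * ye] (mod n)"
      using insert.prems(2)[of e] by (metis cong_sym cong_trans insertI1)
    show "{z} \<subseteq> I - e" using insert.prems(3) by auto
  qed (use e c'(2) in auto)
  then show ?case
    using c'(2,3) dj by (intro exI[of _ "\<lambda>i. if i \<in> e then ce else c' i"] exI[of _ "\<lambda>i. if i \<in> e then ye else y' i"]) auto
qed

text \<open>As e has order 2n, the sum of \<open>J\<close> is f copies of e for a unique f in [0,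
  2n). If 2n - f copies were available, they would complete \<open>J\<close> to a zero sum; hence f
  \<le> 2n - 1 - |U| < n, so f is the residue of \<open>2 * sum y J\<close>, and its parity is read
  off the label.\<close>

lemma word_value:
  assumes zsf: "zsf n c y E" and fin: "finite E" and n: "odd n" "0 < n" and U: "U \<subseteq> E"
    and e: "\<And>i. i \<in> U \<Longrightarrow> c i = ce \<and> [y i = ye] (mod n)" and ye: "[2 * ye = 1] (mod n)"
    and m: "n \<le> int (card U)" and ce: "ce \<noteq> 0"
    and J: "J \<subseteq> E - U" "J \<noteq> {}" "sum c J = 0 \<or> sum c J = ce"
  shows "1 \<le> (2 * sum y J) mod n" "(2 * sum y J) mod n \<le> 2 * n - 1 - int (card U)"
    "even ((2 * sum y J) mod n) \<longleftrightarrow> sum c J = 0"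
proof -
  define g where "g = (2 * sum y J) mod n"
  have g: "0 \<le> g" "g < n" "[2 * sum y J = g] (mod n)" using n by (auto simp: g_def cong_def)
  \<comment> \<open>Of the lifts g and g + n to [0, 2n), the one whose parity fits the label; they
    differ in parity because n is odd.\<close>
  define f where "f = (if even g \<longleftrightarrow> sum c J = 0 then g else g + n)"
  have f: "even f \<longleftrightarrow> sum c J = 0" "0 \<le> f" "f < 2 * n" "[2 * sum y J = f] (mod n)" "f < n \<longrightarrow> f = g"
  proof -
    have "f = g \<or> f = g + n" by (simp add: f_def)
    then show "0 \<le> f" "f < 2 * n" "f < n \<longrightarrow> f = g" "[2 * sum y J = f] (mod n)"
      using g by (auto simp: cong_def)
    show "even f \<longleftrightarrow> sum c J = 0" using n(1) by (auto simp: f_def)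
  qed
  have finU: "finite U" using U fin finite_subset by blast
  have fb: "f \<le> 2 * n - 1 - int (card U)"
  proof (rule ccontr)
    assume "\<not> ?thesis"
    then have "nat (2 * n - f) \<le> card U" by linarith
    then obtain S where S: "S \<subseteq> U" "card S = nat (2 * n - f)" by (meson obtain_subset_with_card_n)
    have cS: "int (card S) = 2 * n - f" using S(2) f(3) by simp
    have finS: "finite S" "finite J" using S finU J fin finite_subset by (blast, meson Diff_subset finite_subset subset_trans)
    have dj: "J \<inter> S = {}" using S J by blast
    have "even (card S) \<longleftrightarrow> even f" using cS by presburger
    moreover have "sum c S = scal (card S) ce" by (rule sum_const_char_two) (use S(1) e in blast)
    ultimately have "sum c S = sum c J" using f(1) J(3) ce by (auto simp: scal_def)
    then have "sum c (J \<union> S) = 0" using sum.union_disjoint[OF finS(2,1) dj, of c] by simp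
    moreover have "[2 * sum y (J \<union> S) = f + (2 * n - f) * 1] (mod n)"
    proof -
      have "[sum y S = (2 * n - f) * ye] (mod n)" using sum_const_cong[of S y ye n] S(1) e cS by (metis subsetD)
      then have "[2 * sum y S = 2 * ((2 * n - f) * ye)] (mod n)" by (rule cong_scalar_left)
      moreover have "[(2 * n - f) * (2 * ye) = (2 * n - f) * 1] (mod n)" by (rule cong_scalar_left[OF ye])
      ultimately have "[2 * sum y S = (2 * n - f) * 1] (mod n)" by (metis cong_trans mult.left_commute)
      then show ?thesis
        unfolding sum.union_disjoint[OF finS(2,1) dj] distrib_left by (rule cong_add[OF f(4)])
    qed
    then have "[2 * sum y (J \<union> S) = 2 * 0] (mod n)" by (simp add: cong_def)
    then have "n dvd sum y (J \<union> S)" using cong_half[OF n(1)] cong_0_iff by blast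
    ultimately show False using zsfD[OF zsf, of "J \<union> S"] J S U by blast
  qed
  then have fg: "f = g" using m f(5) by linarith
  then show "(2 * sum y J) mod n \<le> 2 * n - 1 - int (card U)" "even ((2 * sum y J) mod n) \<longleftrightarrow> sum c J = 0" using fb f(1) unfolding g_def[symmetric] by simp_all
  have "g \<noteq> 0"
  proof
    assume 0: "g = 0"
    then have "sum c J = 0" using fg f(1) by simp
    moreover have "[2 * sum y J = 2 * 0] (mod n)" using 0 by (simp add: cong_def g_def)
    then have "n dvd sum y J" using cong_half[OF n(1)] cong_0_iff by blast
    ultimately show False using zsfD[OF zsf, of J] J by blast
  qed
  then show "1 \<le> (2 * sum y J) mod n" using g unfolding g_def[symmetric] by linarith
qed

text \<open>With label 0, already n copies of e would sum to zero; 2n copies always do.\<close>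

lemma multiplicity_bounds:
  assumes zsf: "zsf n c y E" and fin: "finite E" and n: "odd n" "0 < n" and U: "U \<subseteq> E"
    and e: "\<And>i. i \<in> U \<Longrightarrow> c i = ce \<and> [y i = ye] (mod n)" and m: "n \<le> int (card U)"
  shows "ce \<noteq> 0" "int (card U) < 2 * n"
proof -
  have key: False if k: "k \<le> card U" "0 < k" "scal k ce = 0" "n dvd int k" for k
  proof -
    obtain S where S: "S \<subseteq> U" "card S = k" using k(1) by (meson obtain_subset_with_card_n)
    have "sum c S = 0" using sum_const_char_two[of S c ce] S e k(3) by (metis subsetD)
    moreover have "[sum y S = int k * ye] (mod n)" using sum_const_cong[of S y ye n] S e by (metis subsetD)
    then have "n dvd sum y S" using k(4) by (metis cong_dvd_iff dvd_mult2)
    moreover have "S \<subseteq> E" "S \<noteq> {}" using S U k(2) by auto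
    ultimately show False using zsfD[OF zsf, of S] by blast
  qed
  show "ce \<noteq> 0" using key[of "nat n"] m n by (auto simp: scal_def nat_le_iff)
  show "int (card U) < 2 * n" using key[of "nat (2 * n)"] n by (force simp: scal_def even_nat_iff nat_le_iff)
qed

text \<open>Exchanging words of large value for copies of \<open>e\<close> terminates because the multiplicity grows.\<close>

lemma compat_normal_form:
  assumes "compat n I j A c y" "finite I" "j \<notin> I" "odd n" "70 < n" "[2 * ye = 1] (mod n)"
    and "2 * n - 55 \<le> int (card {i\<in>I. c i = ce \<and> [y i = ye] (mod n)})"
  obtains c' y' U where "compat n I j A c' y'" "U \<subseteq> I" "\<And>i. i \<in> U \<Longrightarrow> c' i = ce \<and> [y' i = ye] (mod n)"
    "2 * n - 55 \<le> int (card U)"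
    "\<And>J. J \<subseteq> I - U \<Longrightarrow> J \<noteq> {} \<Longrightarrow> sum c' J = 0 \<or> sum c' J = ce \<Longrightarrow> (2 * sum y' J) mod n < int (card J)"
  using assms(1,7)
proof (induction "card I - card {i\<in>I. c i = ce \<and> [y i = ye] (mod n)}" arbitrary: thesis c y rule: less_induct)
  case less
  let ?U = "\<lambda>c y. {i\<in>I. c i = ce \<and> [y i = ye] (mod n)}"
  let ?m = "int (card (?U c y))"
  show ?case
  proof (cases "\<exists>J\<subseteq>I - ?U c y. J \<noteq> {} \<and> (sum c J = 0 \<or> sum c J = ce) \<and> int (card J) \<le> (2 * sum y J) mod n")
    case False
    show thesis
      by (rule less.prems(1)[OF less.prems(2), of "?U c y"]) (use False less.prems(3) in \<open>auto simp: not_le\<close>)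
  next
    case True
    then obtain J where J: "J \<subseteq> I - ?U c y" "J \<noteq> {}" "sum c J = 0 \<or> sum c J = ce"
      "int (card J) \<le> (2 * sum y J) mod n" by blast
    have zsf: "zsf n c y I" using less.prems(2) by (simp add: compat_def)
    have UI: "?U c y \<subseteq> I" by blast
    have m: "n \<le> ?m" using less.prems(3) assms(5) by linarith
    have ce: "ce \<noteq> 0"
      by (rule multiplicity_bounds(1)[OF zsf assms(2,4) _ UI _ m]) (use assms(5) in auto)
    let ?f = "(2 * sum y J) mod n"
    have f: "1 \<le> ?f" "?f \<le> 2 * n - 1 - ?m" "even ?f \<longleftrightarrow> sum c J = 0"
      by (rule word_value[OF zsf assms(2,4) _ UI _ assms(6) m ce J(1-3)]; use assms(5) in auto)+
    let ?c = "\<lambda>i. if i \<in> J then ce else c i" and ?y = "\<lambda>i. if i \<in> J then ye else y i"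
    have comp: "compat n I j A ?c ?y"
    proof (rule compat_replace[OF less.prems(2) assms(2,3), of J "?U c y" ce ye "nat ?f"])
      show "sum c J = scal (nat ?f) ce" using f(1,3) J(3) by (auto simp: scal_def even_nat_iff)
      have "[2 * sum y J = ?f] (mod n)" by (simp add: cong_def)
      moreover have "[?f * (2 * ye) = ?f * 1] (mod n)" by (rule cong_scalar_left[OF assms(6)])
      ultimately have "[2 * sum y J = 2 * (?f * ye)] (mod n)"
        by (simp only: mult.left_commute[of ?f 2] mult_1_right) (rule cong_trans[OF _ cong_sym])
      then have "[sum y J = ?f * ye] (mod n)" using cong_half assms(4) by blast
      then show "[sum y J = int (nat ?f) * ye] (mod n)" using f(1) by simp
      show "card J \<le> nat ?f" using J(4) by linarith
      \<comment> \<open>At least 2n - 55 copies force f \<le> 54, and for n > 70 the copies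
        outnumber that.\<close>
      show "nat ?f \<le> card (?U c y) + 1" using f(2) less.prems(3) assms(5) by linarith
    qed (use J in auto)
    have fin: "finite (?U ?c ?y)" using assms(2) by simp
    have "?U c y \<subset> ?U ?c ?y" using J(1,2) by fastforce
    then have lt: "card (?U c y) < card (?U ?c ?y)" using psubset_card_mono[OF fin] by blast
    have le: "card (?U ?c ?y) \<le> card I" using assms(2) by (intro card_mono) auto
    show thesis
    proof (rule less.hyps[of ?c ?y])
      show "card I - card (?U ?c ?y) < card I - card (?U c y)" using lt le by linarith
      show "2 * n - 55 \<le> int (card (?U ?c ?y))" using lt less.prems(3) by linarith
      show thesis if "compat n I j A c' y'" "U \<subseteq> I" "\<And>i. i \<in> U \<Longrightarrow> c' i = ce \<and> [y' i = ye] (mod n)"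
        "2 * n - 55 \<le> int (card U)"
        "\<And>J. J \<subseteq> I - U \<Longrightarrow> J \<noteq> {} \<Longrightarrow> sum c' J = 0 \<or> sum c' J = ce \<Longrightarrow> (2 * sum y' J) mod n < int (card J)"
        for c' y' U
        by (rule less.prems(1)[OF that])
    qed (rule comp)
  qed
qed

lemma matching_sum_label:
  fixes c :: "'i \<Rightarrow> 'v::char_two"
  assumes "matching (\<lambda>p r. c p = c r) I D"
  shows "sum c (\<Union>D) = 0"
proof -
  have "sum c e = 0" if e: "e \<in> D" for e
    by (rule matching_edge[OF assms e]) simp
  then show ?thesis unfolding sum_matching_Union[OF assms] by simp
qed

lemma zsf_scale:
  assumes "coprime u n"
  shows "zsf n c (\<lambda>i. u * y i) I \<longleftrightarrow> zsf n c y I"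
proof -
  have "n dvd (\<Sum>i\<in>J. u * y i) \<longleftrightarrow> n dvd sum y J" for J
    using assms by (simp add: coprime_commute coprime_dvd_mult_right_iff flip: sum_distrib_left)
  then show ?thesis by (simp add: zsf_def)
qed

text \<open>Pairs of equal labels act as terms of C_n, and most of them share a residue, which is
  scaled to 1. To find half of 1, take two such pairs with one common label: re-pairing the four
  terms must again give 1 each time, which makes \<open>b\<close> and \<open>b'\<close> congruent
  with sum 1.\<close>

lemma unit_pairs:
  fixes c :: "'i \<Rightarrow> 'v::{char_two,finite}" and y :: "'i \<Rightarrow> int"
  assumes V: "card (UNIV :: 'v set) = 32" and n: "odd n" "70 < n" and I: "finite I" "int (card I) = 2 * n + 3"
    and zsf: "zsf n c y I"
  obtains u D z where "coprime u n" "matching (\<lambda>p r. c p = c r) I D" "n - 27 \<le> int (card D)"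
    "\<And>e. e \<in> D \<Longrightarrow> [u * sum y e = 1] (mod n)" "z \<in> I" "[2 * (u * y z) = 1] (mod n)"
proof -
  let ?R = "\<lambda>p r. c p = c r"
  obtain D0 where D0: "matching ?R I D0" and max: "\<And>D'. matching ?R I D' \<Longrightarrow> card D' \<le> card D0"
    using ex_max_matching[OF I(1), of ?R] by blast
  have finD0: "finite D0" using matching_finite[OF D0 I(1)] .
  note UI = matching_Union[OF D0]
  have finU: "finite (\<Union>D0)" using UI I(1) finite_subset by blast
  have "inj_on c (I - \<Union>D0)"
    using max_matching_leftover[OF I(1) D0 max] by (meson inj_onI)
  then have "card (I - \<Union>D0) \<le> 32" using card_inj_on_le[of c _ "UNIV :: 'v set"] V by auto
  moreover have "card (I - \<Union>D0) + 2 * card D0 = card I"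
    using card_matching_Union[OF D0 I(1)] card_Diff_subset[OF finU UI] card_mono[OF I(1) UI] by simp
  \<comment> \<open>At most 32 terms stay unmatched, so twice the number of pairs is at least 2n + 3
    - 32.\<close>
  ultimately have cD0: "n - 14 \<le> int (card D0)" using I(2) n by presburger
  have Dsum: "sum c (\<Union>D') = 0" "sum y (\<Union>D') = (\<Sum>e\<in>D'. sum y e)" if "D' \<subseteq> D0" for D'
    using matching_sum_label[OF matching_subset[OF D0 that]] sum_matching_Union[OF matching_subset[OF D0 that]] by auto
  have Dne: "\<Union>D' \<noteq> {}" if D': "D' \<subseteq> D0" "D' \<noteq> {}" for D'
  proof -
    obtain e where e: "e \<in> D'" using D' by blast
    have "e \<noteq> {}" by (rule matching_edge[OF D0, of e]) (use e D' in auto)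
    then show ?thesis using e by blast
  qed
  have zmod: "zsf_mod n (sum y) D0"
    unfolding zsf_mod_def
  proof (intro allI impI notI)
    fix J assume J: "J \<subseteq> D0" "J \<noteq> {}" "(\<Sum>e\<in>J. sum y e) mod n = 0"
    have "\<Union>J \<subseteq> I" using J(1) UI by blast
    then show False using zsfD[OF zsf _ Dne[OF J(1,2)] Dsum(1)[OF J(1)]] Dsum(2)[OF J(1)] J(3) by auto
  qed
  obtain g where g: "2 * int (card D0) + 1 - n \<le> int (card {e\<in>D0. sum y e mod n = g})"
    using frequent_residue[OF finD0 zmod] n cD0 by force
  define D where "D = {e\<in>D0. sum y e mod n = g}"
  have DD0: "D \<subseteq> D0" by (auto simp: D_def)
  \<comment> \<open>The bound of \<open>frequent_residue\<close> is 2(n - 14) + 1 - n.\<close>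
  have cD: "n - 27 \<le> int (card D)" using g cD0 by (simp add: D_def)
  have Dg: "[sum y e = g] (mod n)" if "e \<in> D" for e using that by (auto simp: D_def cong_def)
  \<comment> \<open>A common divisor d \<ge> 3 would make n / d of the pairs sum to zero, and that
    many are available.\<close>
  have "coprime g n"
  proof (rule ccontr)
    assume nc: "\<not> ?thesis"
    define d where "d = gcd g n"
    have d: "d dvd n" "d dvd g" "0 < d" "d \<noteq> 1" using n nc by (auto simp: d_def coprime_iff_gcd_eq_1)
    obtain m where m: "n = d * m" using d(1) by (rule dvdE)
    have "odd d" using m n(1) by auto
    then have "3 \<le> d" using d(3,4) by presburger
    moreover have "0 < m" using m d(3) n(2) zero_less_mult_pos[of d m] by auto
    ultimately have "3 * m \<le> n" using m by (simp add: mult_right_mono)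
    then have "nat m \<le> card D" using cD n(2) by linarith
    then obtain S where S: "S \<subseteq> D" "card S = nat m" by (meson obtain_subset_with_card_n)
    have SD0: "S \<subseteq> D0" using S(1) DD0 by blast
    have "[(\<Sum>e\<in>S. sum y e) = int (card S) * g] (mod n)"
      by (rule sum_const_cong) (use S(1) Dg in blast)
    also have "int (card S) * g = m * g" using S(2) \<open>0 < m\<close> by simp
    also have "[m * g = 0] (mod n)" using m d(2) by (simp add: cong_0_iff mult.commute mult_dvd_mono)
    finally have "(\<Sum>e\<in>S. sum y e) mod n = 0" by (simp add: cong_0_iff dvd_eq_mod_eq_0)
    moreover have "S \<noteq> {}" using S(2) \<open>0 < m\<close> by auto
    ultimately show False using zmod SD0 by (auto simp: zsf_mod_def)
  qed
  then obtain u where u: "[g * u = 1] (mod n)" using cong_solve_coprime_int by blast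
  have cu: "coprime u n" using u by (metis coprime_iff_invertible_int mult.commute)
  define w where "w i = u * y i" for i
  have zsfw: "zsf n c w I" using zsf_scale[OF cu, of c y I] zsf by (simp add: w_def[abs_def])
  have Dw: "[sum w e = 1] (mod n)" if "e \<in> D" for e
  proof -
    have "sum w e = u * sum y e" by (simp add: w_def sum_distrib_left)
    also have "[u * sum y e = u * g] (mod n)" by (rule cong_scalar_left[OF Dg[OF that]])
    finally show ?thesis using u by (metis cong_trans mult.commute)
  qed
  have mD: "matching ?R I D" by (rule matching_subset[OF D0 DD0])
  have finD: "finite D" using finD0 DD0 finite_subset by blast
  define lab where "lab e = (SOME v. \<forall>i\<in>e. c i = v)" for e
  have lab: "c i = lab e" if e: "e \<in> D" "i \<in> e" for e i
  proof -
    obtain p r where "p \<in> I" "r \<in> I" "p \<noteq> r" "c p = c r" "e = {p, r}" by (rule matching_edge[OF mD e(1)])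
    then have "\<exists>v. \<forall>i\<in>e. c i = v" by blast
    then show ?thesis using someI_ex[of "\<lambda>v. \<forall>i\<in>e. c i = v"] e(2) unfolding lab_def by blast
  qed
  have "\<not> inj_on lab D"
  proof
    assume "inj_on lab D"
    then have "card D \<le> 32" using card_inj_on_le[of lab D "UNIV :: 'v set"] V by auto
    then show False using cD n(2) by linarith
  qed
  then obtain e1 e2 where e: "e1 \<in> D" "e2 \<in> D" "e1 \<noteq> e2" "lab e1 = lab e2" by (auto simp: inj_on_def)
  obtain a b where ab: "a \<in> I" "b \<in> I" "a \<noteq> b" "c a = c b" "e1 = {a, b}" by (rule matching_edge[OF mD e(1)])
  obtain a' b' where ab': "a' \<in> I" "b' \<in> I" "a' \<noteq> b'" "c a' = c b'" "e2 = {a', b'}" by (rule matching_edge[OF mD e(2)])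
  have dj: "e1 \<inter> e2 = {}" using matching_disjoint[OF mD e(1-3)] .
  have cc: "c a' = c a" using lab[OF e(1), of a] lab[OF e(2), of a'] e(4) ab ab' by simp
  let ?D = "D - {e1, e2}"
  have m': "matching ?R I ?D" by (rule matching_subset[OF mD]) blast
  have cD': "n - 29 \<le> int (card ?D)" using e cD finD by (simp add: card_Diff_subset)
  \<comment> \<open>A word of value v \<ge> 29 would be completed to a zero sum by n - v of the at
    least n - 29 remaining pairs, each of value 1.\<close>
  have val: "1 \<le> sum w J mod n \<and> sum w J mod n \<le> 28" if J: "J \<subseteq> I - \<Union>?D" "J \<noteq> {}" "sum c J = 0" for J
  proof (rule ccontr)
    assume no: "\<not> ?thesis"
    define v where "v = sum w J mod n"
    have v: "0 \<le> v" "v < n" "[sum w J = v] (mod n)" using n by (auto simp: v_def cong_def)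
    have "\<not> n dvd sum w J" by (rule zsfD[OF zsfw _ J(2,3)]) (use J(1) in blast)
    then have "v \<noteq> 0" by (simp add: v_def dvd_eq_mod_eq_0)
    then have "29 \<le> v" using no v(1) unfolding v_def[symmetric] by linarith
    then have "nat (n - v) \<le> card ?D" using cD' by linarith
    then obtain S where S: "S \<subseteq> ?D" "card S = nat (n - v)" by (meson obtain_subset_with_card_n)
    have mS: "matching ?R I S" by (rule matching_subset[OF m' S(1)])
    have USI: "\<Union>S \<subseteq> I" by (rule matching_Union[OF mS])
    have dJ: "J \<inter> \<Union>S = {}" using J(1) S(1) by blast
    have fin: "finite J" "finite (\<Union>S)" using J(1) USI I(1) by (meson Diff_subset finite_subset subset_trans)+
    have "sum c (J \<union> \<Union>S) = 0"
      unfolding sum.union_disjoint[OF fin dJ] using J(3) matching_sum_label[OF mS] by simp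
    moreover have "[sum w (\<Union>S) = int (card S) * 1] (mod n)"
      unfolding sum_matching_Union[OF mS] by (rule sum_const_cong) (use S(1) Dw in blast)
    then have "[sum w J + sum w (\<Union>S) = v + (n - v)] (mod n)"
      by (intro cong_add v(3)) (use S(2) v(2) in simp)
    then have "[sum w (J \<union> \<Union>S) = 0] (mod n)" unfolding sum.union_disjoint[OF fin dJ] by (simp add: cong_def)
    moreover have "J \<union> \<Union>S \<subseteq> I" "J \<union> \<Union>S \<noteq> {}" using J(1,2) USI by auto
    ultimately show False using zsfD[OF zsfw] cong_0_iff by metis
  qed
  have out: "{p, r} \<subseteq> I - \<Union>?D" if "p \<in> e1" "r \<in> e2" for p r
  proof -
    have "f \<inter> e1 = {}" "f \<inter> e2 = {}" if "f \<in> ?D" for f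
      using matching_disjoint[OF mD, of f e1] matching_disjoint[OF mD, of f e2] that e by auto
    then have "e1 \<inter> \<Union>?D = {}" "e2 \<inter> \<Union>?D = {}" by blast+
    moreover have "e1 \<subseteq> I" "e2 \<subseteq> I" using ab ab' by auto
    ultimately show ?thesis using that by blast
  qed
  have w1: "[w a + w b = 1] (mod n)" "[w a' + w b' = 1] (mod n)"
    using Dw[OF e(1)] Dw[OF e(2)] ab ab' by simp_all
  have neq: "a \<noteq> a'" "a \<noteq> b'" "b \<noteq> a'" "b \<noteq> b'" using dj ab ab' by auto
  \<comment> \<open>The two new pairs have total value 2 modulo \<open>n\<close> and each has value
    in [1, 28]; as n exceeds 56, the total is exactly 2 and both are 1.\<close>
  have cross: "[w p + w p' = 1] (mod n)" "[w r + w r' = 1] (mod n)"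
    if p: "p \<in> e1" "p' \<in> e2" "r \<in> e1" "r' \<in> e2" and tot: "[w p + w r = 1] (mod n)" "[w p' + w r' = 1] (mod n)"
    for p p' r r'
  proof -
    have ne: "p \<noteq> p'" "r \<noteq> r'" using p dj by auto
    have lc: "c p = c p'" "c r = c r'" using p lab[OF e(1)] lab[OF e(2)] e(4) by metis+
    have "1 \<le> sum w {p, p'} mod n \<and> sum w {p, p'} mod n \<le> 28" by (rule val[OF out[OF p(1,2)]]) (use ne lc in auto)
    then have v1: "1 \<le> (w p + w p') mod n" "(w p + w p') mod n \<le> 28" using ne by auto
    have "1 \<le> sum w {r, r'} mod n \<and> sum w {r, r'} mod n \<le> 28" by (rule val[OF out[OF p(3,4)]]) (use ne lc in auto)
    then have v2: "1 \<le> (w r + w r') mod n" "(w r + w r') mod n \<le> 28" using ne by auto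
    have "[(w p + w p') mod n + (w r + w r') mod n = (w p + w p') + (w r + w r')] (mod n)"
      by (intro cong_add) (simp_all add: cong_def)
    also have "(w p + w p') + (w r + w r') = (w p + w r) + (w p' + w r')" by simp
    also have "[(w p + w r) + (w p' + w r') = 1 + 1] (mod n)" by (intro cong_add tot)
    finally have "(w p + w p') mod n + (w r + w r') mod n = 1 + 1"
      by (rule cong_imp_eq_small) (use v1 v2 n(2) in linarith)
    then have "(w p + w p') mod n = 1" "(w r + w r') mod n = 1" using v1 v2 by linarith+
    then show "[w p + w p' = 1] (mod n)" "[w r + w r' = 1] (mod n)" using n(2) by (simp_all add: cong_def)
  qed
  have 1: "[w a + w a' = 1] (mod n)" "[w b + w b' = 1] (mod n)"
    using cross[of a a' b b'] ab ab' w1 by auto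
  have 2: "[w a + w b' = 1] (mod n)"
    using cross[of a b' b a'] ab ab' w1 by (auto simp: add.commute)
  have "[w b = w b'] (mod n)" using cong_trans[OF w1(1) cong_sym[OF 2]] by (simp add: cong_add_lcancel)
  then have "[w b + w b = w b + w b'] (mod n)" by (rule cong_add[OF cong_refl])
  from cong_trans[OF this 1(2)] have "[2 * w b = 1] (mod n)" by (simp only: mult_2)
  then have "[2 * (u * y b) = 1] (mod n)" by (simp add: w_def)
  moreover have "[u * sum y e = 1] (mod n)" if "e \<in> D" for e
    using Dw[OF that] by (simp add: w_def sum_distrib_left)
  ultimately show thesis using that[OF cu mD cD _ ab(2)] by blast
qed

section \<open>Separating the admissible labels\<close>

text \<open>The condition on all \<open>v\<close> says that \<open>H\<close> has index two, so the
  labels in \<open>B\<close> lie in the complement of a hyperplane.\<close>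

definition separated :: "'v::char_two set \<Rightarrow> bool" where
  "separated B \<longleftrightarrow> (\<exists>H b. subgrp H \<and> b \<notin> H \<and> (\<forall>v. v \<in> H \<or> v + b \<in> H) \<and> (\<forall>v\<in>B. v + b \<in> H))"

lemma separatedI:
  fixes H :: "'v::{char_two,finite} set"
  assumes "subgrp H" "b \<notin> H" "\<And>v. v \<in> B \<Longrightarrow> v + b \<in> H"
  shows "separated B"
proof -
  obtain H' where "subgrp H'" "H \<subseteq> H'" "b \<notin> H'" "\<And>v. v \<in> H' \<or> v + b \<in> H'"
    using subgrp_index_two[OF assms(1,2)] by blast
  then show ?thesis using assms(3) unfolding separated_def by blast
qed

lemma separated_empty:
  assumes "card (UNIV :: 'v::{char_two,finite} set) = 32"
  shows "separated ({} :: 'v set)"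
proof -
  have "\<exists>b::'v. b \<noteq> 0"
  proof (rule ccontr)
    assume "\<not> ?thesis"
    then have "(UNIV :: 'v set) = {0}" by auto
    then have "card (UNIV :: 'v set) = card {0::'v}" by simp
    then show False using assms by simp
  qed
  then obtain b :: 'v where "b \<noteq> 0" by blast
  then show ?thesis by (intro separatedI[of "{0}" b]) (auto simp: subgrp_def)
qed

text \<open>Labels are projected along \<open>ce\<close> onto a complement of size 16. The words of
  the projection have label 0 or \<open>ce\<close>, and the parity of the value tells which; hence
  values are linear modulo 2.\<close>

lemma no_nine_system:
  fixes c :: "'i \<Rightarrow> 'v::{char_two,finite}"
  assumes V: "card (UNIV :: 'v set) = 32" and n: "odd n" "36 < n" and E: "finite E" "card E = 9" and ce: "ce \<noteq> 0"
    and words: "\<And>J. J \<subseteq> E \<Longrightarrow> J \<noteq> {} \<Longrightarrow> sum c J = 0 \<or> sum c J = ce \<Longrightarrow>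
      1 \<le> (2 * sum y J) mod n \<and> (2 * sum y J) mod n < int (card J) \<and>
      (even ((2 * sum y J) mod n) \<longleftrightarrow> sum c J = 0)"
  shows False
proof -
  obtain H where H: "subgrp H" "ce \<notin> H" "\<And>v. v \<in> H \<or> v + ce \<in> H"
    using subgrp_index_two[of "{0}" ce] ce by (auto simp: subgrp_def)
  have "H \<union> (+) ce ` H = UNIV" using H(3) by (force simp: image_iff add_eq_iff add.commute)
  then have H16: "card H = 16" using card_subgrp_extend[OF H(1) _ H(2)] V by simp
  define p where "p v = (if v \<in> H then v else v + ce)" for v
  have p_add: "p (v + w) = p v + p w" for v w
  proof -
    have "v + w \<in> H \<longleftrightarrow> w \<in> H" if "v \<in> H" for v w using subgrp_cancel[OF H(1) that] .
    moreover have "v + w \<in> H" if "v \<notin> H" "w \<notin> H"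
      using subgrp_add[OF H(1), of "v + ce" "w + ce"] H(3)[of v] H(3)[of w] that by (auto simp: ac_simps)
    ultimately show ?thesis by (auto simp: p_def ac_simps) (metis add.commute)+
  qed
  have p0: "p v = 0 \<longleftrightarrow> v = 0 \<or> v = ce" for v
    using H(2) subgrp_0[OF H(1)] by (auto simp: p_def add_eq_0_iff_eq)
  have psum: "sum (\<lambda>i. p (c i)) J = p (sum c J)" for J
    by (induction J rule: infinite_finite_induct) (use p0 p_add in auto)
  have ysum: "sum (\<lambda>i. 2 * y i) J = 2 * sum y J" for J by (simp add: sum_distrib_left)
  interpret word_system n "\<lambda>i. 2 * y i" "\<lambda>i. p (c i)" "{0}" H E
  proof unfold_locales
    show "1 \<le> sum (\<lambda>i. 2 * y i) J mod n \<and> sum (\<lambda>i. 2 * y i) J mod n < int (card J)"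
      if "J \<subseteq> E" "J \<noteq> {}" "sum (\<lambda>i. p (c i)) J \<in> {0}" for J
      using words[of J] that p0 unfolding psum ysum by blast
    show "even (sum (\<lambda>i. 2 * y i) I mod n + sum (\<lambda>i. 2 * y i) J mod n + sum (\<lambda>i. 2 * y i) (sym_diff I J) mod n)"
      if IJ: "I \<subseteq> E" "J \<subseteq> E" "sum (\<lambda>i. p (c i)) I \<in> {0}" "sum (\<lambda>i. p (c i)) J \<in> {0}" for I J
    proof -
      have ev: "sum c S = 0 \<or> sum c S = ce" "even ((2 * sum y S) mod n) \<longleftrightarrow> sum c S = 0"
        if "S \<subseteq> E" "p (sum c S) = 0" for S
        using words[of S] that p0 by (cases "S = {}"; auto)+
      have fin: "finite I" "finite J" using IJ E finite_subset by auto
      have sd: "sum c (sym_diff I J) = sum c I + sum c J" by (rule sum_sym_diff[OF fin])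
      have "p (sum c (sym_diff I J)) = 0" unfolding sd p_add using IJ(3,4) unfolding psum by simp
      moreover have "sym_diff I J \<subseteq> E" using IJ by blast
      ultimately have 1: "even ((2 * sum y (sym_diff I J)) mod n) \<longleftrightarrow> sum c I = sum c J"
        using ev(2) sd by (simp add: add_eq_0_iff_eq)
      have 2: "sum c I = 0 \<or> sum c I = ce" "even ((2 * sum y I) mod n) \<longleftrightarrow> sum c I = 0"
        "sum c J = 0 \<or> sum c J = ce" "even ((2 * sum y J) mod n) \<longleftrightarrow> sum c J = 0"
        using ev[of I] ev[of J] IJ unfolding psum by auto
      show ?thesis unfolding ysum even_add 1 2(2,4) using 2(1,3) ce by metis
    qed
    show "(\<lambda>i. p (c i)) ` E \<subseteq> H" using H(3) by (auto simp: p_def)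
  qed (use n E H subgrp_0[OF H(1)] in \<open>auto simp: subgrp_def\<close>)
  show False by (rule word_system_four[OF word_system_axioms H16 E(2)])
qed

section \<open>Families in which every word has value 1\<close>

text \<open>This is \<open>atoms\<close> for the rescaled weight \<open>2 ^ k * y\<close>, for which
  words have weight 2^k and atoms weight 1.\<close>

lemma words_value_one_bound:
  fixes c :: "'i \<Rightarrow> 'v::char_two" and y :: "'i \<Rightarrow> int"
  assumes "odd n" "1 < n" "finite E" "2 ^ Suc k \<le> card (words c E)"
    and one: "\<And>J. J \<subseteq> E \<Longrightarrow> J \<noteq> {} \<Longrightarrow> sum c J = 0 \<Longrightarrow> [sum y J = 1] (mod n)"
    and D: "\<And>S. S \<subseteq> D \<Longrightarrow> S \<noteq> {} \<Longrightarrow> \<not> [2 ^ k * sum y S = 1] (mod n)"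
  shows "2 ^ Suc k \<le> card (E - D) + 1"
proof (rule atoms[where W = "words c E" and y = "\<lambda>i. 2 ^ k * y i" and \<beta> = 1])
  show "sym_diff I J \<in> words c E" if "I \<in> words c E" "J \<in> words c E" for I J
    by (rule words_sym_diff[OF assms(3) that])
  show "[(\<Sum>i\<in>J. 2 ^ k * y i) = 2 ^ k * 1] (mod n)" if "J \<in> words c E" "J \<noteq> {}" for J
    unfolding sum_distrib_left[symmetric]
    by (rule cong_scalar_left) (use one[of J] that in \<open>simp add: words_def\<close>)
  show "\<not> [(\<Sum>i\<in>S. 2 ^ k * y i) = 1] (mod n)" if "S \<subseteq> D" "S \<noteq> {}" for S
    unfolding sum_distrib_left[symmetric] by (rule D[OF that])
qed (use assms in \<open>auto simp: words_def zdvd_not_zless\<close>)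

lemma sum_upd: "j \<notin> J \<Longrightarrow> sum (g(j := a)) J = sum g J"
  by (rule sum.cong) auto

text \<open>Eight elements of F_2^5 have at least 8 words, and 16 are too many. If for some
  \<open>d\<close> no word uses \<open>j\<close>, a dimension count puts all \<open>d\<close> into
  one coset of the span of the labels of \<open>R\<close>. Otherwise \<open>R\<close> has exactly
  four words, and words through \<open>j\<close> split their three atoms. An atom {p, r} of size two
  then gives the separation: words of \<open>R\<close> contain both or neither, words through
  \<open>j\<close> exactly one.\<close>

lemma seven_case:
  fixes c :: "'i \<Rightarrow> 'v::{char_two,finite}" and y :: "'i \<Rightarrow> int"
  assumes V: "card (UNIV :: 'v set) = 32" and n: "odd n" "1 < n" and R: "finite R" "card R = 7" "j \<notin> R"
    and one: "\<And>d b J. (d, b) \<in> A \<Longrightarrow> J \<subseteq> insert j R \<Longrightarrow> J \<noteq> {} \<Longrightarrow> sum (c(j := d)) J = 0 \<Longrightarrow>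
      [sum (y(j := b)) J = 1] (mod n)"
  shows "separated (fst ` A)"
proof (cases "A = {}")
  case True
  then show ?thesis using separated_empty[OF V] by simp
next
  case False
  then obtain d0 b0 where A0: "(d0, b0) \<in> A" by auto
  let ?E = "insert j R"
  let ?W = "\<lambda>d. words (c(j := d)) ?E"
  have finE: "finite ?E" using R by simp
  have upd: "sum (c(j := d)) J = sum c J" "sum (y(j := b)) J = sum y J" if "J \<subseteq> R" for J d b
    using that R(3) sum_upd[of j J] by auto
  have WR: "words c R \<subseteq> ?W d" for d
  proof
    fix S assume S: "S \<in> words c R"
    then have "S \<subseteq> R" by (simp add: words_def)
    then show "S \<in> ?W d" using S upd(1)[of S d] by (auto simp: words_def simp del: fun_upd_apply)
  qed
  have W8: "8 \<le> card (?W d)" for d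
    using card_words[of ?E UNIV "c(j := d)"] finE R V by (simp add: subgrp_def)
  \<comment> \<open>Fifteen atoms do not fit into eight elements.\<close>
  have W16: "card (?W d) < 16" if "(d, b) \<in> A" for d b
  proof (rule ccontr)
    assume "\<not> ?thesis"
    then have "2 ^ Suc 3 \<le> card (?E - {}) + 1"
      by (intro words_value_one_bound[OF n finE, of 3 "c(j := d)" "y(j := b)"]) (use one[OF that] in auto)
    then show False using R by simp
  qed
  \<comment> \<open>The words inside \<open>R\<close> form a proper subgroup as soon as some word
    uses \<open>j\<close>.\<close>
  have dbl: "2 * card (words c R) \<le> card (?W d)" if "S \<in> ?W d" "j \<in> S" for S d
  proof (rule card_closed_family[OF words_finite[OF finE] _ WR])
    show "S \<notin> words c R" using that R(3) by (auto simp: words_def)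
  qed (use that words_sym_diff[OF finE] words_sym_diff[OF R(1)] in auto)
  show ?thesis
  proof (cases "\<exists>(d, b)\<in>A. \<forall>S\<in>?W d. j \<notin> S")
    case True
    then obtain d b where db: "(d, b) \<in> A" "\<And>S. S \<in> ?W d \<Longrightarrow> j \<notin> S" by blast
    have "?W d \<subseteq> words c R"
    proof
      fix S assume S: "S \<in> ?W d"
      then have SR: "S \<subseteq> R" using db(2)[OF S] by (auto simp: words_def)
      then show "S \<in> words c R" using S upd(1)[OF SR] by (simp add: words_def)
    qed
    then have w8: "8 \<le> card (words c R)"
      using W8[of d] card_mono[OF words_finite[OF R(1)], of "?W d" c] by linarith
    have w16: "card (words c R) < 16"
      using card_mono[OF words_finite[OF finE] WR[of d]] W16[OF db(1)] by linarith
    define H where "H = sum c ` Pow R"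
    have subH: "subgrp H"
      unfolding subgrp_def
    proof (intro conjI ballI)
      show "0 \<in> H" unfolding H_def by (rule image_eqI[of _ _ "{}"]) auto
      fix u v assume "u \<in> H" "v \<in> H"
      then obtain S T where ST: "S \<subseteq> R" "T \<subseteq> R" "u = sum c S" "v = sum c T" by (auto simp: H_def)
      have "u + v = sum c (sym_diff S T)"
        using sum_sym_diff[of S T c] ST R(1) finite_subset by metis
      then show "u + v \<in> H" unfolding H_def by (rule image_eqI) (use ST in auto)
    qed
    have notH: "d' \<notin> H" if "(d', b') \<in> A" for d' b'
    proof
      assume "d' \<in> H"
      then obtain S where S: "S \<subseteq> R" "d' = sum c S" by (auto simp: H_def)
      have "j \<notin> S" "finite S" using S R finite_subset by auto
      then have "insert j S \<in> ?W d'" using S upd(1)[OF S(1)] by (auto simp: words_def)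
      then have "2 * card (words c R) \<le> card (?W d')" by (rule dbl) simp
      then show False using w8 W16[OF that] by simp
    qed
    \<comment> \<open>Otherwise \<open>H\<close>, \<open>d\<close> and \<open>d'\<close> would span
      \<open>4 * card H\<close> \<le> 32 elements, and \<open>R\<close> would have at least 128 / 8
      = 16 words.\<close>
    have "d' + d \<in> H" if d': "(d', b') \<in> A" for d' b'
    proof (rule ccontr)
      assume no: "d' + d \<notin> H"
      let ?H = "H \<union> (+) d ` H"
      have sub: "subgrp ?H" by (rule subgrp_extend[OF subH])
      have "d' \<notin> ?H" using notH[OF d'] no by (auto simp: ac_simps)
      then have "card (?H \<union> (+) d' ` ?H) = 4 * card H"
        using card_subgrp_extend[OF sub] card_subgrp_extend[OF subH _ notH[OF db(1)]] by simp
      moreover have "card (?H \<union> (+) d' ` ?H) \<le> card (UNIV :: 'v set)" by (rule card_mono) auto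
      ultimately have "card H \<le> 8" using V by simp
      moreover have "2 ^ card R \<le> card (words c R) * card H"
        by (rule card_words[OF R(1) _ subH]) (auto simp: H_def intro!: image_eqI[of _ _ "{_}"])
      ultimately have "2 ^ card R \<le> card (words c R) * 8" by (meson le_trans mult_le_mono2)
      then show False using w16 R(2) by simp
    qed
    then show ?thesis by (intro separatedI[OF subH notH[OF db(1)]]) auto
  next
    case False
    then have ex: "\<exists>S\<in>?W d. j \<in> S" if "(d, b) \<in> A" for d b using that by blast
    have w8: "card (words c R) < 8" using ex[OF A0] dbl W16[OF A0] by fastforce
    have w4: "4 \<le> card (words c R)"
      using card_words[of R UNIV c] R V by (simp add: subgrp_def)
    note finW = words_finite[OF R(1), of c] and sdW = words_sym_diff[OF R(1), of _ c]
    have "card {{}::'i set} < card (words c R)" using w4 by simp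
    then obtain I where I: "I \<in> words c R" "I \<noteq> {}" using ex_notin[of "{{}}"] by blast
    have "card {{}, I} < card (words c R)" using w4 card_insert_le_m1[of 2 "{I}" "{}"] by simp
    then obtain J where J: "J \<in> words c R" "J \<noteq> {}" "J \<noteq> I" using ex_notin[of "{{}, I}"] by blast
    let ?V = "{{}, I, J, sym_diff I J}"
    have "sym_diff I J \<noteq> {}" "sym_diff I J \<noteq> I" "sym_diff I J \<noteq> J" using I J by blast+
    then have cV: "card ?V = 4" using I J by auto
    have Vsub: "?V \<subseteq> words c R" using I J sdW[OF I(1) J(1)] empty_words by auto
    have Vcl: "sym_diff S T \<in> ?V" if "S \<in> ?V" "T \<in> ?V" for S T
    proof -
      have "sym_diff I (sym_diff I J) = J" "sym_diff J (sym_diff I J) = I" "sym_diff (sym_diff I J) I = J"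
        "sym_diff (sym_diff I J) J = I" "sym_diff J I = sym_diff I J" by blast+
      then show ?thesis using that by (elim insertE emptyE) simp_all
    qed
    have Wall: "S \<in> ?V" if S: "S \<in> words c R" for S
    proof (rule ccontr)
      assume "S \<notin> ?V"
      then have "2 * card ?V \<le> card (words c R)"
        by (intro card_closed_family[OF finW _ Vsub Vcl S]) (use sdW in auto)
      then show False using cV w8 by simp
    qed
    let ?at = "{I \<inter> J, I - J, J - I}"
    have IR: "I \<subseteq> R" "J \<subseteq> R" using I J by (auto simp: words_def)
    \<comment> \<open>\<open>I\<close>, \<open>J\<close> and \<open>S\<close> generate a family
      whose nonempty members have value 1, so its atoms have value 1/4 modulo \<open>n\<close> and
      are nonempty. Two of them are \<open>a \<inter> S\<close> and \<open>a - S\<close>.\<close>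
    have split: "a \<inter> S \<noteq> {} \<and> a - S \<noteq> {}" if db: "(d, b) \<in> A" and S: "S \<in> ?W d" "j \<in> S" and a: "a \<in> ?at" for d b S a
    proof -
      let ?y = "y(j := b)"
      have val: "[sum ?y T = 1] (mod n)" if "T \<in> ?W d" "T \<noteq> {}" for T
        using one[OF db, of T] that by (simp add: words_def)
      have finT: "finite T" if "T \<in> ?W d" for T using that finE finite_subset by (auto simp: words_def)
      have half: "[2 * sum ?y (T \<inter> T') = 1] (mod n)"
        if T: "T \<in> ?W d" "T' \<in> ?W d" "T \<noteq> {}" "T' \<noteq> {}" "T \<noteq> T'" for T T'
      proof -
        have "sym_diff T T' \<noteq> {}" using T(5) by blast
        then have "[sum ?y T + sum ?y T' - sum ?y (sym_diff T T') = 1 + 1 - 1] (mod n)"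
          by (intro cong_add cong_diff val words_sym_diff[OF finE] T)
        then show ?thesis using sum_sym_diff_int[OF finT finT, OF T(1,2), of ?y] by simp
      qed
      have W: "I \<in> ?W d" "J \<in> ?W d" using WR I J by auto
      have IJW: "sym_diff I J \<in> ?W d" by (rule words_sym_diff[OF finE W])
      have SS: "S \<noteq> {}" "I \<noteq> S" "J \<noteq> S" "sym_diff I J \<noteq> S" using S IR R(3) by auto
      have hI: "[2 * sum ?y (I \<inter> S) = 1] (mod n)" by (rule half) (use W S I SS in auto)
      have hJ: "[2 * sum ?y (J \<inter> S) = 1] (mod n)" by (rule half) (use W S J SS in auto)
      have hIJ: "[2 * sum ?y (I \<inter> J) = 1] (mod n)" by (rule half) (use W I J in auto)
      have hD: "[2 * sum ?y (sym_diff I J \<inter> S) = 1] (mod n)"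
        by (rule half) (use IJW S SS \<open>sym_diff I J \<noteq> {}\<close> in auto)
      note fI = finT[OF W(1)] and fJ = finT[OF W(2)]
      have "sym_diff I J \<inter> S = sym_diff (I \<inter> S) (J \<inter> S)" by blast
      then have "sum ?y (sym_diff I J \<inter> S) = sum ?y (I \<inter> S) + sum ?y (J \<inter> S) - 2 * sum ?y (I \<inter> J \<inter> S)"
        using sum_sym_diff_int[of "I \<inter> S" "J \<inter> S" ?y] fI fJ by (simp add: Int_ac)
      then have "4 * sum ?y (I \<inter> J \<inter> S) = 2 * sum ?y (I \<inter> S) + 2 * sum ?y (J \<inter> S) - 2 * sum ?y (sym_diff I J \<inter> S)"
        by simp
      also have "[\<dots> = 1 + 1 - 1] (mod n)" by (intro cong_add cong_diff hI hJ hD)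
      finally have q: "[4 * sum ?y (I \<inter> J \<inter> S) = 1] (mod n)" by simp
      have tot: "[2 * sum ?y I = 2 * 1] (mod n)" "[2 * sum ?y J = 2 * 1] (mod n)"
        by (rule cong_scalar_left, rule val; use W I J in simp)+
      have nz: "T \<noteq> {}" if "[4 * sum ?y T = 1] (mod n)" for T
        using that n(2) by (auto simp: cong_def)
      have quarter: "[4 * sum ?y (a \<inter> S) = 1] (mod n)" and half_a: "[2 * sum ?y a = 1] (mod n)"
      proof -
        have e: "sum ?y ((I - J) \<inter> S) = sum ?y (I \<inter> S) - sum ?y (I \<inter> J \<inter> S)"
          "sum ?y ((J - I) \<inter> S) = sum ?y (J \<inter> S) - sum ?y (I \<inter> J \<inter> S)"
          "sum ?y (I - J) = sum ?y I - sum ?y (I \<inter> J)" "sum ?y (J - I) = sum ?y J - sum ?y (I \<inter> J)"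
        proof -
          have s: "(I - J) \<inter> S = I \<inter> S - J" "(J - I) \<inter> S = J \<inter> S - I" "I \<inter> J \<inter> S = I \<inter> S \<inter> J"
            "J \<inter> S \<inter> I = I \<inter> S \<inter> J" "J \<inter> I = I \<inter> J" by blast+
          have "finite (I \<inter> S)" "finite (J \<inter> S)" using fI fJ by auto
          then show "sum ?y ((I - J) \<inter> S) = sum ?y (I \<inter> S) - sum ?y (I \<inter> J \<inter> S)"
            "sum ?y ((J - I) \<inter> S) = sum ?y (J \<inter> S) - sum ?y (I \<inter> J \<inter> S)"
            using sum.Int_Diff[of "I \<inter> S" ?y J] sum.Int_Diff[of "J \<inter> S" ?y I]
            unfolding s by (simp_all del: fun_upd_apply)
          show "sum ?y (I - J) = sum ?y I - sum ?y (I \<inter> J)" "sum ?y (J - I) = sum ?y J - sum ?y (I \<inter> J)"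
            using sum.Int_Diff[OF fI, of ?y J] sum.Int_Diff[OF fJ, of ?y I]
            unfolding s by (simp_all del: fun_upd_apply)
        qed
        have "[2 * (2 * sum ?y (I \<inter> S)) - 4 * sum ?y (I \<inter> J \<inter> S) = 2 * 1 - 1] (mod n)"
          "[2 * (2 * sum ?y (J \<inter> S)) - 4 * sum ?y (I \<inter> J \<inter> S) = 2 * 1 - 1] (mod n)"
          by (intro cong_diff cong_scalar_left hI hJ q)+
        moreover note cong_diff[OF tot(1) hIJ] cong_diff[OF tot(2) hIJ]
        ultimately have "[4 * sum ?y ((I - J) \<inter> S) = 1] (mod n)" "[4 * sum ?y ((J - I) \<inter> S) = 1] (mod n)"
          "[2 * sum ?y (I - J) = 1] (mod n)" "[2 * sum ?y (J - I) = 1] (mod n)"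
          unfolding e by (simp_all add: right_diff_distrib)
        then show "[4 * sum ?y (a \<inter> S) = 1] (mod n)" "[2 * sum ?y a = 1] (mod n)" using a q hIJ by auto
      qed
      have "finite a" using a fI fJ by auto
      then have "4 * sum ?y (a - S) = 2 * (2 * sum ?y a) - 4 * sum ?y (a \<inter> S)"
        using sum.Int_Diff[of a ?y S] by simp
      also have "[\<dots> = 2 * 1 - 1] (mod n)" by (intro cong_diff cong_scalar_left half_a quarter)
      finally have "[4 * sum ?y (a - S) = 1] (mod n)" by simp
      then show ?thesis using nz quarter by blast
    qed
    have two: "2 \<le> card a" if a: "a \<in> ?at" for a
    proof -
      obtain S where S: "S \<in> ?W d0" "j \<in> S" using ex[OF A0] by blast
      have "a \<subseteq> R" using a IR by auto
      then have fin: "finite a" using R(1) finite_subset by blast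
      obtain p r where "p \<in> a" "r \<in> a" "p \<noteq> r" using split[OF A0 S a] by blast
      then have "card {p, r} \<le> card a" using fin by (intro card_mono) auto
      then show ?thesis using \<open>p \<noteq> r\<close> by simp
    qed
    \<comment> \<open>Three disjoint atoms of size at least 3 would need nine elements, but
      \<open>R\<close> has seven.\<close>
    have "\<exists>a\<in>?at. card a = 2"
    proof (rule ccontr)
      assume "\<not> ?thesis"
      then have "3 \<le> card (I \<inter> J)" "3 \<le> card (I - J)" "3 \<le> card (J - I)"
        using two[of "I \<inter> J"] two[of "I - J"] two[of "J - I"] by fastforce+
      moreover have fin: "finite I" "finite J" using IR R(1) finite_subset by blast+
      have "card (I \<union> J) = card (I \<inter> J) + card (I - J) + card (J - I)"
      proof -
        have "I \<union> J = I \<union> (J - I)" by blast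
        then have "card (I \<union> J) = card I + card (J - I)" using card_Un_disjoint[of I "J - I"] fin by simp
        moreover have "card I = card (I \<inter> J) + card (I - J)" using fin card_Int_Diff by blast
        ultimately show ?thesis by simp
      qed
      moreover have "card (I \<union> J) \<le> card R" by (rule card_mono[OF R(1)]) (use IR in blast)
      ultimately show False using R(2) by simp
    qed
    then obtain a where a: "a \<in> ?at" "card a = 2" by blast
    then obtain p r where pr: "a = {p, r}" "p \<noteq> r" by (auto simp: card_2_iff)
    have aR: "p \<in> R" "r \<in> R" using a(1) IR pr by auto
    have even_w: "p \<in> S \<longleftrightarrow> r \<in> S" if "S \<in> words c R" for S
    proof -
      have "{p, r} = I \<inter> J \<or> {p, r} = I - J \<or> {p, r} = J - I" using a(1) unfolding pr by blast
      then have "(p \<in> I \<longleftrightarrow> r \<in> I) \<and> (p \<in> J \<longleftrightarrow> r \<in> J)" by blast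
      then show ?thesis using Wall[OF that] by auto
    qed
    have odd_w: "p \<in> S \<longleftrightarrow> r \<notin> S" if "(d, b) \<in> A" "S \<in> ?W d" "j \<in> S" for d b S
      using split[OF that a(1)] unfolding pr by blast
    \<comment> \<open>If \<open>c p\<close> were in this subgroup, \<open>R\<close> would have a
      word containing exactly one of \<open>p\<close> and \<open>r\<close>.\<close>
    define H where "H = sum c ` {S. S \<subseteq> R \<and> (p \<in> S \<longleftrightarrow> r \<in> S)}"
    have finS: "finite S" if "S \<subseteq> R" for S using that R(1) finite_subset by blast
    have subH: "subgrp H"
      unfolding subgrp_def
    proof (intro conjI ballI)
      show "0 \<in> H" unfolding H_def by (rule image_eqI[of _ _ "{}"]) auto
      fix u v assume "u \<in> H" "v \<in> H"
      then obtain S T where ST: "S \<subseteq> R" "T \<subseteq> R" "p \<in> S \<longleftrightarrow> r \<in> S" "p \<in> T \<longleftrightarrow> r \<in> T" "u = sum c S" "v = sum c T"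
        by (auto simp: H_def)
      have "u + v = sum c (sym_diff S T)" using sum_sym_diff[OF finS finS, OF ST(1,2), of c] ST by simp
      then show "u + v \<in> H" unfolding H_def by (rule image_eqI) (use ST in auto)
    qed
    have flip: "sum c (sym_diff {p} S) = c p + sum c S" if "S \<subseteq> R" for S
      using sum_sym_diff[OF _ finS[OF that], of "{p}" c] by simp
    show ?thesis
    proof (rule separatedI[OF subH])
      show "c p \<notin> H"
      proof
        assume "c p \<in> H"
        then obtain S where S: "S \<subseteq> R" "p \<in> S \<longleftrightarrow> r \<in> S" "c p = sum c S" by (auto simp: H_def)
        have "sym_diff {p} S \<in> words c R" unfolding words_def using flip[OF S(1)] S aR by auto
        then show False using even_w[of "sym_diff {p} S"] S(2) pr(2) by auto
      qed
      fix v assume "v \<in> fst ` A"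
      then obtain b where vb: "(v, b) \<in> A" by auto
      obtain S where S: "S \<in> ?W v" "j \<in> S" using ex[OF vb] by blast
      let ?S = "S - {j}"
      have SR: "?S \<subseteq> R" using S by (auto simp: words_def)
      have "finite S" using S finE finite_subset by (auto simp: words_def)
      then have "sum (c(j := v)) S = v + sum c ?S"
        using sum.remove[OF _ S(2), of "c(j := v)"] sum_upd[of j ?S c v] by simp
      then have v: "v = sum c ?S" using S(1) by (simp add: words_def add_eq_0_iff_eq)
      have jp: "p \<noteq> j" "r \<noteq> j" using aR R(3) by auto
      have "v + c p = sum c (sym_diff {p} ?S)" using flip[OF SR] v by (simp add: add.commute)
      then show "v + c p \<in> H" unfolding H_def
        by (rule image_eqI) (use SR aR odd_w[OF vb S] pr(2) jp in auto)
    qed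
  qed
qed

section \<open>Families in normal form with four to eight elements besides e\<close>

text \<open>\<open>M\<close> holds the elements that are not counted as copies of \<open>e\<close>,
  and the index \<open>e\<close> stands for all m copies. The bound \<open>card M - 4\<close> is 2n
  - 1 - m, because \<open>card M\<close> is 2n + 3 - m; \<open>small\<close> says that no exchange
  is left.\<close>

locale reduced_family =
  fixes n :: int and c :: "'i \<Rightarrow> 'v::{char_two,finite}" and y :: "'i \<Rightarrow> int" and M :: "'i set" and j e :: 'i
    and A :: "('v \<times> int) set"
  assumes V: "card (UNIV :: 'v set) = 32" and n: "odd n" "70 < n" and finM: "finite M"
    and je: "j \<notin> insert e M" "e \<notin> M" and ce: "c e \<noteq> 0" and ye: "[2 * y e = 1] (mod n)"
    and val: "\<And>d b J. (d, b) \<in> A \<Longrightarrow> J \<subseteq> insert j M \<Longrightarrow> J \<noteq> {} \<Longrightarrow>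
      sum (c(j := d)) J = 0 \<or> sum (c(j := d)) J = c e \<Longrightarrow>
      1 \<le> (2 * sum (y(j := b)) J) mod n \<and> (2 * sum (y(j := b)) J) mod n \<le> int (card M) - 4 \<and>
      (even ((2 * sum (y(j := b)) J) mod n) \<longleftrightarrow> sum (c(j := d)) J = 0)"
    and small: "\<And>J. J \<subseteq> M \<Longrightarrow> J \<noteq> {} \<Longrightarrow> sum c J = 0 \<or> sum c J = c e \<Longrightarrow>
      (2 * sum y J) mod n < int (card J)"
    and card_M: "4 \<le> card M" "card M \<le> 8"
begin

lemma upd: "J \<subseteq> insert e M \<Longrightarrow> sum (c(j := d)) J = sum c J" "J \<subseteq> insert e M \<Longrightarrow> sum (y(j := b)) J = sum y J"
  using je sum_upd[of j J] by auto

text \<open>The values \<open>f\<close> of the words for the labels modulo \<open>c e\<close> turn into values of \<open>y\<close>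
  on honest words once \<open>e\<close> is added to the words with odd \<open>f\<close>.\<close>

lemma word_y:
  assumes A: "(d, b) \<in> A" and J: "J \<subseteq> insert j (insert e M)" "J \<noteq> {}" "sum (c(j := d)) J = 0"
  shows "\<exists>v. 1 \<le> v \<and> 2 * v \<le> int (card M) - 4 + (if e \<in> J then 1 else 0) \<and> [sum (y(j := b)) J = v] (mod n)"
proof (cases "e \<in> J")
  case False
  then have JM: "J \<subseteq> insert j M" using J(1) by blast
  let ?f = "(2 * sum (y(j := b)) J) mod n"
  have f: "1 \<le> ?f" "?f \<le> int (card M) - 4" "even ?f" using val[OF A JM J(2)] J(3) by auto
  obtain v where v: "?f = 2 * v" using f(3) by (rule evenE)
  have "[2 * sum (y(j := b)) J = 2 * v] (mod n)" unfolding v[symmetric] by (simp add: cong_def)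
  then have "[sum (y(j := b)) J = v] (mod n)" using cong_half n by blast
  then show ?thesis using f v False by (intro exI[of _ v]) auto
next
  case True
  let ?J = "J - {e}"
  have JM: "?J \<subseteq> insert j M" using J(1) by blast
  have "finite J" using J(1) finM by (meson finite_insert finite_subset)
  then have s: "sum (c(j := d)) J = c e + sum (c(j := d)) ?J" "sum (y(j := b)) J = y e + sum (y(j := b)) ?J"
    using sum.remove[OF _ True, of "c(j := d)"] sum.remove[OF _ True, of "y(j := b)"] je by auto
  then have cJ: "sum (c(j := d)) ?J = c e" using J(3) by (simp add: add_eq_0_iff_eq)
  have "?J \<noteq> {}"
  proof
    assume em: "?J = {}"
    show False using cJ ce unfolding em sum.empty by simp
  qed
  let ?f = "(2 * sum (y(j := b)) ?J) mod n"
  have f: "1 \<le> ?f" "?f \<le> int (card M) - 4" "odd ?f"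
    using val[OF A JM \<open>?J \<noteq> {}\<close>] cJ ce by auto
  obtain v where v: "?f = 2 * v + 1" using f(3) by (rule oddE)
  have "[2 * sum (y(j := b)) ?J = 2 * v + 1] (mod n)" unfolding v[symmetric] by (simp add: cong_def)
  then have "[2 * y e + 2 * sum (y(j := b)) ?J = 1 + (2 * v + 1)] (mod n)" by (rule cong_add[OF ye])
  then have "[2 * sum (y(j := b)) J = 2 * (v + 1)] (mod n)" unfolding s(2) by (simp only: distrib_left ac_simps) simp
  then have "[sum (y(j := b)) J = v + 1] (mod n)" using cong_half n by blast
  then show ?thesis using f v True by (intro exI[of _ "v + 1"]) auto
qed

lemma ex_zero_word:
  fixes g :: "'i \<Rightarrow> 'v"
  assumes "finite Z" "6 \<le> card Z"
  obtains J where "J \<subseteq> Z" "J \<noteq> {}" "sum g J = 0"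
proof -
  have "(2::nat) ^ 6 \<le> 2 ^ card Z" using assms(2) by (intro power_increasing) auto
  then have "\<exists>J\<subseteq>Z. J \<noteq> {} \<and> sum g J \<in> {0}"
    by (intro ex_word[OF assms(1), of "{0}" UNIV]) (use V in \<open>auto simp: subgrp_def\<close>)
  then show thesis using that by auto
qed

text \<open>Six elements of F_2^5 contain a zero word, whose value v \<ge> 1 would satisfy 2v \<le>
  1. For four elements in \<open>M\<close>, both \<open>j\<close> and \<open>e\<close> are needed to
  reach six.\<close>

lemma small_case:
  assumes "card M \<le> 5"
  shows "A = {}"
proof (rule ccontr)
  assume "A \<noteq> {}"
  then obtain d b where A: "(d, b) \<in> A" by auto
  let ?R = "if card M = 4 then insert e M else M"
  have R: "?R \<subseteq> insert e M" "card (insert j ?R) = 6" "finite ?R"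
    using assms card_M(1) finM je by (auto simp: card_insert_if)
  have "finite (insert j ?R)" "6 \<le> card (insert j ?R)" using R(2,3) by auto
  then obtain J where J: "J \<subseteq> insert j ?R" "J \<noteq> {}" "sum (c(j := d)) J = 0"
    by (rule ex_zero_word)
  have JI: "J \<subseteq> insert j (insert e M)" using J(1) R(1) by blast
  obtain v where v: "1 \<le> v" "2 * v \<le> int (card M) - 4 + (if e \<in> J then 1 else 0)"
    using word_y[OF A JI J(2,3)] by blast
  have "e \<notin> J" if "card M \<noteq> 4" using that J(1) je by auto
  then have "int (card M) = 4 \<or> e \<notin> J" by fastforce
  then show False using v assms by (cases "e \<in> J") simp_all
qed

text \<open>All words satisfy 2v \<le> 3, so v = 1. When \<open>M\<close> has only six elements,
  \<open>e\<close> is the seventh and raises the bound 2 to 3.\<close>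

lemma middle_case:
  assumes "card M = 6 \<or> card M = 7"
  shows "separated (fst ` A)"
proof -
  let ?R = "if card M = 6 then insert e M else M"
  have R: "?R \<subseteq> insert e M" "card ?R = 7" "finite ?R" "j \<notin> ?R"
    using assms finM je by auto
  show ?thesis
  proof (rule seven_case[OF V n(1) _ R(3,2,4)])
    fix d b J assume A: "(d, b) \<in> A" and J: "J \<subseteq> insert j ?R" "J \<noteq> {}" "sum (c(j := d)) J = 0"
    have JI: "J \<subseteq> insert j (insert e M)" using J(1) R(1) by blast
    obtain v where v: "1 \<le> v" "2 * v \<le> int (card M) - 4 + (if e \<in> J then 1 else 0)"
      "[sum (y(j := b)) J = v] (mod n)" using word_y[OF A JI J(2,3)] by blast
    have "e \<notin> J" if "card M = 7" using that J(1) je by auto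
    then have "v = 1" using v(1,2) assms by (auto split: if_splits)
    then show "[sum (y(j := b)) J = 1] (mod n)" using v(3) by simp
  qed (use n in simp)
qed

definition unit_words :: "'i set \<Rightarrow> bool" where
  "unit_words E \<longleftrightarrow> (\<forall>J\<subseteq>E. J \<noteq> {} \<longrightarrow> sum c J = 0 \<longrightarrow> [sum y J = 1] (mod n))"

lemma card_words_ge: "finite E \<Longrightarrow> 2 ^ card E \<le> card (words c E) * 32"
  using card_words[of E UNIV c] V by (simp add: subgrp_def)

text \<open>Nine elements have at least 16 words, and their fifteen atoms would not fit.\<close>

lemma not_unit_words:
  assumes "card M = 8"
  shows "\<not> unit_words (insert e M)"
proof
  assume u: "unit_words (insert e M)"
  have fin: "finite (insert e M)" "card (insert e M) = 9" using finM je assms by auto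
  have "2 ^ Suc 3 \<le> card (words c (insert e M))" using card_words_ge[OF fin(1)] fin(2) by simp
  then have "2 ^ Suc 3 \<le> card (insert e M - {}) + 1"
    by (intro words_value_one_bound[OF n(1) _ fin(1), of 3 c y]) (use u n in \<open>auto simp: unit_words_def\<close>)
  then show False using fin(2) by simp
qed

text \<open>By parity, f \<le> 2 means f = 2 for label 0 and f = 1 for label \<open>c e\<close>. In
  the second case e itself supplies the missing 1, so twice the sum is 2 in both.\<close>

lemma unit_wordsI:
  assumes A: "(d, b) \<in> A" and E: "E \<subseteq> M"
    and le: "\<And>J. J \<subseteq> E \<Longrightarrow> J \<noteq> {} \<Longrightarrow> sum c J = 0 \<or> sum c J = c e \<Longrightarrow> (2 * sum y J) mod n \<le> 2"
  shows "unit_words (insert e E)"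
  unfolding unit_words_def
proof (intro allI impI)
  fix J assume J: "J \<subseteq> insert e E" "J \<noteq> {}" "sum c J = 0"
  have JeM: "J - {e} \<subseteq> insert j M" "J - {e} \<subseteq> insert e M" "J - {e} \<subseteq> E" using J(1) E by auto
  have finJ: "finite J" using J(1) E finM by (meson finite_insert finite_subset)
  let ?f = "(2 * sum y (J - {e})) mod n"
  have s: "sum c J = (if e \<in> J then c e else 0) + sum c (J - {e})" "sum y J = (if e \<in> J then y e else 0) + sum y (J - {e})"
    using sum.remove[OF finJ, of e] by auto
  have cJ: "sum c (J - {e}) = (if e \<in> J then c e else 0)" using s(1) J(3) by (auto simp: add_eq_0_iff_eq split: if_splits)
  have ne: "J - {e} \<noteq> {}"
  proof
    assume em: "J - {e} = {}"
    then have "e \<in> J" using J(2) by blast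
    then show False using cJ ce unfolding em sum.empty by simp
  qed
  have "1 \<le> ?f" "even ?f \<longleftrightarrow> sum c (J - {e}) = 0"
    using val[OF A JeM(1) ne] cJ unfolding upd[OF JeM(2)] by (auto split: if_splits)
  moreover have "?f \<le> 2" by (rule le[OF JeM(3) ne]) (use cJ in auto)
  moreover have "p = (if e \<in> J then 1 else 2)" if "1 \<le> p" "p \<le> 2" "even p \<longleftrightarrow> e \<notin> J" for p :: int
    using that by (cases "e \<in> J") (simp_all, presburger+)
  ultimately have f: "?f = (if e \<in> J then 1 else 2)" using cJ ce by (metis (full_types))
  have "[2 * sum y (J - {e}) = ?f] (mod n)" by (simp add: cong_def)
  then have "[2 * sum y J = 2 * 1] (mod n)"
    using cong_add[OF ye, of "2 * sum y (J - {e})" 1] unfolding s(2) f by (auto simp: distrib_left)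
  then show "[sum y J = 1] (mod n)" using cong_half n by blast
qed

text \<open>The elements of \<open>M\<close> whose label an admissible \<open>d\<close> may repeat;
  the restriction on \<open>2 * y r\<close> is what uniqueness rests on.\<close>

definition exceptional :: "'i \<Rightarrow> bool" where
  "exceptional r \<longleftrightarrow> r \<in> M \<and> unit_words (insert e (M - {r})) \<and> (\<exists>t. (t = 0 \<or> t = 1 \<or> t = 2) \<and> [2 * y r = t] (mod n))"

text \<open>The eight elements other than \<open>r\<close> have at least 8 words, all of value 1,
  hence seven atoms with 4y = 1. On subsets of {e, r'} the value 4y is 2, 2t or 2 + 2t, small and
  even, so no atom lies there; but only six elements are left.\<close>

lemma exceptional_unique:
  assumes "card M = 8" "exceptional r" "exceptional r'"
  shows "r = r'"
proof (rule ccontr)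
  assume ne: "r \<noteq> r'"
  have r: "r \<in> M" "r' \<in> M" "unit_words (insert e (M - {r}))" using assms by (auto simp: exceptional_def)
  obtain t where t: "t = 0 \<or> t = 1 \<or> t = 2" "[2 * y r' = t] (mod n)" using assms(3) by (auto simp: exceptional_def)
  let ?E = "insert e (M - {r})"
  have E: "finite ?E" "card ?E = 8" using finM je r(1) assms(1) by auto
  have er: "e \<noteq> r'" using je r(2) by blast
  have "2 ^ Suc 2 \<le> card (words c ?E)" using card_words_ge[OF E(1)] E(2) by simp
  then have "2 ^ Suc 2 \<le> card (?E - {e, r'}) + 1"
  proof (intro words_value_one_bound[OF n(1) _ E(1), of 2 c y])
    show "\<not> [2\<^sup>2 * sum y S = 1] (mod n)" if S: "S \<subseteq> {e, r'}" "S \<noteq> {}" for S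
    proof
      assume one: "[2\<^sup>2 * sum y S = 1] (mod n)"
      have c1: "[2 * (2 * y e) = 2 * 1] (mod n)" by (rule cong_scalar_left[OF ye])
      have c2: "[2 * (2 * y r') = 2 * t] (mod n)" by (rule cong_scalar_left[OF t(2)])
      have "S = {e} \<or> S = {r'} \<or> S = {e, r'}" using S by blast
      then have "\<exists>k\<in>{2, 2 * t, 2 + 2 * t}. [2\<^sup>2 * sum y S = k] (mod n)"
        using c1 c2 cong_add[OF c1 c2] er by (elim disjE) (auto simp: distrib_left)
      then obtain k where k: "k \<in> {2, 2 * t, 2 + 2 * t}" "[2\<^sup>2 * sum y S = k] (mod n)" by blast
      have "[1 = k] (mod n)" using cong_trans[OF cong_sym[OF one] k(2)] .
      then have "1 = k" by (rule cong_imp_eq_small) (use k(1) t(1) n in auto)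
      moreover have "k = 2 \<or> k = 2 * t \<or> k = 2 + 2 * t" using k(1) by simp
      ultimately show False by presburger
    qed
  qed (use r(3) n in \<open>auto simp: unit_words_def\<close>)
  moreover have "card (?E - {e, r'}) = 6"
  proof -
    have "?E - {e, r'} = M - {r, r'}" using je by auto
    then show ?thesis using finM r ne assms(1) by (simp add: card_Diff_subset)
  qed
  ultimately show False by simp
qed

text \<open>By \<open>no_nine_system\<close> some word \<open>J\<close> has value at least its size,
  and by \<open>small\<close> it uses \<open>j\<close>. Values of disjoint words add up to at most
  4, which leaves only {j} and {j, r} for \<open>J\<close>, and then \<open>d\<close> can be read
  off.\<close>

lemma eight_case_element:
  assumes M8: "card M = 8" and A: "(d, b) \<in> A"
  shows "d = c e \<or> (\<exists>r. exceptional r \<and> d = c r)"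
proof -
  let ?c = "c(j := d)" and ?y = "y(j := b)"
  let ?f = "\<lambda>J. (2 * sum ?y J) mod n"
  let ?w = "\<lambda>J. sum ?c J = 0 \<or> sum ?c J = c e"
  have E: "finite (insert j M)" "card (insert j M) = 9" using finM je M8 by auto
  have v: "1 \<le> ?f J" "?f J \<le> 4" "even (?f J) \<longleftrightarrow> sum ?c J = 0" if "J \<subseteq> insert j M" "J \<noteq> {}" "?w J" for J
    using val[OF A that] M8 by auto
  have "\<not> (\<forall>J. J \<subseteq> insert j M \<longrightarrow> J \<noteq> {} \<longrightarrow> ?w J \<longrightarrow>
      1 \<le> ?f J \<and> ?f J < int (card J) \<and> (even (?f J) \<longleftrightarrow> sum ?c J = 0))"
  proof
    assume all: "\<forall>J. J \<subseteq> insert j M \<longrightarrow> J \<noteq> {} \<longrightarrow> ?w J \<longrightarrow>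
      1 \<le> ?f J \<and> ?f J < int (card J) \<and> (even (?f J) \<longleftrightarrow> sum ?c J = 0)"
    show False
    proof (rule no_nine_system[OF V n(1) _ E ce, of ?c ?y])
      show "36 < n" using n by simp
      fix J assume "J \<subseteq> insert j M" "J \<noteq> {}" "?w J"
      then show "1 \<le> ?f J \<and> ?f J < int (card J) \<and> (even (?f J) \<longleftrightarrow> sum ?c J = 0)"
        by (rule all[rule_format])
    qed
  qed
  then obtain J where J: "J \<subseteq> insert j M" "J \<noteq> {}" "?w J"
    "\<not> (1 \<le> ?f J \<and> ?f J < int (card J) \<and> (even (?f J) \<longleftrightarrow> sum ?c J = 0))"
    unfolding not_all not_imp by (elim exE conjE)
  then have J4: "int (card J) \<le> ?f J"
    using v[OF J(1-3)] by linarith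
  note J = J(1-3) J4
  have jJ: "j \<in> J"
  proof (rule ccontr)
    assume "j \<notin> J"
    then have JM: "J \<subseteq> M" "J \<subseteq> insert e M" using J(1) by auto
    show False using small[OF JM(1) J(2)] J(3,4) unfolding upd[OF JM(2)] by linarith
  qed
  define J0 where "J0 = J - {j}"
  have J0: "J0 \<subseteq> M" "J = insert j J0" "j \<notin> J0" using J(1) jJ by (auto simp: J0_def)
  have finJ: "finite J0" using J0(1) finM finite_subset by blast
  have cJ: "card J = Suc (card J0)" using J0 finJ by simp
  \<comment> \<open>Values of the disjoint words \<open>I\<close> and \<open>J\<close> add without
    reduction modulo \<open>n\<close>, and their union obeys the bound 4.\<close>
  have rest: "(2 * sum y I) mod n \<le> 4 - ?f J"
    if I: "I \<subseteq> M - J0" "I \<noteq> {}" "sum c I = 0 \<or> sum c I = c e" for I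
  proof -
    have IM: "I \<subseteq> insert j M" "I \<subseteq> insert e M" using I(1) by auto
    have dj: "I \<inter> J = {}" using I(1) J0 je by auto
    have fin: "finite I" "finite J" using finite_subset[OF IM(1) E(1)] finite_subset[OF J(1) E(1)] .
    have wI: "?w I" using I(3) unfolding upd[OF IM(2)] .
    have sc: "sum ?c (I \<union> J) = sum ?c I + sum ?c J" and sy: "sum ?y (I \<union> J) = sum ?y I + sum ?y J"
      by (rule sum.union_disjoint[OF fin dj])+
    have wU: "?w (I \<union> J)" using wI J(3) unfolding sc by (elim disjE) simp_all
    have U: "I \<union> J \<subseteq> insert j M" "I \<union> J \<noteq> {}" using IM J by auto
    have "[?f (I \<union> J) = ?f I + ?f J] (mod n)"
      unfolding sy distrib_left by (simp only: cong_def mod_mod_trivial mod_add_eq)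
    then have "?f (I \<union> J) = ?f I + ?f J"
      by (rule cong_imp_eq_small) (use v(1,2)[OF IM(1) I(2) wI] v(1,2)[OF J(1-3)] v(1,2)[OF U wU] n in linarith)
    then have "?f I \<le> 4 - ?f J" using v(2)[OF U wU] by linarith
    then show ?thesis unfolding upd[OF IM(2)] .
  qed
  have low: "1 \<le> (2 * sum y I) mod n" "even ((2 * sum y I) mod n) \<longleftrightarrow> sum c I = 0"
    if I: "I \<subseteq> M" "I \<noteq> {}" "sum c I = 0 \<or> sum c I = c e" for I
  proof -
    have IM: "I \<subseteq> insert j M" "I \<subseteq> insert e M" using I(1) by auto
    show "1 \<le> (2 * sum y I) mod n" "even ((2 * sum y I) mod n) \<longleftrightarrow> sum c I = 0"
      using v[OF IM(1) I(2)] I(3) unfolding upd[OF IM(2)] by auto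
  qed
  have cMJ: "card (M - J0) = 8 - card J0" using finJ J0(1) M8 by (simp add: card_Diff_subset)
  \<comment> \<open>Six elements contain a zero word, whose even value is at least 2.\<close>
  have f2: "?f J \<le> 2" if c6: "6 \<le> card (M - J0)"
  proof -
    obtain I where I: "I \<subseteq> M - J0" "I \<noteq> {}" "sum c I = 0"
      using ex_zero_word[OF finite_Diff[OF finM] c6] .
    have "I \<subseteq> M" using I(1) by blast
    then have "1 \<le> (2 * sum y I) mod n" "even ((2 * sum y I) mod n)" using low[of I] I by auto
    moreover have "2 \<le> p" if "1 \<le> p" "even p" for p :: int using that by presburger
    ultimately have "2 \<le> (2 * sum y I) mod n" by blast
    then show ?thesis using rest[OF I(1,2)] I(3) by linarith
  qed
  have f4: "?f J \<le> 4" by (rule v(2)[OF J(1-3)])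
  have "card J0 \<le> 1"
  proof (rule ccontr)
    assume "\<not> ?thesis"
    then consider "card J0 = 2" | "card J0 = 3" using J(4) cJ f4 by linarith
    then show False
    proof cases
      case 1
      then show False using f2 cMJ J(4) cJ by simp
    next
      case 2
      \<comment> \<open>Five elements remain, dependent modulo \<open>c e\<close>, while the value 4
        of \<open>J\<close> leaves nothing for a disjoint word.\<close>
      have "\<exists>I\<subseteq>M - J0. I \<noteq> {} \<and> sum c I \<in> {0, c e}"
        by (rule ex_word[of _ _ UNIV]) (use finM V cMJ 2 ce in \<open>auto simp: subgrp_def\<close>)
      then obtain I where I: "I \<subseteq> M - J0" "I \<noteq> {}" "sum c I = 0 \<or> sum c I = c e" by blast
      have "I \<subseteq> M" using I(1) by blast
      then show False using low(1)[OF _ I(2,3)] rest[OF I] J(4) cJ 2 by linarith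
    qed
  qed
  then consider "J0 = {}" | r where "J0 = {r}" using finJ by (metis card_0_eq card_1_singletonE le_Suc_eq One_nat_def le_zero_eq)
  then show ?thesis
  proof cases
    case 1
    then have Jj: "J = {j}" "sum ?c J = d" using J0 by auto
    have "?f J \<le> 2" using f2 cMJ 1 by simp
    moreover have "?f J \<noteq> 2"
    proof
      assume "?f J = 2"
      then have "unit_words (insert e M)"
        by (intro unit_wordsI[OF A order_refl]) (use rest 1 in auto)
      then show False using not_unit_words M8 by blast
    qed
    ultimately have "?f J = 1" using v(1)[OF J(1-3)] by linarith
    then have "d \<noteq> 0" using v(3)[OF J(1-3)] Jj(2) by auto
    then show ?thesis using J(3) Jj(2) by simp
  next
    case (2 r)
    then have rM: "r \<in> M" "r \<noteq> j" using J0 by auto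
    have fJ: "?f J = 2" using f2 cMJ 2 J(4) cJ by simp
    have Jr: "J = {j, r}" using J0(2) 2 by simp
    have "sum ?c J = 0" using v(3)[OF J(1-3)] fJ by simp
    then have dr: "d = c r" using Jr rM by (simp add: add_eq_0_iff_eq)
    have yr: "[2 * (b + y r) = 2 * 1] (mod n)"
    proof -
      have "[2 * sum ?y J = ?f J] (mod n)" by (simp add: cong_def)
      then show ?thesis unfolding fJ unfolding Jr using rM by simp
    qed
    then have yr1: "[b + y r = 1] (mod n)" using cong_half n by blast
    have u: "unit_words (insert e (M - {r}))"
      by (rule unit_wordsI[OF A Diff_subset]) (use rest fJ 2 in auto)
    \<comment> \<open>A word with value other than 1 must use \<open>r\<close>. Replacing
      \<open>r\<close> by \<open>j\<close>, which has the same label, gives another word; both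
      values are 1 or 2, and their difference \<open>y r - b\<close> together with
      \<open>b + y r\<close> = 1 confines \<open>2 * y r\<close>.\<close>
    obtain L where L: "L \<subseteq> insert e M" "L \<noteq> {}" "sum c L = 0" "\<not> [sum y L = 1] (mod n)"
      using not_unit_words[OF M8] by (auto simp: unit_words_def)
    have rL: "r \<in> L"
    proof (rule ccontr)
      assume "r \<notin> L"
      then have "L \<subseteq> insert e (M - {r})" using L(1) by blast
      then show False using u L(2-4) by (auto simp: unit_words_def)
    qed
    have finL: "finite L" using L(1) finM by (meson finite_insert finite_subset)
    define L' where "L' = insert j (L - {r})"
    have jL: "j \<notin> L" using L(1) je by blast
    have Ls: "L - {r} \<subseteq> insert e M" "L \<subseteq> insert e M" using L(1) by auto
    have sc: "sum c L = c r + sum c (L - {r})" and sy: "sum y L = y r + sum y (L - {r})"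
      by (rule sum.remove[OF finL rL])+
    have sc': "sum ?c L' = d + sum c (L - {r})" and sy': "sum ?y L' = b + sum y (L - {r})"
      unfolding L'_def using finL jL upd[OF Ls(1)] by simp_all
    have "L' \<subseteq> insert j (insert e M)" "L' \<noteq> {}" "sum ?c L' = 0"
      using L(1,3) sc sc' dr by (auto simp: L'_def)
    from word_y[OF A this] M8 obtain v' where v': "1 \<le> v'" "2 * v' \<le> 5" "[sum ?y L' = v'] (mod n)"
      by (auto split: if_splits)
    have "L \<subseteq> insert j (insert e M)" "sum ?c L = 0" using L(1,3) upd(1)[OF Ls(2)] by auto
    from word_y[OF A this(1) L(2) this(2)] M8 obtain v where w: "1 \<le> v" "2 * v \<le> 5" "[sum ?y L = v] (mod n)"
      by (auto split: if_splits)
    have "[sum y L - sum ?y L' + (b + y r) = v - v' + 1] (mod n)"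
      using w(3) unfolding upd(2)[OF Ls(2)] by (intro cong_add cong_diff v'(3) yr1)
    moreover have "sum y L - sum ?y L' + (b + y r) = 2 * y r" unfolding sy sy' by simp
    ultimately have "[2 * y r = v - v' + 1] (mod n)" by (simp only:)
    moreover have "v - v' + 1 = 0 \<or> v - v' + 1 = 1 \<or> v - v' + 1 = 2" using v'(1,2) w(1,2) by presburger
    ultimately have "exceptional r" unfolding exceptional_def using rM(1) u by blast
    then show ?thesis using dr by blast
  qed
qed

theorem separated_A: "separated (fst ` A)"
proof -
  consider "card M \<le> 5" | "card M = 6 \<or> card M = 7" | "card M = 8" using card_M by linarith
  then show ?thesis
  proof cases
    case 1
    then show ?thesis using small_case separated_empty[OF V] by simp
  next
    case 2
    then show ?thesis by (rule middle_case)
  next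
    case 3
    note el = eight_case_element[OF 3]
    show ?thesis
    proof (cases "\<exists>r. exceptional r")
      case False
      then show ?thesis using el ce by (intro separatedI[of "{0}" "c e"]) (auto simp: subgrp_def add_eq_0_iff_eq)
    next
      case True
      then obtain r where r: "exceptional r" by blast
      have rM: "{r} \<subseteq> M" using r by (auto simp: exceptional_def)
      show ?thesis
      proof (cases "A = {}")
        case True
        then show ?thesis using separated_empty[OF V] by simp
      next
        case False
        then obtain d b where A: "(d, b) \<in> A" by auto
        \<comment> \<open>A single element of label 0 would have value at least 1 by
          \<open>val\<close> and below 1 by \<open>small\<close>. So \<open>c e\<close> lies outside
          {0, c e + c r}.\<close>
        have "c r \<noteq> 0"
        proof
          assume 0: "c r = 0"
          have "{r} \<subseteq> insert j M" "{r} \<subseteq> insert e M" using rM by auto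
          then have "1 \<le> (2 * sum y {r}) mod n" using val[OF A, of "{r}"] 0 upd[of "{r}"] by (simp del: fun_upd_apply)
          then show False using small[OF rM] 0 by simp
        qed
        moreover have "v + c e \<in> {0, c e + c r}" if "v \<in> fst ` A" for v
          using that el exceptional_unique[OF 3 r] by (fastforce simp: add.commute)
        ultimately show ?thesis
          using ce by (intro separatedI[of "{0, c e + c r}" "c e"]) (auto simp: subgrp_def)
      qed
    qed
  qed
qed

end

text \<open>Scaling by the unit \<open>u\<close> changes only the residues in \<open>A\<close>, and
  exchanges act inside \<open>I\<close>; so the labels to be separated are the same before and after
  normalization.\<close>

theorem zsf_separated:
  fixes c :: "'i \<Rightarrow> 'v::{char_two,finite}" and y :: "'i \<Rightarrow> int"
  assumes V: "card (UNIV :: 'v set) = 32" and n: "odd n" "70 < n" and I: "finite I" "int (card I) = 2 * n + 3" "j \<notin> I"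
    and zsf: "zsf n c y I" and A: "\<And>d b. (d, b) \<in> A \<Longrightarrow> zsf n (c(j := d)) (y(j := b)) (insert j I)"
  shows "separated (fst ` A)"
proof -
  obtain u D z where u: "coprime u n" "matching (\<lambda>p r. c p = c r) I D" "n - 27 \<le> int (card D)"
    "\<And>e. e \<in> D \<Longrightarrow> [u * sum y e = 1] (mod n)" "z \<in> I" "[2 * (u * y z) = 1] (mod n)"
    using unit_pairs[OF V n I(1,2) zsf] by blast
  define y1 where "y1 = (\<lambda>i. u * y i)"
  define A1 where "A1 = (\<lambda>(d, b). (d, u * b)) ` A"
  have fstA: "fst ` A1 = fst ` A" by (force simp: A1_def image_iff)
  have "zsf n (c(j := d)) (y1(j := u * b)) (insert j I)" if "(d, b) \<in> A" for d b
  proof -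
    have "(\<lambda>i. u * (y(j := b)) i) = y1(j := u * b)" by (auto simp: y1_def)
    then show ?thesis using zsf_scale[OF u(1), of "c(j := d)" "y(j := b)" "insert j I"] A[OF that] by simp
  qed
  then have comp1: "compat n I j A1 c y1"
    using zsf_scale[OF u(1), of c y I] zsf by (auto simp: compat_def A1_def y1_def)
  let ?D = "{e\<in>D. z \<notin> e}"
  have finD: "finite D" by (rule matching_finite[OF u(2) I(1)])
  have mD: "matching (\<lambda>p r. c p = c r) I ?D" by (rule matching_subset[OF u(2)]) blast
  have "card (D - ?D) \<le> 1"
  proof (rule ccontr)
    assume "\<not> ?thesis"
    then have "2 \<le> card (D - ?D)" by simp
    then obtain Z where "Z \<subseteq> D - ?D" "card Z = 2" by (meson obtain_subset_with_card_n)
    then obtain e e' where "e \<in> D - ?D" "e' \<in> D - ?D" "e \<noteq> e'" by (auto simp: card_2_iff)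
    then show False using matching_disjoint[OF u(2), of e e'] by blast
  qed
  moreover have "card (D - ?D) = card D - card ?D" by (rule card_Diff_subset) (use finD in auto)
  ultimately have cD: "n - 28 \<le> int (card ?D)" using u(3) by linarith
  have zD: "z \<in> I - \<Union>?D" using u(5) by blast
  obtain c2 y2 where c2: "compat n I j A1 c2 y2"
    "\<forall>i\<in>insert z (\<Union>?D). c2 i = c z \<and> [y2 i = y1 z] (mod n)"
  proof -
    have "[sum y1 e = 1] (mod n)" if "e \<in> ?D" for e
      using u(4)[of e] that by (simp add: y1_def sum_distrib_left)
    then show thesis
      using compat_pairs[OF _ mD _ comp1 I(1,3) zD refl cong_refl] u(6) finD that by (auto simp: y1_def)
  qed
  let ?U = "{i\<in>I. c2 i = c z \<and> [y2 i = y1 z] (mod n)}"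
  have ye: "[2 * y1 z = 1] (mod n)" using u(6) by (simp add: y1_def)
  have "insert z (\<Union>?D) \<subseteq> ?U" using c2(2) zD matching_Union[OF mD] by blast
  then have "card (insert z (\<Union>?D)) \<le> card ?U" by (rule card_mono[rotated]) (use I(1) in simp)
  moreover have "card (insert z (\<Union>?D)) = Suc (2 * card ?D)"
  proof -
    have "finite (\<Union>?D)" using matching_Union[OF mD] I(1) finite_subset by blast
    then show ?thesis using card_matching_Union[OF mD I(1)] by simp
  qed
  \<comment> \<open>Two copies from each of at least n - 28 pairs, and \<open>z\<close> itself; one
    of the n - 27 pairs may be lost for containing \<open>z\<close>.\<close>
  ultimately have mU: "2 * n - 55 \<le> int (card ?U)" using cD by linarith
  obtain c' y' U where nf: "compat n I j A1 c' y'" "U \<subseteq> I"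
    "\<And>i. i \<in> U \<Longrightarrow> c' i = c z \<and> [y' i = y1 z] (mod n)" "2 * n - 55 \<le> int (card U)"
    "\<And>J. J \<subseteq> I - U \<Longrightarrow> J \<noteq> {} \<Longrightarrow> sum c' J = 0 \<or> sum c' J = c z \<Longrightarrow> (2 * sum y' J) mod n < int (card J)"
    using compat_normal_form[OF c2(1) I(1,3) n ye mU] by blast
  have npos: "0 < n" using n by simp
  have nU: "n \<le> int (card U)" using nf(4) n by linarith
  have zsf': "zsf n c' y' I" using nf(1) by (simp add: compat_def)
  note mb = multiplicity_bounds[OF zsf' I(1) n(1) npos nf(2,3) nU]
  have ce: "c z \<noteq> 0" and Ult: "int (card U) < 2 * n" using mb by blast+
  have finU: "finite U" using nf(2) I(1) finite_subset by blast
  let ?M = "I - U"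
  have cM: "int (card ?M) = 2 * n + 3 - int (card U)"
    using I(2) nf(2) finU card_mono[OF I(1) nf(2)] by (simp add: card_Diff_subset)
  have U0: "U \<noteq> {}" using nU n by auto
  then obtain e where e: "e \<in> U" by blast
  have e': "c' e = c z" "[y' e = y1 z] (mod n)" using nf(3)[OF e] by auto
  have ye': "[2 * y' e = 1] (mod n)" using cong_trans[OF cong_scalar_left[OF e'(2)] ye] .
  have wval: "1 \<le> (2 * sum y' J) mod n" "even ((2 * sum y' J) mod n) \<longleftrightarrow> sum c' J = 0"
    if "J \<subseteq> ?M" "J \<noteq> {}" "sum c' J = 0 \<or> sum c' J = c z" for J
    using word_value[OF zsf' I(1) n(1) npos nf(2,3) ye nU ce that] by blast+
  have M8: "card ?M \<le> 8"
  proof (rule ccontr)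
    assume "\<not> ?thesis"
    then have "9 \<le> card ?M" by simp
    then obtain E where E: "E \<subseteq> ?M" "card E = 9" by (meson obtain_subset_with_card_n)
    have finE: "finite E" using E(1) I(1) by (meson Diff_subset finite_subset subset_trans)
    show False
    proof (rule no_nine_system[OF V n(1) _ finE E(2) ce, of c' y'])
      show "1 \<le> (2 * sum y' J) mod n \<and> (2 * sum y' J) mod n < int (card J) \<and>
          (even ((2 * sum y' J) mod n) \<longleftrightarrow> sum c' J = 0)"
        if "J \<subseteq> E" "J \<noteq> {}" "sum c' J = 0 \<or> sum c' J = c z" for J
        using wval[of J] nf(5)[of J] that E(1) by blast
    qed (use n in simp)
  qed
  interpret reduced_family n c' y' ?M j e A1
  proof unfold_locales
    show "j \<notin> insert e ?M" "e \<notin> ?M" using I(3) e nf(2) by auto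
    show "c' e \<noteq> 0" using ce e'(1) by simp
    show "4 \<le> card ?M" using cM Ult by linarith
    show "(2 * sum y' J) mod n < int (card J)" if "J \<subseteq> ?M" "J \<noteq> {}" "sum c' J = 0 \<or> sum c' J = c' e" for J
      using nf(5) that e'(1) by simp
    show "1 \<le> (2 * sum (y'(j := b)) J) mod n \<and> (2 * sum (y'(j := b)) J) mod n \<le> int (card ?M) - 4 \<and>
        (even ((2 * sum (y'(j := b)) J) mod n) \<longleftrightarrow> sum (c'(j := d)) J = 0)"
      if db: "(d, b) \<in> A1" and J: "J \<subseteq> insert j ?M" "J \<noteq> {}" "sum (c'(j := d)) J = 0 \<or> sum (c'(j := d)) J = c' e"
      for d b J
    proof -
      have z': "zsf n (c'(j := d)) (y'(j := b)) (insert j I)" using nf(1) db by (auto simp: compat_def)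
      have jU: "j \<notin> U" using I(3) nf(2) by blast
      have JU: "J \<subseteq> insert j I - U" using J(1) jU by blast
      have Uj: "(c'(j := d)) i = c z \<and> [(y'(j := b)) i = y1 z] (mod n)" if "i \<in> U" for i
        using nf(3)[OF that] that jU by auto
      have fin: "finite (insert j I)" "U \<subseteq> insert j I" using I(1) nf(2) by auto
      have "2 * n - 1 - int (card U) = int (card ?M) - 4" using cM by simp
      then show ?thesis
        using word_value[OF z' fin(1) n(1) npos fin(2) Uj ye nU ce JU J(2)] J(3) e'(1) by simp
    qed
  qed (use V n I ye' M8 in auto)
  show ?thesis using separated_A fstA by simp
qed

section \<open>Sequences over the group\<close>

text \<open>Subsequences become index sets, which connects multisets with the indexed families
  above.\<close>

lemma subseteq_image_mset_set:
  assumes "finite I" "S \<subseteq># image_mset g (mset_set I)"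
  shows "\<exists>J\<subseteq>I. S = image_mset g (mset_set J)"
  using assms
proof (induction I arbitrary: S rule: finite_induct)
  case (insert i I)
  let ?T = "image_mset g (mset_set I)"
  have T: "S \<subseteq># add_mset (g i) ?T" using insert.prems insert.hyps by simp
  show ?case
  proof (cases "g i \<in># S")
    case True
    then obtain S' where S': "S = add_mset (g i) S'" by (metis insert_DiffM)
    then have "S' \<subseteq># ?T" using T by simp
    then obtain J where J: "J \<subseteq> I" "S' = image_mset g (mset_set J)" using insert.IH by blast
    have "i \<notin> J" "finite J" using J(1) insert.hyps finite_subset by auto
    then have "S = image_mset g (mset_set (insert i J))" using S' J by simp
    then show ?thesis using J(1) by blast
  next
    case False
    then have "count S z \<le> count ?T z" for z
      using mset_subset_eq_count[OF T, of z] by (cases "z = g i") (auto simp: not_in_iff)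
    then have "S \<subseteq># ?T" by (rule mset_subset_eqI)
    then show ?thesis using insert.IH by blast
  qed
qed (use subset_mset.le_zero_eq in \<open>auto\<close>)

lemma ex_indexing:
  obtains g :: "nat \<Rightarrow> 'a" where "T = image_mset g (mset_set {..<size T})"
proof -
  obtain xs where xs: "mset xs = T" using ex_mset by blast
  then have "length xs = size T" by auto
  moreover have "mset xs = image_mset ((!) xs) (mset [0..<length xs])"
    by (metis map_nth mset_map)
  ultimately have "T = image_mset ((!) xs) (mset_set {..<size T})"
    using xs by (simp add: mset_set_upto_eq_mset_upto)
  then show thesis by (rule that)
qed

context comm_group
begin

lemma seq_sum_add_mset:
  assumes "a \<in> carrier G" "set_mset T \<subseteq> carrier G"
  shows "seq_sum G (add_mset a T) = a \<otimes> seq_sum G T"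
proof -
  let ?F = "set_mset T - {a}"
  let ?h = "\<lambda>T g. g [^] count T g"
  have F: "?h T' \<in> ?F \<rightarrow> carrier G" for T' using assms by auto
  have split: "finprod G (?h T') (insert a ?F) = a [^] count T' a \<otimes> finprod G (?h T') ?F" for T'
    by (rule finprod_insert) (use assms F in auto)
  have eq: "finprod G (?h (add_mset a T)) ?F = finprod G (?h T) ?F"
    by (rule finprod_cong') (use assms in auto)
  have "seq_sum G (add_mset a T) = finprod G (?h (add_mset a T)) (insert a ?F)"
    by (simp add: seq_sum_def)
  also have "\<dots> = a [^] Suc (count T a) \<otimes> finprod G (?h T) ?F"
    unfolding split eq by simp
  also have "\<dots> = a \<otimes> (a [^] count T a \<otimes> finprod G (?h T) ?F)"
    using assms(1) finprod_closed[OF F] by (simp add: m_ac)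
  also have "a [^] count T a \<otimes> finprod G (?h T) ?F = seq_sum G T"
  proof (cases "a \<in># T")
    case True
    then have "insert a ?F = set_mset T" by blast
    then show ?thesis using split[of T] by (simp add: seq_sum_def)
  next
    case False
    then have "?F = set_mset T" "count T a = 0" by (auto simp: not_in_iff)
    then show ?thesis using finprod_closed[OF F[of T]] by (simp add: seq_sum_def)
  qed
  finally show ?thesis .
qed

lemma seq_sum_image_mset:
  assumes "finite J" "g ` J \<subseteq> carrier G"
  shows "seq_sum G (image_mset g (mset_set J)) = finprod G g J"
  using assms
proof (induction J rule: finite_induct)
  case empty
  then show ?case by (simp add: seq_sum_def)
next
  case (insert i J)
  have "seq_sum G (image_mset g (mset_set (insert i J))) = g i \<otimes> seq_sum G (image_mset g (mset_set J))"
    using insert by (simp add: seq_sum_add_mset)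
  then show ?case using insert by (simp add: Pi_iff image_subset_iff)
qed

lemma subseq_sums_image_mset:
  assumes "finite I" "g ` I \<subseteq> carrier G"
  shows "subseq_sums G (image_mset g (mset_set I)) = {finprod G g J |J. J \<subseteq> I \<and> J \<noteq> {}}"
proof (rule subset_antisym; rule subsetI)
  fix a assume "a \<in> subseq_sums G (image_mset g (mset_set I))"
  then obtain S where S: "S \<subseteq># image_mset g (mset_set I)" "S \<noteq> {#}" "a = seq_sum G S"
    by (auto simp: subseq_sums_def)
  then obtain J where J: "J \<subseteq> I" "S = image_mset g (mset_set J)"
    using subseteq_image_mset_set[OF assms(1)] by blast
  have "a = finprod G g J"
    unfolding S(3) J(2) by (rule seq_sum_image_mset) (use J(1) assms finite_subset in blast)+
  moreover have "J \<noteq> {}" using S(2) J(2) by auto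
  ultimately show "a \<in> {finprod G g J |J. J \<subseteq> I \<and> J \<noteq> {}}" using J(1) by blast
next
  fix a assume "a \<in> {finprod G g J |J. J \<subseteq> I \<and> J \<noteq> {}}"
  then obtain J where J: "J \<subseteq> I" "J \<noteq> {}" "a = finprod G g J" by blast
  have fin: "finite J" using J(1) assms(1) finite_subset by blast
  have "a = seq_sum G (image_mset g (mset_set J))"
    unfolding J(3) by (rule seq_sum_image_mset[symmetric]) (use fin J(1) assms(2) in blast)+
  moreover have "image_mset g (mset_set J) \<subseteq># image_mset g (mset_set I)"
    by (rule image_mset_subseteq_mono) (use J(1) assms(1) in \<open>simp add: subset_imp_msubset_mset_set\<close>)
  moreover have "image_mset g (mset_set J) \<noteq> {#}" using J(2) fin by (simp add: mset_set_empty_iff)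
  ultimately show "a \<in> subseq_sums G (image_mset g (mset_set I))"
    unfolding subseq_sums_def by blast
qed

end

lemma zero_sum_free_mono:
  assumes "zero_sum_free G T" "T' \<subseteq># T"
  shows "zero_sum_free G T'"
proof -
  have "subseq_sums G T' \<subseteq> subseq_sums G T"
    using assms(2) by (auto simp: subseq_sums_def intro: subset_mset.order_trans)
  moreover have "set_mset T' \<subseteq> set_mset T" using assms(2) by (rule set_mset_mono)
  ultimately show ?thesis using assms(1) unfolding zero_sum_free_def seq_over_def by blast
qed

section \<open>Coordinates on the group\<close>

text \<open>An isomorphism onto F_2^5 + C_n in disguise: \<open>y\<close> takes integer
  representatives and is additive only modulo \<open>n\<close>, and \<open>kernel\<close> and
  \<open>coord_surj\<close> express bijectivity.\<close>

locale coordinates = comm_group G for G (structure) +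
  fixes c :: "'a \<Rightarrow> 'v::{char_two,finite}" and y :: "'a \<Rightarrow> int" and n :: int
  assumes V: "card (UNIV :: 'v set) = 32" and n: "odd n" "70 < n"
    and c_mult: "\<And>a b. a \<in> carrier G \<Longrightarrow> b \<in> carrier G \<Longrightarrow> c (a \<otimes> b) = c a + c b"
    and y_mult: "\<And>a b. a \<in> carrier G \<Longrightarrow> b \<in> carrier G \<Longrightarrow> [y (a \<otimes> b) = y a + y b] (mod n)"
    and kernel: "\<And>a. a \<in> carrier G \<Longrightarrow> c a = 0 \<Longrightarrow> n dvd y a \<Longrightarrow> a = \<one>"
    and coord_surj: "\<And>v z. \<exists>a\<in>carrier G. c a = v \<and> [y a = z] (mod n)"
begin

lemma c_one: "c \<one> = 0"
  using c_mult[of \<one> \<one>] by simp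

lemma y_one: "[y \<one> = 0] (mod n)"
  using y_mult[of \<one> \<one>] by (simp add: cong_iff_dvd_diff)

lemma c_finprod: "g ` J \<subseteq> carrier G \<Longrightarrow> c (finprod G g J) = (\<Sum>i\<in>J. c (g i))"
proof (induction J rule: infinite_finite_induct)
  case (insert i J)
  then have "g \<in> J \<rightarrow> carrier G" "g i \<in> carrier G" by auto
  then show ?case using insert by (simp add: c_mult)
qed (simp_all add: c_one)

lemma y_finprod: "g ` J \<subseteq> carrier G \<Longrightarrow> [y (finprod G g J) = (\<Sum>i\<in>J. y (g i))] (mod n)"
proof (induction J rule: infinite_finite_induct)
  case (insert i J)
  then have g: "g \<in> J \<rightarrow> carrier G" "g i \<in> carrier G" by auto
  then have "[y (finprod G g (insert i J)) = y (g i) + y (finprod G g J)] (mod n)"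
    using insert.hyps by (simp add: y_mult)
  also have "[y (g i) + y (finprod G g J) = y (g i) + (\<Sum>i\<in>J. y (g i))] (mod n)"
    by (rule cong_add[OF cong_refl insert.IH]) (use insert.prems in auto)
  finally show ?case using insert.hyps by simp
qed (simp_all add: y_one)

lemma finprod_eq_one:
  assumes "g ` J \<subseteq> carrier G"
  shows "finprod G g J = \<one> \<longleftrightarrow> (\<Sum>i\<in>J. c (g i)) = 0 \<and> n dvd (\<Sum>i\<in>J. y (g i))"
proof -
  have "n dvd y (finprod G g J) \<longleftrightarrow> n dvd (\<Sum>i\<in>J. y (g i))"
    by (rule cong_dvd_iff[OF y_finprod[OF assms]])
  moreover have "finprod G g J \<in> carrier G" using assms by (intro finprod_closed) auto
  moreover have "n dvd y \<one>" using y_one by (simp add: cong_0_iff)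
  ultimately show ?thesis using kernel[of "finprod G g J"] c_finprod[OF assms] c_one by metis
qed

lemma zero_sum_free_iff:
  assumes "finite I" "g ` I \<subseteq> carrier G"
  shows "zero_sum_free G (image_mset g (mset_set I)) \<longleftrightarrow> zsf n (\<lambda>i. c (g i)) (\<lambda>i. y (g i)) I"
proof -
  have gJ: "g ` J \<subseteq> carrier G" if "J \<subseteq> I" for J using that assms(2) by blast
  have "\<one> \<in> subseq_sums G (image_mset g (mset_set I)) \<longleftrightarrow> (\<exists>J\<subseteq>I. J \<noteq> {} \<and> finprod G g J = \<one>)"
    unfolding subseq_sums_image_mset[OF assms] by (auto simp: eq_commute)
  also have "\<dots> \<longleftrightarrow> (\<exists>J\<subseteq>I. J \<noteq> {} \<and> (\<Sum>i\<in>J. c (g i)) = 0 \<and> n dvd (\<Sum>i\<in>J. y (g i)))"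
    by (intro ex_cong1 conj_cong refl finprod_eq_one gJ)
  finally have "\<one> \<in> subseq_sums G (image_mset g (mset_set I)) \<longleftrightarrow>
      (\<exists>J\<subseteq>I. J \<noteq> {} \<and> (\<Sum>i\<in>J. c (g i)) = 0 \<and> n dvd (\<Sum>i\<in>J. y (g i)))" .
  moreover have "seq_over G (image_mset g (mset_set I))"
    using assms by (simp add: seq_over_def)
  ultimately show ?thesis unfolding zero_sum_free_def zsf_def by blast
qed

lemma index_two_subgroup:
  assumes H': "subgrp H'" "b \<notin> H'" "\<And>v. v \<in> H' \<or> v + b \<in> H'"
  obtains H \<alpha> where "subgroup H G" "card (rcosets H) = 2" "\<alpha> \<in> carrier G - H"
    "\<And>a. a \<in> carrier G \<Longrightarrow> c a + b \<in> H' \<Longrightarrow> a \<in> \<alpha> <# H"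
proof -
  define H where "H = {a \<in> carrier G. c a \<in> H'}"
  obtain \<alpha> where \<alpha>: "\<alpha> \<in> carrier G" "c \<alpha> = b" using coord_surj by blast
  have c_inv: "c (inv a) = c a" if "a \<in> carrier G" for a
    using c_mult[of a "inv a"] that c_one by (simp add: add_eq_0_iff_eq)
  have sub: "subgroup H G"
    by (rule subgroupI)
      (auto simp: H_def c_inv c_mult subgrp_add[OF H'(1)] intro!: exI[of _ \<one>] simp: c_one subgrp_0[OF H'(1)])
  have \<alpha>H: "\<alpha> \<notin> H" using \<alpha> H'(2) by (simp add: H_def)
  have coset: "a \<in> \<alpha> <# H" if a: "a \<in> carrier G" "c a + b \<in> H'" for a
  proof -
    have "inv \<alpha> \<otimes> a \<in> H" using a \<alpha> by (simp add: H_def c_mult c_inv add.commute)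
    moreover have "a = \<alpha> \<otimes> (inv \<alpha> \<otimes> a)" using a(1) \<alpha>(1) by (simp add: m_assoc[symmetric])
    ultimately show ?thesis unfolding l_coset_def by blast
  qed
  have HG: "H \<subseteq> carrier G" by (auto simp: H_def)
  have rc: "H #> a = H \<or> H #> a = H #> \<alpha>" if a: "a \<in> carrier G" for a
  proof (cases "a \<in> H")
    case True
    then show ?thesis using coset_join2[OF a sub] by simp
  next
    case False
    then have "c a + b \<in> H'" using H'(3)[of "c a"] a by (auto simp: H_def)
    then have "a \<otimes> inv \<alpha> \<in> H" using a \<alpha> by (simp add: H_def c_mult c_inv)
    moreover have "a = (a \<otimes> inv \<alpha>) \<otimes> \<alpha>" using a \<alpha>(1) by (simp add: m_assoc)
    ultimately have "a \<in> H #> \<alpha>" unfolding r_coset_def by blast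
    then have "H #> \<alpha> = H #> a" by (rule repr_independence[OF _ \<alpha>(1) sub])
    then show ?thesis by simp
  qed
  have "H #> \<one> = H" using coset_join2[OF one_closed sub subgroup.one_closed[OF sub]] .
  then have "rcosets H = {H, H #> \<alpha>}"
    unfolding RCOSETS_def using rc one_closed \<alpha>(1) by blast
  moreover have "H \<noteq> H #> \<alpha>" using rcos_self[OF \<alpha>(1) sub] \<alpha>H by auto
  ultimately have "card (rcosets H) = 2" by simp
  then show thesis using that[OF sub _ _ coset] \<alpha>(1) \<alpha>H by blast
qed

text \<open>If a nonzero element is no subsequence sum of \<open>T\<close>, its inverse can be
  appended to \<open>T\<close>, and so also to the first 2n + 3 terms, without creating a zero sum.
  An element and its inverse have the same label.\<close>

lemma missing_sums_in_coset:
  assumes T: "zero_sum_free G T" "2 * n + 3 \<le> int (size T)"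
  shows "\<exists>H \<alpha>. subgroup H G \<and> card (rcosets H) = 2 \<and> \<alpha> \<in> carrier G - H \<and>
    nonzero_elems G - subseq_sums G T \<subseteq> \<alpha> <# H"
proof -
  obtain g :: "nat \<Rightarrow> 'a" where g: "T = image_mset g (mset_set {..<size T})" by (rule ex_indexing)
  let ?N = "{..<size T}"
  define I where "I = {..<nat (2 * n + 3)}"
  define j where "j = nat (2 * n + 3)"
  have I: "finite I" "int (card I) = 2 * n + 3" "j \<notin> I" using n by (auto simp: I_def j_def)
  have IN: "I \<subseteq> ?N" using T(2) by (auto simp: I_def)
  have "seq_over G T" using T(1) by (simp add: zero_sum_free_def)
  then have gN: "g ` ?N \<subseteq> carrier G" unfolding seq_over_def by (subst (asm) g) simp
  have gI: "g ` I \<subseteq> carrier G" using gN IN by blast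
  have sums: "subseq_sums G T = {finprod G g J |J. J \<subseteq> ?N \<and> J \<noteq> {}}"
    by (subst g) (rule subseq_sums_image_mset[OF _ gN], simp)
  have "zsf n (\<lambda>i. c (g i)) (\<lambda>i. y (g i)) ?N"
    using T(1) zero_sum_free_iff[OF _ gN] g by simp
  then have zsf: "zsf n (\<lambda>i. c (g i)) (\<lambda>i. y (g i)) I"
    using IN unfolding zsf_def by (meson subset_trans)
  define A where "A = (\<lambda>a. (c (inv a), y (inv a))) ` (nonzero_elems G - subseq_sums G T)"
  have "separated (fst ` A)"
  proof (rule zsf_separated[OF V n I zsf])
    fix d b assume "(d, b) \<in> A"
    then obtain a where a: "a \<in> nonzero_elems G" "a \<notin> subseq_sums G T" "d = c (inv a)" "b = y (inv a)"
      by (auto simp: A_def)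
    have aG: "a \<in> carrier G" "a \<noteq> \<one>" using a(1) by (auto simp: nonzero_elems_def)
    show "zsf n ((\<lambda>i. c (g i))(j := d)) ((\<lambda>i. y (g i))(j := b)) (insert j I)"
      unfolding zsf_def
    proof (intro allI impI notI)
      fix J assume J: "J \<subseteq> insert j I" "J \<noteq> {}"
        and z: "sum ((\<lambda>i. c (g i))(j := d)) J = 0 \<and> n dvd sum ((\<lambda>i. y (g i))(j := b)) J"
      let ?h = "g(j := inv a)"
      have hJ: "?h ` J \<subseteq> carrier G" using J(1) gI aG(1) by auto
      have upd: "(\<lambda>i. c (g i))(j := d) = (\<lambda>i. c (?h i))" "(\<lambda>i. y (g i))(j := b) = (\<lambda>i. y (?h i))"
        using a(3,4) by auto
      have one: "finprod G ?h J = \<one>" using finprod_eq_one[OF hJ] z unfolding upd by blast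
      let ?J = "J - {j}"
      have JI: "?J \<subseteq> I" using J(1) by blast
      have fin: "finite ?J" using JI I(1) finite_subset by blast
      have gJ: "g \<in> ?J \<rightarrow> carrier G" using JI gI by blast
      have same: "finprod G ?h ?J = finprod G g ?J" by (rule finprod_cong') (use gJ in auto)
      show False
      proof (cases "j \<in> J")
        case False
        then have "?J = J" by blast
        then have "finprod G g J = \<one>" "J \<subseteq> ?N" using one same JI IN by auto
        moreover have "finprod G g J \<in> subseq_sums G T" unfolding sums using calculation(2) J(2) by blast
        ultimately have "\<one> \<in> subseq_sums G T" by simp
        then show False using T(1) by (simp add: zero_sum_free_def)
      next
        case True
        then have "finprod G ?h J = inv a \<otimes> finprod G ?h ?J"
          using finprod_insert[of ?J j ?h] fin hJ aG(1) by (auto simp: insert_absorb Pi_iff image_subset_iff)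
        then have "inv a \<otimes> finprod G g ?J = \<one>" using one same by simp
        then have fa: "finprod G g ?J = a"
          using aG(1) finprod_closed[OF gJ] by (metis inv_closed inv_equality inv_inv m_comm)
        then have "?J \<noteq> {}" using aG(2) by (metis finprod_empty)
        then have "a \<in> subseq_sums G T" unfolding sums using fa JI IN by blast
        then show False using a(2) by blast
      qed
    qed
  qed
  then obtain H' b where H': "subgrp H'" "b \<notin> H'" "\<And>v. v \<in> H' \<or> v + b \<in> H'"
    "\<And>v. v \<in> fst ` A \<Longrightarrow> v + b \<in> H'"
    unfolding separated_def by blast
  obtain H \<alpha> where H: "subgroup H G" "card (rcosets H) = 2" "\<alpha> \<in> carrier G - H"
    "\<And>a. a \<in> carrier G \<Longrightarrow> c a + b \<in> H' \<Longrightarrow> a \<in> \<alpha> <# H"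
    using index_two_subgroup[OF H'(1-3)] by blast
  have "nonzero_elems G - subseq_sums G T \<subseteq> \<alpha> <# H"
  proof
    fix a assume a: "a \<in> nonzero_elems G - subseq_sums G T"
    then have aG: "a \<in> carrier G" by (simp add: nonzero_elems_def)
    have "c a + c (inv a) = 0" using c_mult[OF aG inv_closed[OF aG]] aG c_one by simp
    then have "c (inv a) = c a" by (simp add: add_eq_0_iff_eq)
    moreover have "c (inv a) \<in> fst ` A" using a by (force simp: A_def)
    ultimately have "c a + b \<in> H'" using H'(4) by metis
    then show "a \<in> \<alpha> <# H" by (rule H(4)[OF aG])
  qed
  then show ?thesis using H(1-3) by blast
qed

end

text \<open>Two elements \<open>a\<close>, \<open>b\<close> of a zero-sum free sequence leave the three missing sums
  \<open>-a\<close>, \<open>-b\<close> and \<open>-(a + b)\<close> after their removal, and these do not lie in one coset \<open>\<alpha> + H\<close>.\<close>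

lemma (in comm_group) size_le_of_cosets:
  assumes coset: "\<And>T. zero_sum_free G T \<Longrightarrow> l \<le> size T \<Longrightarrow>
      \<exists>H \<alpha>. subgroup H G \<and> H \<subset> carrier G \<and> \<alpha> \<in> carrier G - H \<and>
        nonzero_elems G - subseq_sums G T \<subseteq> \<alpha> <# H"
    and T: "zero_sum_free G T"
  shows "size T \<le> l + 1"
proof (rule ccontr)
  assume big: "\<not> ?thesis"
  obtain g :: "nat \<Rightarrow> 'a" where g: "T = image_mset g (mset_set {..<size T})" by (rule ex_indexing)
  define m where "m = size T - 2"
  have sz: "size T = Suc (Suc m)" using big by (simp add: m_def)
  let ?I = "{..<m}"
  let ?T = "image_mset g (mset_set ?I)"
  have "seq_over G T" using T by (simp add: zero_sum_free_def)
  then have gN: "g ` {..<size T} \<subseteq> carrier G" unfolding seq_over_def by (subst (asm) g) simp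
  have gI: "g ` ?I \<subseteq> carrier G" using gN sz by auto
  have ab: "g m \<in> carrier G" "g (Suc m) \<in> carrier G" using gN sz by auto
  have sums: "subseq_sums G T = {finprod G g J |J. J \<subseteq> {..<size T} \<and> J \<noteq> {}}"
    by (subst g) (rule subseq_sums_image_mset[OF _ gN], simp)
  have nz: "finprod G g J \<noteq> \<one>" if "J \<subseteq> {..<size T}" "J \<noteq> {}" for J
  proof -
    have "finprod G g J \<in> subseq_sums G T" unfolding sums using that by blast
    then show ?thesis using T by (auto simp: zero_sum_free_def)
  qed
  have "?T \<subseteq># T"
    by (subst g) (rule image_mset_subseteq_mono, use sz in \<open>simp add: subset_imp_msubset_mset_set\<close>)
  then have "zero_sum_free G ?T" by (rule zero_sum_free_mono[OF T])
  moreover have "l \<le> size ?T" using big sz by simp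
  ultimately obtain H \<alpha> where H: "subgroup H G" "\<alpha> \<in> carrier G - H"
    "nonzero_elems G - subseq_sums G ?T \<subseteq> \<alpha> <# H"
    using coset by blast
  have mem: "inv (finprod G g B) \<in> \<alpha> <# H" if B: "B \<subseteq> {m, Suc m}" "B \<noteq> {}" for B
  proof -
    have BN: "B \<subseteq> {..<size T}" using B sz by auto
    have finB: "finite B" using BN finite_subset by blast
    have gB: "g \<in> B \<rightarrow> carrier G" using BN gN by blast
    have cl: "finprod G g B \<in> carrier G" by (rule finprod_closed[OF gB])
    have "inv (finprod G g B) \<notin> subseq_sums G ?T"
    proof
      assume "inv (finprod G g B) \<in> subseq_sums G ?T"
      then obtain J where J: "J \<subseteq> ?I" "J \<noteq> {}" "inv (finprod G g B) = finprod G g J"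
        unfolding subseq_sums_image_mset[OF finite_lessThan gI] by blast
      have "finprod G g (J \<union> B) = finprod G g J \<otimes> finprod G g B"
      proof (rule finprod_Un_disjoint)
        show "finite J" using J(1) finite_subset by blast
        have "i < m" if "i \<in> J" for i using that J(1) by blast
        moreover have "m \<le> i" if "i \<in> B" for i using that B(1) by auto
        ultimately show "J \<inter> B = {}" using leD by blast
        show "g \<in> J \<rightarrow> carrier G" using J(1) gI by blast
      qed (use finB gB in auto)
      then have "finprod G g (J \<union> B) = \<one>" using cl unfolding J(3)[symmetric] by simp
      moreover have "J \<union> B \<subseteq> {..<size T}" using J(1) BN sz by auto
      ultimately show False using nz[of "J \<union> B"] J(2) by blast
    qed
    moreover have "inv (finprod G g B) \<in> nonzero_elems G"
      using nz[OF BN B(2)] cl by (simp add: nonzero_elems_def inv_eq_1_iff)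
    ultimately show ?thesis using H(3) by blast
  qed
  have "finprod G g {m} = g m" "finprod G g {Suc m} = g (Suc m)" "finprod G g {m, Suc m} = g m \<otimes> g (Suc m)"
    using ab by simp_all
  then have "inv (g m) \<in> \<alpha> <# H" "inv (g (Suc m)) \<in> \<alpha> <# H" "inv (g m \<otimes> g (Suc m)) \<in> \<alpha> <# H"
    using mem[of "{m}"] mem[of "{Suc m}"] mem[of "{m, Suc m}"] by simp_all
  then obtain h1 h2 h3 where h: "h1 \<in> H" "h2 \<in> H" "h3 \<in> H"
    "inv (g m) = \<alpha> \<otimes> h1" "inv (g (Suc m)) = \<alpha> \<otimes> h2" "inv (g m \<otimes> g (Suc m)) = \<alpha> \<otimes> h3"
    unfolding l_coset_def by blast
  have hG: "h1 \<in> carrier G" "h2 \<in> carrier G" "h3 \<in> carrier G" "\<alpha> \<in> carrier G"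
    using h(1-3) H(1,2) subgroup.subset by blast+
  \<comment> \<open>A coset that contains two elements and their product is the subgroup
    itself.\<close>
  have "\<alpha> \<otimes> h3 = (\<alpha> \<otimes> h1) \<otimes> (\<alpha> \<otimes> h2)" using h(4-6) ab by (simp add: inv_mult)
  also have "\<dots> = \<alpha> \<otimes> (\<alpha> \<otimes> (h1 \<otimes> h2))" using hG by (simp add: m_ac)
  finally have "h3 = \<alpha> \<otimes> (h1 \<otimes> h2)" using hG by simp
  then have "\<alpha> = h3 \<otimes> inv (h1 \<otimes> h2)" using hG by (simp add: m_assoc)
  moreover have "h3 \<otimes> inv (h1 \<otimes> h2) \<in> H"
    using h(1-3) by (intro subgroup.m_closed[OF H(1)] subgroup.m_inv_closed[OF H(1)])
  ultimately show False using H(2) by simp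
qed

section \<open>The extremal sequence and the coordinates\<close>

lemma UNIV_bit: "UNIV = {0, 1 :: bit}"
  by (auto intro: bit.exhaust)

instance bit :: finite
  by standard (simp add: UNIV_bit)

lemma card_UNIV_bit: "card (UNIV :: bit set) = 2"
  by (simp add: UNIV_bit)

lemma card_UNIV_prod: "card (UNIV :: ('a \<times> 'b) set) = card (UNIV :: 'a set) * card (UNIV :: 'b set)"
  by (simp add: card_cartesian_product flip: UNIV_Times_UNIV)

lemma of_int_bit: "(of_int k :: bit) = (if even k then 0 else 1)"
proof (cases "even k")
  case True
  then obtain m where "k = 2 * m" by (rule evenE)
  then show ?thesis by simp
next
  case False
  then obtain m where "k = 2 * m + 1" by (rule oddE)
  then show ?thesis by simp
qed

text \<open>The extremal sequence consists of \<open>2n - 4\<close> copies of an element, indexed by \<open>Inl\<close>, and of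
  eight elements indexed by the points of \<open>C\<^sub>2\<^sup>3\<close>, of which the one at the origin is modified.\<close>

definition ext_label :: "nat + bit \<times> bit \<times> bit \<Rightarrow> bit \<times> bit \<times> bit \<times> bit \<times> bit" where
  "ext_label = case_sum (\<lambda>_. (1, 0, 0)) (\<lambda>s. (if s = 0 then 1 else 0, 1, s))"

definition ext_value :: "nat + bit \<times> bit \<times> bit \<Rightarrow> int" where
  "ext_value = case_sum (\<lambda>_. 2) (\<lambda>s. if s = 0 then - 1 else 1)"

definition ext_index :: "int \<Rightarrow> (nat + bit \<times> bit \<times> bit) set" where
  "ext_index n = Inl ` {..<nat (2 * n - 4)} \<union> range Inr"

lemma ext_index: "finite (ext_index n)" "card (ext_index n) = nat (2 * n - 4) + 8"
proof -
  show "finite (ext_index n)" by (simp add: ext_index_def)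
  have "card (ext_index n) = card (Inl ` {..<nat (2 * n - 4)} :: (nat + bit \<times> bit \<times> bit) set)
      + card (range Inr :: (nat + bit \<times> bit \<times> bit) set)"
    unfolding ext_index_def by (rule card_Un_disjoint) auto
  then show "card (ext_index n) = nat (2 * n - 4) + 8"
    by (simp add: card_image card_UNIV_prod card_UNIV_bit)
qed

text \<open>Two points with sum 0 coincide, so size 2 is impossible. All eight points sum to 0,
  hence the complement also has sum 0, and size 6 is impossible too.\<close>

lemma zero_sum_points:
  fixes S :: "(bit \<times> bit \<times> bit) set"
  assumes "even (card S)" "\<Sum>S = 0"
  shows "card S = 0 \<or> card S = 4 \<or> card S = 8"
proof -
  have U8: "card (UNIV :: (bit \<times> bit \<times> bit) set) = 8" by (simp add: card_UNIV_prod card_UNIV_bit)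
  have no2: "card T \<noteq> 2" if "\<Sum>T = 0" for T :: "(bit \<times> bit \<times> bit) set"
  proof
    assume "card T = 2"
    then obtain s t where "T = {s, t}" "s \<noteq> t" unfolding card_2_iff by blast
    then show False using that by (simp add: add_eq_0_iff_eq)
  qed
  have U: "(UNIV :: (bit \<times> bit \<times> bit) set) =
      {(0, 0, 0), (0, 0, 1), (0, 1, 0), (0, 1, 1), (1, 0, 0), (1, 0, 1), (1, 1, 0), (1, 1, 1)}"
    unfolding UNIV_Times_UNIV[symmetric] UNIV_bit by auto
  have U0: "(\<Sum>s\<in>(UNIV :: (bit \<times> bit \<times> bit) set). s) = 0" unfolding U by (simp add: zero_prod_def)
  have "(\<Sum>s\<in>UNIV. s) = \<Sum>(UNIV - S) + \<Sum>S" by (rule sum.subset_diff) auto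
  then have "\<Sum>(UNIV - S) = 0" using U0 assms(2) by simp
  then have "card (UNIV - S) \<noteq> 2" by (rule no2)
  moreover have "card (UNIV - S) = 8 - card S" using U8 by (simp add: card_Diff_subset)
  moreover have "card S \<le> 8" using card_mono[of UNIV S] U8 by simp
  moreover have "card S \<noteq> 2" by (rule no2[OF assms(2)])
  ultimately show ?thesis using assms(1) by presburger
qed

text \<open>The labels make |S| equal to 0, 4 or 8, and k odd exactly when the origin is in
  \<open>S\<close>. Half of the value, k + |S| / 2, less 1 if the origin is in \<open>S\<close>, is
  then even, and k \<le> 2n - 4 keeps it below 2n. As n is odd, it is divisible by n only when it is
  0, that is for empty \<open>J\<close>.\<close>

lemma zsf_ext:
  assumes n: "odd n" "2 < n"
  shows "zsf n ext_label ext_value (ext_index n)"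
  unfolding zsf_def
proof (intro allI impI notI)
  fix J assume J: "J \<subseteq> ext_index n" "J \<noteq> {}" and z: "sum ext_label J = 0 \<and> n dvd sum ext_value J"
  define K where "K = Inl -` J"
  define S where "S = Inr -` J"
  have KS: "J = Inl ` K \<union> Inr ` S"
  proof
    show "J \<subseteq> Inl ` K \<union> Inr ` S"
    proof
      fix i assume "i \<in> J" then show "i \<in> Inl ` K \<union> Inr ` S" by (cases i) (auto simp: K_def S_def)
    qed
  qed (auto simp: K_def S_def)
  have K: "K \<subseteq> {..<nat (2 * n - 4)}" using J(1) by (auto simp: K_def ext_index_def)
  have finK: "finite K" using K finite_subset by blast
  have finS: "finite S" by simp
  have split: "sum f J = (\<Sum>i\<in>K. f (Inl i)) + (\<Sum>s\<in>S. f (Inr s))" for f :: "_ \<Rightarrow> 'x::comm_monoid_add"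
  proof -
    have "sum f J = sum f (Inl ` K) + sum f (Inr ` S)"
      unfolding KS by (rule sum.union_disjoint) (use finK finS in auto)
    then show ?thesis by (simp add: sum.reindex)
  qed
  let ?p = "0 \<in> S"
  have del: "(\<Sum>s\<in>S. if s = 0 then a else b) = (\<Sum>s\<in>S - {0}. b) + (if ?p then a else 0)"
    for a b :: "'x::comm_monoid_add"
  proof -
    have "(\<Sum>s\<in>S - {0}. if s = 0 then a else b) = (\<Sum>s\<in>S - {0}. b)" by (rule sum.cong) auto
    then show ?thesis
      using sum.remove[OF finS, of 0 "\<lambda>s. if s = 0 then a else b"] by (cases ?p) (simp_all add: add.commute)
  qed
  have ones: "(\<Sum>i\<in>B. 1 :: bit) = scal (card B) 1" for B :: "'x set"
    by (rule sum_const_char_two) simp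
  have lab: "sum ext_label J = ((\<Sum>i\<in>K. 1) + (\<Sum>s\<in>S. if s = 0 then 1 else 0), (\<Sum>s\<in>S. 1), \<Sum>S)"
    unfolding split[of ext_label] by (simp add: ext_label_def prod_eq_iff fst_sum snd_sum)
  have "even (card S)" using z unfolding lab ones by (auto simp: zero_prod_def scal_def split: if_splits)
  moreover have "\<Sum>S = 0" using z unfolding lab by (simp add: zero_prod_def)
  ultimately have cS: "card S = 0 \<or> card S = 4 \<or> card S = 8" by (rule zero_sum_points)
  have pK: "even (card K) \<longleftrightarrow> \<not> ?p"
    using z unfolding lab ones del by (auto simp: zero_prod_def scal_def split: if_splits)
  define k where "k = int (card K)"
  have k: "0 \<le> k" "k \<le> 2 * n - 4" "even k \<longleftrightarrow> \<not> ?p"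
    using card_mono[OF _ K] n pK by (auto simp: k_def)
  have "sum ext_value J = 2 * k + (int (card (S - {0})) + (if ?p then - 1 else 0))"
    unfolding split[of ext_value] by (simp add: ext_value_def k_def del)
  also have "int (card (S - {0})) = int (card S) - (if ?p then 1 else 0)"
    using card_gt_0_iff[of S] by (cases ?p) (auto simp: of_nat_diff Suc_leI)
  finally have dv: "n dvd 2 * k + int (card S) - (if ?p then 2 else 0)"
    using z by (auto simp: add_diff_eq split: if_splits)
  have half: "q = 0 \<or> q = n" if q: "n dvd 2 * q" "0 \<le> q" "q < 2 * n" for q
  proof -
    have "n dvd q" using q(1) n(1) by (metis coprime_commute coprime_dvd_mult_right_iff coprime_left_2_iff_odd)
    then obtain r where r: "q = n * r" by (rule dvdE)
    have "0 \<le> r" "r < 2" using q(2,3) n(2) unfolding r by (auto simp: zero_le_mult_iff)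
    then have "r = 0 \<or> r = 1" by linarith
    then show ?thesis using r by auto
  qed
  show False
    using cS
  proof (elim disjE)
    assume 0: "card S = 0"
    then have S0: "S = {}" using finS by simp
    then have "k = 0 \<or> k = n" using half[of k] dv 0 k by simp
    then have "k = 0" using k(3) S0 n(1) by auto
    then show False using J(2) KS S0 finK by (simp add: k_def)
  next
    assume 4: "card S = 4"
    show False
    proof (cases ?p)
      case True
      then have "k + 1 = 0 \<or> k + 1 = n" using half[of "k + 1"] dv 4 k by (simp add: algebra_simps)
      then show False using k(1,3) True n(1) by auto
    next
      case False
      then have "k + 2 = 0 \<or> k + 2 = n" using half[of "k + 2"] dv 4 k by (simp add: algebra_simps)
      then show False using k(1,3) False n(1) by auto
    qed
  next
    assume 8: "card S = 8"
    have "card (UNIV :: (bit \<times> bit \<times> bit) set) = 8" by (simp add: card_UNIV_prod card_UNIV_bit)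
    then have "S = UNIV" using 8 card_subset_eq[of UNIV S] by simp
    then have p: ?p by simp
    then have "k + 3 = 0 \<or> k + 3 = n" using half[of "k + 3"] dv 8 k by (simp add: algebra_simps)
    then show False using k(1,3) p n(1) by auto
  qed
qed

lemma (in coordinates) ex_sequence:
  fixes cv :: "'i \<Rightarrow> 'v" and yv :: "'i \<Rightarrow> int"
  assumes "finite I" "zsf n cv yv I"
  obtains T where "zero_sum_free G T" "size T = card I"
proof -
  define g where "g i = (SOME a. a \<in> carrier G \<and> c a = cv i \<and> [y a = yv i] (mod n))" for i
  have g: "g i \<in> carrier G" "c (g i) = cv i" "[y (g i) = yv i] (mod n)" for i
    using someI_ex[of "\<lambda>a. a \<in> carrier G \<and> c a = cv i \<and> [y a = yv i] (mod n)"] coord_surj[of "cv i" "yv i"]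
    unfolding g_def by blast+
  have "n dvd (\<Sum>i\<in>J. y (g i)) \<longleftrightarrow> n dvd sum yv J" for J
    by (rule cong_dvd_iff) (rule cong_sum, rule g)
  then have "zsf n (\<lambda>i. c (g i)) (\<lambda>i. y (g i)) I" using assms(2) by (simp add: zsf_def g(2))
  then have "zero_sum_free G (image_mset g (mset_set I))"
    using zero_sum_free_iff[OF assms(1), of g] g(1) by blast
  then show thesis by (rule that) simp
qed

text \<open>A subgroup missing \<alpha> is proper, so \<open>P2\<close> implies \<open>P\<close>. By
  \<open>size_le_of_cosets\<close> any l with \<open>P l\<close> satisfies |T0| \<le> l + 1, which
  makes 2n + 3 least for both; the same bound at l = 2n + 3 gives the Davenport constant.\<close>

lemma (in coordinates) nu_values:
  assumes T0: "zero_sum_free G T0" "int (size T0) = 2 * n + 4"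
  shows "nu G = nat (2 * n + 3)" "nu_prime 2 G = nat (2 * n + 3)" "small_davenport G = nat (2 * n + 4)"
proof -
  let ?l = "nat (2 * n + 3)"
  define P2 where "P2 l \<longleftrightarrow> (\<forall>T. zero_sum_free G T \<and> l \<le> size T \<longrightarrow>
     (\<exists>H \<alpha>. subgroup H G \<and> card (rcosets H) = 2 \<and> \<alpha> \<in> carrier G - H \<and>
        nonzero_elems G - subseq_sums G T \<subseteq> \<alpha> <# H))" for l
  define P where "P l \<longleftrightarrow> (\<forall>T. zero_sum_free G T \<and> l \<le> size T \<longrightarrow>
     (\<exists>H \<alpha>. subgroup H G \<and> H \<subset> carrier G \<and> \<alpha> \<in> carrier G - H \<and>
        nonzero_elems G - subseq_sums G T \<subseteq> \<alpha> <# H))" for l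
  have P2: "P2 ?l"
    unfolding P2_def using missing_sums_in_coset by (simp add: nat_le_iff)
  have P2P: "P l" if p2: "P2 l" for l
    unfolding P_def
  proof (intro allI impI)
    fix T assume "zero_sum_free G T \<and> l \<le> size T"
    then obtain H \<alpha> where H: "subgroup H G" "\<alpha> \<in> carrier G - H"
      "nonzero_elems G - subseq_sums G T \<subseteq> \<alpha> <# H"
      using p2[unfolded P2_def] by meson
    have "H \<subset> carrier G" using H(2) subgroup.subset[OF H(1)] by blast
    then show "\<exists>H \<alpha>. subgroup H G \<and> H \<subset> carrier G \<and> \<alpha> \<in> carrier G - H \<and>
        nonzero_elems G - subseq_sums G T \<subseteq> \<alpha> <# H"
      using H by blast
  qed
  have bound: "size T \<le> l + 1" if "P l" "zero_sum_free G T" for l T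
    by (rule size_le_of_cosets[OF _ that(2)]) (use that(1) in \<open>simp add: P_def\<close>)
  have low: "?l \<le> l" if "P l" for l
    using bound[OF that T0(1)] T0(2) n by linarith
  have "(LEAST l. P l) = ?l" by (rule Least_equality) (use P2P[OF P2] low in auto)
  then show "nu G = ?l" by (simp add: nu_def P_def)
  have "(LEAST l. P2 l) = ?l" by (rule Least_equality) (use P2 P2P low in auto)
  then show "nu_prime 2 G = ?l" by (simp add: nu_prime_def P2_def)
  have le: "size T \<le> nat (2 * n + 4)" if "zero_sum_free G T" for T
    using bound[OF P2P[OF P2] that] n by linarith
  have "Max {size T |T. zero_sum_free G T} = nat (2 * n + 4)"
  proof (rule Max_eqI)
    have "{size T |T. zero_sum_free G T} \<subseteq> {..nat (2 * n + 4)}" using le by auto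
    then show "finite {size T |T. zero_sum_free G T}" by (rule finite_subset) simp
    have "size T0 = nat (2 * n + 4)" using T0(2) by linarith
    then show "nat (2 * n + 4) \<in> {size T |T. zero_sum_free G T}" using T0(1) by (metis (mono_tags) mem_Collect_eq)
  qed (use le in auto)
  then show "small_davenport G = nat (2 * n + 4)" by (simp add: small_davenport_def)
qed

text \<open>For odd n the factor C_2n splits as C_2 + C_n: a residue modulo 2n contributes its
  parity to the label and its class modulo n to the second coordinate.\<close>

lemma ex_coordinates:
  fixes G (structure)
  assumes "comm_group G"
    and iso: "G \<cong> product_group {..<4::nat} (\<lambda>_. integer_mod_group 2) \<times>\<times> integer_mod_group (2 * n)"
    and n: "odd n" "n > 70"
  shows "\<exists>(c :: _ \<Rightarrow> bit \<times> bit \<times> bit \<times> bit \<times> bit) y. coordinates G c y (int n)"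
proof -
  interpret comm_group G by (rule assms(1))
  let ?P = "product_group {..<4::nat} (\<lambda>_. integer_mod_group 2)"
  let ?Z = "integer_mod_group (2 * n)"
  obtain h where h: "h \<in> iso G (?P \<times>\<times> ?Z)" using iso by (auto simp: is_iso_def)
  have bij: "bij_betw h (carrier G) (carrier ?P \<times> carrier ?Z)"
    and mult: "\<And>a b. a \<in> carrier G \<Longrightarrow> b \<in> carrier G \<Longrightarrow> h (a \<otimes> b) = h a \<otimes>\<^bsub>?P \<times>\<times> ?Z\<^esub> h b"
    using h by (auto simp: iso_def hom_def)
  have Z: "carrier ?Z = {0..<2 * int n}" "\<And>u v. u \<otimes>\<^bsub>?Z\<^esub> v = (u + v) mod (2 * int n)"
    using n by (simp_all add: integer_mod_group_def)
  have Z2: "carrier (integer_mod_group 2) = {0..<2}" "\<And>u v. u \<otimes>\<^bsub>integer_mod_group 2\<^esub> v = (u + v) mod 2"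
    by (simp_all add: integer_mod_group_def)
  let ?f = "\<lambda>a. fst (h a)" and ?z = "\<lambda>a. snd (h a)"
  have hz: "?z (a \<otimes> b) = (?z a + ?z b) mod (2 * int n)"
    and hf: "\<And>i. i < 4 \<Longrightarrow> ?f (a \<otimes> b) i = (?f a i + ?f b i) mod 2"
    if "a \<in> carrier G" "b \<in> carrier G" for a b
    using mult[OF that] by (simp_all add: mult_DirProd' Z Z2)
  have hmem: "?f a \<in> {..<4} \<rightarrow>\<^sub>E {0..<2}" "?z a \<in> {0..<2 * int n}" if "a \<in> carrier G" for a
    using bij_betwE[OF bij] that by (auto simp: Z Z2 mem_Times_iff)
  define c :: "'a \<Rightarrow> bit \<times> bit \<times> bit \<times> bit \<times> bit" where
    "c a = (of_int (?z a), of_int (?f a 0), of_int (?f a 1), of_int (?f a 2), of_int (?f a 3))" for a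
  have "coordinates G c ?z (int n)"
  proof (unfold_locales)
    show "card (UNIV :: (bit \<times> bit \<times> bit \<times> bit \<times> bit) set) = 32"
      by (simp add: card_UNIV_prod card_UNIV_bit)
    show "odd (int n)" "70 < int n" using n by simp_all
    fix a b assume ab: "a \<in> carrier G" "b \<in> carrier G"
    have "(of_int ((u + v) mod 2) :: bit) = of_int u + of_int v"
      "(of_int ((u + v) mod (2 * int n)) :: bit) = of_int u + of_int v" for u v :: int
      by (auto simp: of_int_bit even_add dvd_mod_iff)
    then show "c (a \<otimes> b) = c a + c b" by (simp add: c_def hz[OF ab] hf[OF ab])
    have "[?z a + ?z b = (?z a + ?z b) mod (2 * int n)] (mod (2 * int n))" by (simp add: cong_def)
    then have "[?z a + ?z b = ?z (a \<otimes> b)] (mod (int n))"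
      unfolding hz[OF ab] by (rule cong_dvd_modulus) simp
    then show "[?z (a \<otimes> b) = ?z a + ?z b] (mod (int n))" by (rule cong_sym)
  next
    fix a assume a: "a \<in> carrier G" "c a = 0" "int n dvd ?z a"
    have ev: "even (?z a)" "even (?f a 0)" "even (?f a 1)" "even (?f a 2)" "even (?f a 3)"
      using a(2) by (simp_all add: c_def zero_prod_def of_int_bit split: if_splits)
    have "coprime (2 :: int) (int n)" using n by simp
    then have "2 * int n dvd ?z a" using divides_mult ev(1) a(3) by blast
    then have z0: "?z a = 0" using hmem(2)[OF a(1)] by (auto dest: zdvd_imp_le simp: zdvd_not_zless)
    have f0: "?f a i = 0" if "i < 4" for i
    proof -
      have "i = 0 \<or> i = 1 \<or> i = 2 \<or> i = 3" using that by auto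
      then have "even (?f a i)" using ev by auto
      moreover have "?f a i \<in> {0..<2}" using hmem(1)[OF a(1)] that by (auto simp: PiE_iff)
      ultimately show ?thesis by auto
    qed
    have z1: "?z \<one> = 0"
    proof -
      have "?z \<one> = (?z \<one> + ?z \<one>) mod (2 * int n)"
        using hz[OF one_closed one_closed] unfolding r_one[OF one_closed] .
      from arg_cong[OF this, of "\<lambda>t. t mod (2 * int n)"]
      have "[?z \<one> + ?z \<one> = ?z \<one>] (mod (2 * int n))"
        by (simp only: cong_def mod_mod_trivial)
      then have "2 * int n dvd ?z \<one>" by (simp add: cong_iff_dvd_diff)
      moreover have "0 \<le> ?z \<one>" "?z \<one> < 2 * int n" using hmem(2)[of \<one>] by simp_all
      ultimately show ?thesis using zdvd_not_zless[of "?z \<one>" "2 * int n"] by linarith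
    qed
    have f1: "?f \<one> i = 0" if "i < 4" for i
    proof -
      have "?f \<one> i \<in> {0..<2}" using hmem(1)[of \<one>] that by (auto simp: PiE_iff)
      then show ?thesis using hf[of \<one> \<one> i] that by auto
    qed
    have "?f a = ?f \<one>"
      by (rule PiE_ext[OF hmem(1)[OF a(1)] hmem(1)]) (use f0 f1 in auto)
    then have "h a = h \<one>" using z0 z1 by (simp add: prod_eq_iff)
    then show "a = \<one>" using bij_betw_imp_inj_on[OF bij] a(1) by (simp add: inj_on_eq_iff)
  next
    fix v :: "bit \<times> bit \<times> bit \<times> bit \<times> bit" and k :: int
    obtain v0 v1 v2 v3 v4 where v: "v = (v0, v1, v2, v3, v4)" by (metis prod.exhaust)
    let ?b = "\<lambda>w :: bit. if w = 0 then 0 else 1 :: int"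
    have bb: "of_int (?b w) = w" for w by (cases w) auto
    define f where "f = (\<lambda>i\<in>{..<4::nat}. ?b ([v1, v2, v3, v4] ! i))"
    define r where "r = k mod int n"
    have r: "0 \<le> r" "r < int n" "[r = k] (mod (int n))" using n by (auto simp: r_def cong_def)
    \<comment> \<open>The lift of \<open>k\<close> to [0, 2n) with prescribed parity;
      \<open>r\<close> and \<open>r + int n\<close> differ in parity.\<close>
    define z where "z = (if (of_int r :: bit) = v0 then r else r + int n)"
    have z: "z \<in> {0..<2 * int n}" "[z = k] (mod (int n))" "of_int z = v0"
    proof -
      show "z \<in> {0..<2 * int n}" using r by (auto simp: z_def)
      show "[z = k] (mod (int n))" using r(3) by (auto simp: z_def cong_def)
      show "of_int z = v0" using n(1) by (cases v0) (auto simp: z_def of_int_bit)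
    qed
    have "f \<in> {..<4} \<rightarrow>\<^sub>E {0..<2}" by (auto simp: f_def)
    then have "(f, z) \<in> carrier ?P \<times> carrier ?Z" using z(1) by (simp add: Z Z2)
    then obtain a where a: "a \<in> carrier G" "h a = (f, z)" using bij unfolding bij_betw_def by (metis imageE)
    have "c a = v" using a(2) z(3) bb by (simp add: c_def v f_def numeral_eq_Suc)
    then show "\<exists>a\<in>carrier G. c a = v \<and> [?z a = k] (mod (int n))" using a z(2) by force
  qed
  then show ?thesis by blast
qed

theorem theorem5p5:
  fixes G :: "('a, 'b) monoid_scheme" and n :: nat
  assumes "comm_group G"
    and "G \<cong> product_group {..<4::nat} (\<lambda>_. integer_mod_group 2) \<times>\<times> integer_mod_group (2 * n)"
    and "odd n" and "n > 70"
  shows "nu G = nu_prime 2 G \<and> int (nu_prime 2 G) = int (small_davenport G) - 1"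
proof -
  obtain c :: "'a \<Rightarrow> bit \<times> bit \<times> bit \<times> bit \<times> bit" and y where "coordinates G c y (int n)"
    using ex_coordinates[OF assms] by blast
  then interpret coordinates G c y "int n" .
  have "zsf (int n) ext_label ext_value (ext_index (int n))"
    by (rule zsf_ext) (use assms(3,4) in auto)
  then obtain T where T: "zero_sum_free G T" "size T = card (ext_index (int n))"
    by (rule ex_sequence[OF ext_index(1)])
  have "int (size T) = 2 * int n + 4"
    using T(2) ext_index(2)[of "int n"] assms(4) by simp
  from nu_values[OF T(1) this] show ?thesis by simp
qed

end
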